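(* Let $\mathscr D\subset\mathbb T$ be a set whose boundary has Lebesgue measure zero and with $|\mathscr D|>0$, let $\varphi:\mathbb T\to\mathbb C$ be Riemann integrable, and fix a positive integer $N$. For each $q\in\mathbb N$ let $p$ be chosen uniformly at random from $\{p\in\mathbb Z_q^\times : p/q \bmod 1\in\mathscr D\}$. Then, with $q\to\infty$ always restricted to integers with $d(q)\le N$, the following convergences in distribution hold: (1) through $q\equiv 0\bmod 4$, $q$ not a square: $\big(\frac{g_1(p,q)}{\sqrt q},\frac{g_\varphi(p,q)}{g_1(p,q)}\big)\xrightarrow{d}(X,G^+_\varphi)$; (2) through $q\equiv 0\bmod 4$, $q$ a square: $\big(\frac{g_1(p,q)}{\sqrt q},\frac{g_\varphi(p,q)}{g_1(p,q)}\big)\xrightarrow{d}(Z,G^+_\varphi)$; (3) through odd non-square $q$: $\big(\frac{g_1(p,q)}{\epsilon_q\sqrt q},\frac{g_\varphi(p,q)}{g_1(p,q)}\big)\xrightarrow{d}(Y,G_\varphi)$; (4) through odd square $q$: $\frac{g_\varphi(p,q)}{\epsilon_q\sqrt q}\xrightarrow{d}G_\varphi$; (5) through $q\equiv 2\bmod 4$ with $q/2$ not a square: $\big(\frac{g_1(2p,q/2)}{\epsilon_{q/2}\sqrt{q/2}},\frac{g_\varphi(p,q)}{2g_1(2p,q/2)}\big)\xrightarrow{d}(Y,G^-_\varphi)$; (6) through $q\equiv 2\bmod 4$ with $q/2$ a square: $\frac{g_\varphi(p,q)}{\epsilon_{q/2}\sqrt{2q}}\xrightarrow{d}G^-_\varphi$.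 Moreover (again with $d(q)\le N$): through $q\equiv0\bmod4$, $\frac{|g_\varphi(p,q)|}{\sqrt{2q}}\xrightarrow{d}|G^+_\varphi|$; through odd $q$, $\frac{|g_\varphi(p,q)|}{\sqrt q}\xrightarrow{d}|G_\varphi|$; through $q\equiv2\bmod4$, $\frac{|g_\varphi(p,q)|}{\sqrt{2q}}\xrightarrow{d}|G^-_\varphi|$.
   Context: $\mathbb T=\mathbb R/\mathbb Z$ with Lebesgue measure $|\cdot|$. $d(q)$ is the number of positive divisors of $q$. $\mathbb Z_q^\times=\{p\in\{1,\dots,q\}:\gcd(p,q)=1\}$. $e(x)=e^{2\pi i x}$, $e_q(x)=e^{2\pi i x/q}$. $g_\varphi(p,q)=\sum_{h=0}^{q-1}\varphi(h/q)\,e_q(ph^2)$; $g_1$ is the case $\varphi\equiv1$. $\widehat\varphi_k=\int_0^1\varphi(x)e(-kx)\,dx$. For $a$ an integer, $\epsilon_a=1$ if $a\equiv1\bmod4$, $\epsilon_a=i$ if $a\equiv3\bmod4$. Random variables: $X$ uniform on $\{\pm1\pm i\}$; $Y$ uniform on $\{\pm1\}$; $Z$ uniform on $\{1\pm i\}$; with $x$ uniform on $\mathbb T$, $G^+_\varphi=\sum_{n\in\mathbb Z}\widehat\varphi_{2n}e(n^2x)$, $G_\varphi=\sum_{n\in\mathbb Z}\widehat\varphi_{n}e(n^2x)$, $G^-_\varphi=\sum_{n\in 2\mathbb Z+1}\widehat\varphi_{n}e(n^2x)$ (series converging in $L^2(\mathbb T)$). In each limiting pair the two components are independent. *)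

theory Defs
  imports "HOL-Probability.Probability"
begin

text \<open>The circle T = R/Z is represented by 1-periodic objects on the reals.\<close>

definition e :: "real \<Rightarrow> complex" where
  "e x = exp (2 * of_real pi * \<i> * of_real x)"

definition gsum :: "(real \<Rightarrow> complex) \<Rightarrow> nat \<Rightarrow> nat \<Rightarrow> complex" where
  "gsum \<phi> p q = (\<Sum>h<q. \<phi> (real h / real q) * e (real (p * h ^ 2) / real q))"

abbreviation g1 :: "nat \<Rightarrow> nat \<Rightarrow> complex" where
  "g1 \<equiv> gsum (\<lambda>_. 1)"

definition fcoeff :: "(real \<Rightarrow> complex) \<Rightarrow> int \<Rightarrow> complex" where
  "fcoeff \<phi> k = integral {0..1} (\<lambda>x. \<phi> x * e (- (real_of_int k * x)))"

definition num_divisors :: "nat \<Rightarrow> nat" where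
  "num_divisors q = card {d. d dvd q}"

definition eps_sym :: "nat \<Rightarrow> complex" where
  "eps_sym a = (if a mod 4 = 1 then 1 else \<i>)"

definition is_square :: "nat \<Rightarrow> bool" where
  "is_square q \<longleftrightarrow> (\<exists>k. q = k ^ 2)"

definition riemann_int_real :: "(real \<Rightarrow> real) \<Rightarrow> real \<Rightarrow> real \<Rightarrow> bool" where
  "riemann_int_real f a b \<longleftrightarrow> bounded (f ` {a..b}) \<and>
     (\<forall>\<epsilon>>0. \<exists>(n::nat) (x::nat \<Rightarrow> real). x 0 = a \<and> x n = b \<and> (\<forall>i<n. x i < x (Suc i)) \<and>
        (\<Sum>i<n. (x (Suc i) - x i) *
            ((SUP t\<in>{x i..x (Suc i)}. f t) - (INF t\<in>{x i..x (Suc i)}. f t))) < \<epsilon>)"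

definition riemann_int :: "(real \<Rightarrow> complex) \<Rightarrow> real \<Rightarrow> real \<Rightarrow> bool" where
  "riemann_int f a b \<longleftrightarrow> riemann_int_real (\<lambda>x. Re (f x)) a b \<and> riemann_int_real (\<lambda>x. Im (f x)) a b"

definition unifT :: "real measure" where
  "unifT = uniform_measure lborel {0..1}"

definition L2_lim :: "(nat \<Rightarrow> real \<Rightarrow> complex) \<Rightarrow> real \<Rightarrow> complex" where
  "L2_lim s = (SOME g. g \<in> borel_measurable lborel \<and>
      ((\<lambda>M. \<integral>\<^sup>+ x\<in>{0..1}. ennreal ((cmod (s M x - g x))\<^sup>2) \<partial>lborel) \<longlongrightarrow> 0) sequentially)"

definition Gplus :: "(real \<Rightarrow> complex) \<Rightarrow> real \<Rightarrow> complex" where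
  "Gplus \<phi> = L2_lim (\<lambda>M x. \<Sum>n\<in>{- int M..int M}. fcoeff \<phi> (2 * n) * e (real_of_int (n ^ 2) * x))"

definition Gfull :: "(real \<Rightarrow> complex) \<Rightarrow> real \<Rightarrow> complex" where
  "Gfull \<phi> = L2_lim (\<lambda>M x. \<Sum>n\<in>{- int M..int M}. fcoeff \<phi> n * e (real_of_int (n ^ 2) * x))"

definition Gminus :: "(real \<Rightarrow> complex) \<Rightarrow> real \<Rightarrow> complex" where
  "Gminus \<phi> = L2_lim (\<lambda>M x. \<Sum>n\<in>{n\<in>{- int M..int M}. odd n}. fcoeff \<phi> n * e (real_of_int (n ^ 2) * x))"

definition lawT :: "(real \<Rightarrow> 'a::topological_space) \<Rightarrow> 'a measure" where
  "lawT G = distr unifT borel G"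

definition lawX :: "complex measure" where
  "lawX = measure_pmf (pmf_of_set {1 + \<i>, 1 - \<i>, -1 + \<i>, -1 - \<i>})"
definition lawY :: "complex measure" where
  "lawY = measure_pmf (pmf_of_set {1, -1})"
definition lawZ :: "complex measure" where
  "lawZ = measure_pmf (pmf_of_set {1 + \<i>, 1 - \<i>})"

definition adm :: "real set \<Rightarrow> nat \<Rightarrow> nat set" where
  "adm D q = {p \<in> {1..q}. coprime p q \<and> frac (real p / real q) \<in> D}"

definition sample_law :: "real set \<Rightarrow> (nat \<Rightarrow> nat \<Rightarrow> 'a) \<Rightarrow> nat \<Rightarrow> 'a measure" where
  "sample_law D V q = measure_pmf (map_pmf (\<lambda>p. V p q) (pmf_of_set (adm D q)))"

definition through :: "nat set \<Rightarrow> nat filter" where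
  "through Q = inf at_top (principal Q)"

definition conv_distr :: "('i \<Rightarrow> 'a::topological_space measure) \<Rightarrow> 'a measure \<Rightarrow> 'i filter \<Rightarrow> bool" where
  "conv_distr \<mu> \<nu> F \<longleftrightarrow> (\<forall>f::'a \<Rightarrow> real. continuous_on UNIV f \<longrightarrow> bounded (range f) \<longrightarrow>
      ((\<lambda>i. \<integral>x. f x \<partial>\<mu> i) \<longlongrightarrow> (\<integral>x. f x \<partial>\<nu>)) F)"

end

theory Submission
  imports Defs "HOL-Number_Theory.Number_Theory"
begin

text \<open>
  For \<open>\<phi>(x) = e(kx)\<close> completing the square gives \<open>g\<^sub>\<phi>(p,q) / g\<^sub>1(p,q) = e(n\<^sup>2 x)\<close>, where \<open>x\<close> is a fixed
  multiple of \<open>p\<^sup>-\<^sup>1 / q\<close> and \<open>n\<close> is \<open>k\<close> or \<open>k / 2\<close>, up to a parity condition on \<open>k\<close>. So for a trigonometric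
  polynomial the theorem is the joint equidistribution of \<open>(p / q, x)\<close> on the torus, together with
  independence from the value of \<open>g\<^sub>1(p,q)\<close>.

  By Weyl's criterion this amounts to \<open>o(q)\<close> bounds for Kloosterman sums whose weight is the indicator of
  a value of \<open>g\<^sub>1(p,q)\<close>; such a weight is invariant under multiplication of \<open>p\<close> by squares. Kloosterman's
  fourth moment argument suffices: it counts solutions of \<open>x + y = z + v\<close>, \<open>x\<^sup>-\<^sup>1 + y\<^sup>-\<^sup>1 = z\<^sup>-\<^sup>1 + v\<^sup>-\<^sup>1\<close>
  modulo \<open>q\<close>, which force \<open>(x + y) (z - x) (z - y) = 0\<close>, so there are at most \<open>3 q\<^sup>3 / P\<close> of them for every
  prime \<open>P\<close> dividing \<open>q\<close>. As \<open>q\<close> has at most \<open>N\<close> divisors, its largest prime factor tends to infinity.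

  The distribution of \<open>g\<^sub>1(p,q)\<close> itself is exactly uniform, because its possible values are permuted by
  complex conjugation (\<open>p \<mapsto> -p\<close>) and, for a non-square \<open>q\<close>, by a change of sign (\<open>p \<mapsto> up\<close> for a suitable unit \<open>u\<close>).

  A Riemann integrable \<open>\<phi>\<close> is reduced to trigonometric polynomials by the mean square of \<open>g\<^sub>\<phi>(p,q)\<close> over \<open>p\<close>,
  which is controlled by Riemann sums of \<open>\<bar>\<phi>\<bar>\<^sup>2\<close> with at least \<open>sqrt q\<close> points.
\<close>

section \<open>Quadratic Gauss sums\<close>

text \<open>The bound N on the number of divisors works in four places. It gives q \<le>
  \<open>N * totient q\<close>, so averages over units can be compared with sums over all residues;
  it bounds the number of square roots of a unit square, hence the loss in passing from a fourth
  moment to a single sum; it controls the mean square of Gauss sums; and it forces a large prime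
  factor. The saving obtained may tend to zero arbitrarily slowly, but it is uniform in the weight.

  For a non-square q the values of the Gauss sum are determined only as a set together with its
  symmetries. The indicator of one value has an exact mean, which is the whole contribution of the
  zero frequency; independence of the two components is the vanishing of all other frequencies.

  The classes q = 0 mod 4, q odd and q = 2 mod 4 differ only in the Fourier frequencies that survive
  and in the multiple of the inverse of p that appears. The analysis is therefore carried out once,
  in a locale over these data.\<close>

lemma e_add: "e (x + y) = e x * e y"
  by (simp add: e_def algebra_simps flip: exp_add)

lemma e_0 [simp]: "e 0 = 1"
  by (simp add: e_def)

lemma e_minus: "e (- x) = cnj (e x)"
  by (simp add: e_def exp_cnj)

lemma norm_e [simp]: "cmod (e x) = 1"
  by (simp add: e_def norm_exp_eq_Re)

lemma e_eq_1_iff: "e x = 1 \<longleftrightarrow> x \<in> \<int>"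
proof -
  have "e x = 1 \<longleftrightarrow> (\<exists>n::int. 2 * pi * x = real_of_int (2 * n) * pi)"
    by (simp add: e_def exp_eq_1)
  also have "\<dots> \<longleftrightarrow> (\<exists>n::int. x = real_of_int n)"
    by (intro ex_cong1) (auto simp: field_simps)
  finally show ?thesis by (auto simp: Ints_def)
qed

lemma e_of_int [simp]: "e (real_of_int k) = 1"
  by (simp add: e_eq_1_iff)

lemma e_add_int: "e (x + real_of_int k) = e x"
  by (simp add: e_add)

lemma continuous_on_e [continuous_intros]:
  "continuous_on A f \<Longrightarrow> continuous_on A (\<lambda>x. e (f x))"
  unfolding e_def by (intro continuous_intros)

definition ez :: "nat \<Rightarrow> int \<Rightarrow> complex" where
  "ez q z = e (real_of_int z / real q)"

lemma ez_add: "ez q (a + b) = ez q a * ez q b"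
  by (simp add: ez_def add_divide_distrib e_add)

lemma ez_0 [simp]: "ez q 0 = 1"
  by (simp add: ez_def)

lemma norm_ez [simp]: "cmod (ez q z) = 1"
  by (simp add: ez_def)

lemma ez_minus: "ez q (- a) = cnj (ez q a)"
  by (simp add: ez_def flip: e_minus)

lemma ez_diff: "ez q (a - b) = ez q a * cnj (ez q b)"
  using ez_add[of q a "- b"] by (simp add: ez_minus)

lemma ez_scale: "c > 0 \<Longrightarrow> ez (q * c) (a * int c) = ez q a"
  by (simp add: ez_def)

lemma ez_eq_1_iff: "q > 0 \<Longrightarrow> ez q a = 1 \<longleftrightarrow> int q dvd a"
proof -
  assume q: "q > 0"
  have "real_of_int a / real q \<in> \<int> \<longleftrightarrow> int q dvd a"
  proof
    assume "real_of_int a / real q \<in> \<int>"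
    then obtain n where "real_of_int a / real q = real_of_int n" by (auto simp: Ints_def)
    then have "real_of_int a = real_of_int (int q * n)" using q by (simp add: field_simps)
    then have "a = int q * n" by (simp only: of_int_eq_iff)
    then show "int q dvd a" by simp
  next
    assume "int q dvd a"
    then show "real_of_int a / real q \<in> \<int>" using q by (auto elim!: dvdE)
  qed
  then show ?thesis by (simp add: ez_def e_eq_1_iff)
qed

lemma ez_dvd: "int q dvd a \<Longrightarrow> ez q a = 1"
  by (cases "q = 0") (auto simp: ez_eq_1_iff)

lemma ez_cong: "[a = b] (mod int q) \<Longrightarrow> ez q a = ez q b"
  using ez_add[of q "a - b" b] ez_dvd[of q "a - b"] by (simp add: cong_iff_dvd_diff)

text \<open>Common form of the changes of variables below: by counting, q pairwise incongruent
  integers form a complete residue system, whatever index set \<open>X\<close> they come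
  from.\<close>

lemma sum_residues:
  fixes g :: "'a \<Rightarrow> int" and F :: "int \<Rightarrow> 'b::comm_monoid_add"
  assumes "q > 0" "finite X" "card X = q"
    and inj: "\<And>x y. x \<in> X \<Longrightarrow> y \<in> X \<Longrightarrow> [g x = g y] (mod int q) \<Longrightarrow> x = y"
    and per: "\<And>a b. [a = b] (mod int q) \<Longrightarrow> F a = F b"
  shows "(\<Sum>x\<in>X. F (g x)) = (\<Sum>h\<in>{0..<int q}. F h)"
proof -
  have i: "inj_on (\<lambda>x. g x mod int q) X"
    by (intro inj_onI inj) (auto simp: cong_def)
  have "(\<lambda>x. g x mod int q) ` X = {0..<int q}"
    using assms by (intro card_subset_eq) (auto simp: card_image[OF i])
  then have "(\<Sum>h\<in>{0..<int q}. F h) = (\<Sum>x\<in>X. F (g x mod int q))"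
    using sum.reindex[OF i, of F] by (simp add: o_def)
  also have "\<dots> = (\<Sum>x\<in>X. F (g x))"
    by (intro sum.cong per) auto
  finally show ?thesis by simp
qed

lemma cong_less_imp_eq: "[x = y] (mod int q) \<Longrightarrow> x \<in> {0..<int q} \<Longrightarrow> y \<in> {0..<int q} \<Longrightarrow> x = y"
  by (simp add: cong_def)

lemma sum_residues_shift:
  fixes F :: "int \<Rightarrow> 'b::comm_monoid_add"
  assumes "\<And>a b. [a = b] (mod int q) \<Longrightarrow> F a = F b"
  shows "(\<Sum>h\<in>{0..<int q}. F (h + c)) = (\<Sum>h\<in>{0..<int q}. F h)"
proof (cases "q = 0")
  case False
  then show ?thesis
    by (intro sum_residues assms) (auto simp: cong_add_rcancel intro: cong_less_imp_eq)
qed auto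

lemma sum_residues_mult:
  fixes F :: "int \<Rightarrow> 'b::comm_monoid_add"
  assumes "\<And>a b. [a = b] (mod int q) \<Longrightarrow> F a = F b" "coprime u (int q)"
  shows "(\<Sum>h\<in>{0..<int q}. F (u * h)) = (\<Sum>h\<in>{0..<int q}. F h)"
proof (cases "q = 0")
  case False
  then show ?thesis using assms(2)
    by (intro sum_residues assms) (auto simp: cong_mult_lcancel intro: cong_less_imp_eq)
qed auto

lemma sum_residues_split:
  fixes F :: "int \<Rightarrow> 'b::comm_monoid_add"
  assumes "m > 0" "n > 0" "\<And>a b. [a = b] (mod int (m * n)) \<Longrightarrow> F a = F b"
  shows "(\<Sum>h\<in>{0..<int (m * n)}. F h) = (\<Sum>x\<in>{0..<int m}. \<Sum>y\<in>{0..<int n}. F (x + int m * y))"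
proof -
  have "(\<Sum>(x,y)\<in>{0..<int m}\<times>{0..<int n}. F (x + int m * y)) = (\<Sum>h\<in>{0..<int (m * n)}. F h)"
    unfolding case_prod_unfold
  proof (rule sum_residues)
    fix p p' :: "int \<times> int"
    assume p: "p \<in> {0..<int m} \<times> {0..<int n}" "p' \<in> {0..<int m} \<times> {0..<int n}"
      and c: "[fst p + int m * snd p = fst p' + int m * snd p'] (mod int (m * n))"
    obtain x y x' y' where pp: "p = (x,y)" "p' = (x',y')" by (cases p, cases p')
    have c': "[x + int m * y = x' + int m * y'] (mod int m * int n)" using c pp by simp
    then have "[x + int m * y = x' + int m * y'] (mod int m)"
      by (rule cong_modulus_mult)
    then have "x mod int m = x' mod int m" by (simp add: cong_def)
    then have x: "x = x'" using p pp by simp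
    then have "[int m * y = int m * y'] (mod int m * int n)"
      using c' by (simp add: cong_add_lcancel)
    then have "[y = y'] (mod int n)" using assms(1) by (simp add: cong_def mult_mod_right[symmetric])
    then have "y = y'" using p pp by (auto intro: cong_less_imp_eq)
    with x pp show "p = p'" by simp
  qed (use assms in auto)
  then show ?thesis by (simp add: sum.cartesian_product)
qed

lemma sum_ez:
  assumes "q > 0"
  shows "(\<Sum>h\<in>{0..<int q}. ez q (a * h)) = (if int q dvd a then of_nat q else 0)"
proof (cases "int q dvd a")
  case True
  then have "\<And>h. ez q (a * h) = 1" by (intro ez_dvd) auto
  then show ?thesis using True by simp
next
  case False
  let ?s = "\<Sum>h\<in>{0..<int q}. ez q (a * h)"
  have "(\<Sum>h\<in>{0..<int q}. ez q (a * (h + 1))) = ?s"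
    by (rule sum_residues_shift) (auto intro!: ez_cong cong_scalar_left)
  then have "ez q a * ?s = ?s"
    by (simp add: distrib_left ez_add sum_distrib_left mult.commute)
  moreover have "ez q a \<noteq> 1" using False assms by (simp add: ez_eq_1_iff)
  ultimately show ?thesis using False by simp
qed

text \<open>The linear coefficient \<open>k\<close> comes from testing with
  \<open>e (k * x)\<close>. The quadratic coefficient is an integer, so that negation and
  multiplication by units or inverses stay within the notation.\<close>

definition gs :: "nat \<Rightarrow> int \<Rightarrow> int \<Rightarrow> complex" where
  "gs q a k = (\<Sum>h\<in>{0..<int q}. ez q (a * h\<^sup>2 + k * h))"

lemma g1_eq_gs: "g1 p q = gs q (int p) 0"
proof -
  have "gs q (int p) 0 = (\<Sum>h<q. ez q (int p * (int h)\<^sup>2))"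
    unfolding gs_def
    by (rule sum.reindex_bij_witness[of _ int nat]) auto
  then show ?thesis by (simp add: gsum_def ez_def)
qed

lemma gs_cong:
  assumes "[a = a'] (mod int q)" "[k = k'] (mod int q)"
  shows "gs q a k = gs q a' k'"
  unfolding gs_def by (intro sum.cong refl ez_cong cong_add cong_mult assms cong_refl)

lemma gs_1 [simp]: "gs (Suc 0) a k = 1"
  by (simp add: gs_def ez_dvd)

lemma cnj_gs: "cnj (gs q a 0) = gs q (- a) 0"
  by (simp add: gs_def cnj_sum flip: ez_minus)

lemma gs_mult_square:
  assumes "coprime u (int q)"
  shows "gs q (a * u\<^sup>2) 0 = gs q a 0"
proof -
  have "(\<Sum>h\<in>{0..<int q}. ez q (a * (u * h)\<^sup>2)) = (\<Sum>h\<in>{0..<int q}. ez q (a * h\<^sup>2))"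
    by (rule sum_residues_mult[where F="\<lambda>h. ez q (a * h\<^sup>2)"])
      (auto intro!: ez_cong cong_mult cong_pow assms)
  then show ?thesis by (simp add: gs_def power_mult_distrib mult.assoc)
qed

text \<open>The substitution h = x n + y m separates the square, because the cross term 2 a x y m n
  is divisible by the modulus.\<close>

lemma gs_coprime_mult:
  assumes "coprime m n" "m > 0" "n > 0"
  shows "gs (m * n) a 0 = gs n (a * int m) 0 * gs m (a * int n) 0"
proof -
  have "gs (m * n) a 0 = (\<Sum>p\<in>{0..<int m}\<times>{0..<int n}. ez (m * n) (a * (fst p * int n + snd p * int m)\<^sup>2))"
    unfolding gs_def mult_zero_left add_0_right
  proof (rule sum_residues[where F="\<lambda>h. ez (m * n) (a * h\<^sup>2)", symmetric])
    fix p p' :: "int \<times> int"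
    assume p: "p \<in> {0..<int m} \<times> {0..<int n}" "p' \<in> {0..<int m} \<times> {0..<int n}"
      and c0: "[fst p * int n + snd p * int m = fst p' * int n + snd p' * int m] (mod int (m * n))"
    obtain x y x' y' where pp: "p = (x,y)" "p' = (x',y')" by (cases p, cases p')
    have c: "[x * int n + y * int m = x' * int n + y' * int m] (mod int m * int n)"
      using c0 pp by simp
    have cop: "coprime (int n) (int m)" "coprime (int m) (int n)"
      using assms(1) by (auto simp: coprime_commute)
    have "int m dvd (x - x') * int n + (y - y') * int m"
      using c by (auto simp: cong_iff_dvd_diff algebra_simps dest: dvd_mult_left)
    then have "int m dvd (x - x') * int n"
      by (metis dvd_add_left_iff dvd_triv_right)
    then have "[x = x'] (mod int m)"
      using cop by (simp add: cong_iff_dvd_diff coprime_dvd_mult_left_iff coprime_commute)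
    moreover have "int n dvd (y - y') * int m + (x - x') * int n"
      using c by (auto simp: cong_iff_dvd_diff algebra_simps dest: dvd_mult_right)
    then have "int n dvd (y - y') * int m"
      by (metis dvd_add_left_iff dvd_triv_right)
    then have "[y = y'] (mod int n)"
      using cop by (simp add: cong_iff_dvd_diff coprime_dvd_mult_left_iff coprime_commute)
    ultimately show "p = p'" using p pp by (auto intro: cong_less_imp_eq)
  qed (use assms in \<open>auto intro!: ez_cong cong_mult cong_pow\<close>)
  also have "\<dots> = (\<Sum>p\<in>{0..<int m}\<times>{0..<int n}. ez m (a * int n * (fst p)\<^sup>2) * ez n (a * int m * (snd p)\<^sup>2))"
  proof (rule sum.cong[OF refl])
    fix p :: "int \<times> int"
    have "a * (fst p * int n + snd p * int m)\<^sup>2 =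
       (a * int n * (fst p)\<^sup>2) * int n + ((a * int m * (snd p)\<^sup>2) * int m + int (m * n) * (2 * a * fst p * snd p))"
      by (simp add: power2_eq_square algebra_simps)
    then show "ez (m * n) (a * (fst p * int n + snd p * int m)\<^sup>2) =
        ez m (a * int n * (fst p)\<^sup>2) * ez n (a * int m * (snd p)\<^sup>2)"
      using ez_scale[OF assms(3), of m "a * int n * (fst p)\<^sup>2"] ez_scale[OF assms(2), of n "a * int m * (snd p)\<^sup>2"]
      by (simp add: ez_add ez_dvd mult.commute[of n m])
  qed
  also have "\<dots> = gs n (a * int m) 0 * gs m (a * int n) 0"
    by (simp add: gs_def sum_product sum.cartesian_product case_prod_unfold mult.commute)
  finally show ?thesis .
qed

text \<open>With h = x + l t y the phase becomes linear in y. As 2 a is a unit modulo l, the sum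
  over y kills every x that l does not divide, and the remaining x = l c reproduce the sum modulo
  t.\<close>

lemma gs_square_mult:
  assumes "odd l" "t > 0" "coprime a (int l)"
  shows "gs (l\<^sup>2 * t) a 0 = of_nat l * gs t a 0"
proof -
  have l: "l > 0" using assms(1) by (auto intro: Nat.gr0I)
  let ?q = "(l * t) * l"
  let ?F = "\<lambda>h. ez ?q (a * h\<^sup>2)"
  have cop: "coprime (2 * a) (int l)" using assms(1,3) by simp
  have "gs ?q a 0 = (\<Sum>x\<in>{0..<int (l * t)}. \<Sum>y\<in>{0..<int l}. ?F (x + int (l * t) * y))"
    unfolding gs_def mult_zero_left add_0_right
    by (rule sum_residues_split) (use l assms in \<open>auto intro!: ez_cong cong_mult cong_pow\<close>)
  also have "\<dots> = (\<Sum>x\<in>{0..<int (l * t)}. \<Sum>y\<in>{0..<int l}. ?F x * ez l (2 * a * x * y))"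
  proof (intro sum.cong refl)
    fix x y
    have "a * (x + int (l * t) * y)\<^sup>2 = a * x\<^sup>2 + ((2 * a * x * y) * int (l * t) + int ?q * (a * int t * y\<^sup>2))"
      by (simp add: power2_eq_square algebra_simps)
    then show "?F (x + int (l * t) * y) = ?F x * ez l (2 * a * x * y)"
      using ez_scale[of "l * t" l "2 * a * x * y"] l assms(2)
      by (simp add: ez_add ez_dvd mult.commute[of l "l * t"])
  qed
  also have "\<dots> = (\<Sum>x\<in>{0..<int (l * t)}. if int l dvd x then of_nat l * ?F x else 0)"
    using l cop by (intro sum.cong refl) (simp add: sum_ez coprime_commute coprime_dvd_mult_right_iff flip: sum_distrib_left)
  also have "\<dots> = (\<Sum>x | x \<in> {0..<int (l * t)} \<and> int l dvd x. of_nat l * ?F x)"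
    by (subst sum.inter_filter) auto
  also have "\<dots> = (\<Sum>c\<in>{0..<int t}. of_nat l * ?F (int l * c))"
    using l by (intro sum.reindex_bij_witness[of _ "\<lambda>c. int l * c" "\<lambda>x. x div int l"])
      (auto elim!: dvdE simp: zero_le_mult_iff)
  also have "\<dots> = of_nat l * gs t a 0"
    unfolding gs_def sum_distrib_left
  proof (intro sum.cong refl arg_cong2[where f="(*)"])
    fix c
    show "?F (int l * c) = ez t (a * c\<^sup>2 + 0 * c)"
      using ez_scale[of "l * l" t "a * c\<^sup>2"] l by (simp add: power2_eq_square algebra_simps)
  qed
  finally show ?thesis by (simp add: power2_eq_square mult_ac)
qed

text \<open>The analogue of \<open>gs_square_mult\<close> at the prime 2, where 2 a is not
  invertible. The loss is made up by the shorter periods of the squares: with t = 4 r the terms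
  modulo 16 r have period 8 r and those modulo 4 r have period 2 r.\<close>

lemma gs_four_mult:
  assumes "4 dvd t" "t > 0" "odd a"
  shows "gs (4 * t) a 0 = 2 * gs t a 0"
proof -
  obtain r where r: "t = 4 * r" using assms(1) by auto
  then have r0: "r > 0" using assms(2) by simp
  let ?F = "\<lambda>h. ez (16 * r) (a * h\<^sup>2)"
  let ?G = "\<lambda>h. ez (4 * r) (a * h\<^sup>2)"
  have F: "?F (x + int (8 * r) * y) = ?F x" for x y
  proof -
    have "a * (x + int (8 * r) * y)\<^sup>2 = a * x\<^sup>2 + int (16 * r) * (a * x * y + 4 * a * int r * y\<^sup>2)"
      by (simp add: power2_eq_square algebra_simps)
    then show ?thesis by (simp add: ez_add ez_dvd)
  qed
  have G: "?G (x + int (2 * r) * y) = ?G x" for x y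
  proof -
    have "a * (x + int (2 * r) * y)\<^sup>2 = a * x\<^sup>2 + int (4 * r) * (a * x * y + a * int r * y\<^sup>2)"
      by (simp add: power2_eq_square algebra_simps)
    then show ?thesis by (simp add: ez_add ez_dvd)
  qed
  have F2: "?F (x + int (4 * r) * y) = ?F x * ez 2 (a * x * y)" for x y
  proof -
    have "a * (x + int (4 * r) * y)\<^sup>2 = a * x\<^sup>2 + ((a * x * y) * int (8 * r) + int (16 * r) * (a * int r * y\<^sup>2))"
      by (simp add: power2_eq_square algebra_simps)
    then show ?thesis using ez_scale[of "8 * r" 2 "a * x * y"] r0 by (simp add: ez_add ez_dvd)
  qed
  have "gs (16 * r) a 0 = (\<Sum>h\<in>{0..<int (8 * r * 2)}. ?F h)"
    unfolding gs_def by (simp add: mult.commute)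
  also have "\<dots> = (\<Sum>x\<in>{0..<int (8 * r)}. \<Sum>y\<in>{0..<int 2}. ?F (x + int (8 * r) * y))"
    by (rule sum_residues_split) (use r0 in \<open>auto intro!: ez_cong cong_mult cong_pow simp: mult.commute\<close>)
  also have "\<dots> = 2 * (\<Sum>x\<in>{0..<int (4 * r * 2)}. ?F x)"
    by (simp add: F[simplified] sum_distrib_left)
  also have "(\<Sum>x\<in>{0..<int (4 * r * 2)}. ?F x) = (\<Sum>x\<in>{0..<int (4 * r)}. \<Sum>y\<in>{0..<int 2}. ?F (x + int (4 * r) * y))"
  proof (rule sum_residues_split)
    fix x y assume "[x = y] (mod int (4 * r * 2))"
    then have "[y = x] (mod int (8 * r))" by (simp add: cong_sym_eq)
    then obtain k where "x = y + int (8 * r) * k" by (auto simp: cong_iff_lin)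
    then show "?F x = ?F y" using F by simp
  qed (use r0 in auto)
  also have "\<dots> = (\<Sum>x\<in>{0..<int (4 * r)}. if 2 dvd x then 2 * ?F x else 0)"
  proof (intro sum.cong refl)
    fix x
    have "(\<Sum>y\<in>{0..<int 2}. ?F (x + int (4 * r) * y)) = ?F x * (\<Sum>y\<in>{0..<int 2}. ez 2 (a * x * y))"
      by (simp only: F2 sum_distrib_left)
    also have "\<dots> = (if 2 dvd x then 2 * ?F x else 0)"
      using assms(3) by (subst sum_ez) auto
    finally show "(\<Sum>y\<in>{0..<int 2}. ?F (x + int (4 * r) * y)) = (if 2 dvd x then 2 * ?F x else 0)" .
  qed
  also have "\<dots> = (\<Sum>x | x \<in> {0..<int (4 * r)} \<and> 2 dvd x. 2 * ?F x)"
    by (subst sum.inter_filter) auto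
  also have "\<dots> = (\<Sum>z\<in>{0..<int (2 * r)}. 2 * ?F (2 * z))"
    by (intro sum.reindex_bij_witness[of _ "\<lambda>c. 2 * c" "\<lambda>x. x div 2"]) auto
  also have "\<dots> = (\<Sum>z\<in>{0..<int (2 * r)}. 2 * ?G z)"
  proof (intro sum.cong refl arg_cong2[where f="(*)"])
    fix z show "?F (2 * z) = ?G z"
      using ez_scale[of 4 "4 * r" "a * z\<^sup>2"] by (simp add: algebra_simps)
  qed
  also have "\<dots> = (\<Sum>x\<in>{0..<int (2 * r)}. \<Sum>y\<in>{0..<int 2}. ?G (x + int (2 * r) * y))"
    by (simp add: G[simplified])
  also have "\<dots> = (\<Sum>h\<in>{0..<int (2 * r * 2)}. ?G h)"
    by (rule sum_residues_split[symmetric]) (use r0 in \<open>auto intro!: ez_cong cong_mult cong_pow simp: mult.commute\<close>)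
  also have "\<dots> = gs (4 * r) a 0"
    unfolding gs_def by (simp add: mult.commute)
  finally show ?thesis by (simp add: r)
qed

text \<open>Squaring out and substituting x = z + y leaves a linear sum over y with coefficient 2 a
  z, which vanishes unless z = 0.\<close>

lemma norm_gs_odd:
  assumes "odd q" "coprime a (int q)"
  shows "gs q a 0 * cnj (gs q a 0) = of_nat q"
proof -
  have q: "q > 0" using assms(1) by (auto intro: Nat.gr0I)
  have cop: "coprime (2 * a) (int q)" using assms by simp
  have "gs q a 0 * cnj (gs q a 0) = (\<Sum>y\<in>{0..<int q}. \<Sum>x\<in>{0..<int q}. ez q (a * x\<^sup>2 - a * y\<^sup>2))"
    unfolding gs_def cnj_sum sum_product by (subst sum.swap) (simp add: ez_diff)
  also have "\<dots> = (\<Sum>y\<in>{0..<int q}. \<Sum>z\<in>{0..<int q}. ez q (a * (z + y)\<^sup>2 - a * y\<^sup>2))"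
    by (intro sum.cong refl sum_residues_shift[symmetric, where F="\<lambda>h. ez q (a * h\<^sup>2 - a * y\<^sup>2)" for y])
      (auto intro!: ez_cong cong_diff cong_mult cong_pow)
  also have "\<dots> = (\<Sum>y\<in>{0..<int q}. \<Sum>z\<in>{0..<int q}. ez q (a * z\<^sup>2) * ez q (2 * a * z * y))"
    by (simp add: power2_eq_square algebra_simps flip: ez_add)
  also have "\<dots> = (\<Sum>z\<in>{0..<int q}. ez q (a * z\<^sup>2) * (\<Sum>y\<in>{0..<int q}. ez q (2 * a * z * y)))"
    by (subst sum.swap) (simp add: sum_distrib_left)
  also have "\<dots> = (\<Sum>z\<in>{0..<int q}. if z = 0 then of_nat q else 0)"
  proof (intro sum.cong refl)
    fix z assume z: "z \<in> {0..<int q}"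
    have "int q dvd 2 * a * z \<longleftrightarrow> int q dvd z"
      using cop by (simp add: coprime_commute coprime_dvd_mult_right_iff)
    also have "\<dots> \<longleftrightarrow> z = 0" using z by (auto dest: zdvd_imp_le)
    finally show "ez q (a * z\<^sup>2) * (\<Sum>y\<in>{0..<int q}. ez q (2 * a * z * y)) = (if z = 0 then of_nat q else 0)"
      using q by (simp add: sum_ez)
  qed
  also have "\<dots> = of_nat q" using q by simp
  finally show ?thesis .
qed

section \<open>Values of Gauss sums\<close>

lemma coprime_4_8_odd:
  assumes "odd (r::nat)"
  shows "coprime 4 r" "coprime r 4" "coprime 8 r" "coprime r 8"
    "coprime 4 (int r)" "coprime (int r) 4" "coprime 8 (int r)" "coprime (int r) 8"
proof -
  have "coprime (2 ^ 2) r" "coprime (2 ^ 3) r" "coprime (2 ^ 2) (int r)" "coprime (2 ^ 3) (int r)"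
    using assms by (simp_all only: coprime_power_left_iff) simp_all
  then show "coprime 4 r" "coprime r 4" "coprime 8 r" "coprime r 8"
    "coprime 4 (int r)" "coprime (int r) 4" "coprime 8 (int r)" "coprime (int r) 8"
    by (simp_all add: coprime_commute)
qed

lemma gs_odd_symmetric:
  fixes l :: nat
  assumes "odd l"
  shows "gs l a 0 = (\<Sum>h\<in>{-int ((l-1) div 2)..int ((l-1) div 2)}. ez l (a * h\<^sup>2))"
proof -
  let ?m = "int ((l-1) div 2)"
  have l: "int l = 2 * ?m + 1" using assms by (auto elim!: oddE)
  have "(\<Sum>h\<in>{-?m..?m}. ez l (a * h\<^sup>2)) = (\<Sum>h\<in>{0..<int l}. ez l (a * h\<^sup>2))"
  proof (rule sum_residues[where g="\<lambda>h. h"])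
    fix x y assume xy: "x \<in> {-?m..?m}" "y \<in> {-?m..?m}" and c: "[x = y] (mod int l)"
    have "[x + ?m = y + ?m] (mod int l)" using c by (intro cong_add cong_refl)
    then have "x + ?m = y + ?m" by (rule cong_less_imp_eq) (use xy l in auto)
    then show "x = y" by simp
  qed (use l in \<open>auto intro!: ez_cong cong_mult cong_pow\<close>)
  then show ?thesis by (simp add: gs_def)
qed

text \<open>The numbers \<open>h\<^sup>2\<close> (\<open>0 \<le> h \<le> m\<close>) and \<open>u * h\<^sup>2\<close> (\<open>-m \<le> h < 0\<close>) run through all residues
  modulo \<open>l = 2 * m + 1\<close> if \<open>u\<close> is not a quadratic residue.\<close>

lemma gs_prime_nonresidue:
  fixes l :: nat
  assumes l: "prime l" "odd l" and u: "\<not> QuadRes (int l) u" and a: "coprime a (int l)"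
  shows "gs l (a * u) 0 = - gs l a 0"
proof -
  define m where "m = int ((l-1) div 2)"
  have lm: "int l = 2 * m + 1" using l(2) by (auto elim!: oddE simp: m_def)
  have m0: "m \<ge> 0" by (simp add: m_def)
  have pl: "prime (int l)" using l by simp
  let ?F = "\<lambda>h. ez l (a * h)"
  define g where "g = (\<lambda>h::int. if h \<ge> 0 then h\<^sup>2 else u * h\<^sup>2)"
  \<comment> \<open>A collision between the two halves would exhibit u as a square, namely that of x
    times the inverse of y.\<close>
  have QR: False if "[x\<^sup>2 = u * y\<^sup>2] (mod int l)" "\<not> int l dvd y" for x y
  proof -
    have "coprime y (int l)" using that(2) pl by (metis coprime_commute prime_imp_coprime)
    then obtain z where z: "[y * z = 1] (mod int l)" by (meson cong_solve_coprime_int)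
    have "[(x * z)\<^sup>2 = u * y\<^sup>2 * z\<^sup>2] (mod int l)"
      unfolding power_mult_distrib using that(1) by (intro cong_mult cong_refl)
    also have "u * y\<^sup>2 * z\<^sup>2 = u * (y * z)\<^sup>2" by (simp add: power_mult_distrib)
    also have "[u * (y * z)\<^sup>2 = u * 1\<^sup>2] (mod int l)" by (intro cong_mult cong_refl cong_pow z)
    finally show False using u by (auto simp: QuadRes_def)
  qed
  have u0: "\<not> int l dvd u"
  proof
    assume "int l dvd u"
    then have "[0\<^sup>2 = u] (mod int l)" by (simp add: cong_iff_dvd_diff)
    then show False using u unfolding QuadRes_def by blast
  qed
  have sq: "x = y" if "[x\<^sup>2 = y\<^sup>2] (mod int l)" "0 \<le> x" "x \<le> m" "0 \<le> y" "y \<le> m" for x y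
  proof -
    have "int l dvd (x - y) * (x + y)" using that(1)
      by (simp add: cong_iff_dvd_diff power2_eq_square algebra_simps)
    then have "int l dvd x - y \<or> int l dvd x + y" using pl by (simp add: prime_dvd_mult_iff)
    then have "[x = y] (mod int l) \<or> [x = - y] (mod int l)" by (auto simp: cong_iff_dvd_diff)
    then show ?thesis
    proof
      assume "[x = y] (mod int l)" then show ?thesis by (rule cong_less_imp_eq) (use that lm in auto)
    next
      assume "[x = - y] (mod int l)"
      then have "int l dvd x + y" by (simp add: cong_iff_dvd_diff)
      then have "x + y = 0" using that lm by (auto dest: zdvd_imp_le)
      then show ?thesis using that by simp
    qed
  qed
  have nd: "\<not> int l dvd y" if "-m \<le> y" "y < 0" for y
    using that lm zdvd_imp_le[of "int l" "- y"] by auto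
  have "(\<Sum>h\<in>{-m..m}. ?F (g h)) = (\<Sum>h\<in>{0..<int l}. ?F h)"
  proof (rule sum_residues)
    fix x y assume xy: "x \<in> {-m..m}" "y \<in> {-m..m}" and c: "[g x = g y] (mod int l)"
    consider "x \<ge> 0" "y \<ge> 0" | "x \<ge> 0" "y < 0" | "x < 0" "y \<ge> 0" | "x < 0" "y < 0" by linarith
    then show "x = y"
    proof cases
      case 1 then show ?thesis using c xy by (intro sq) (auto simp: g_def)
    next
      case 2 then show ?thesis using c xy QR[of x y] nd[of y] by (auto simp: g_def)
    next
      case 3 then show ?thesis using c xy QR[of y x] nd[of x] by (auto simp: g_def cong_sym_eq)
    next
      case 4
      have "coprime u (int l)" using u0 pl by (metis coprime_commute prime_imp_coprime)
      then have "[(-x)\<^sup>2 = (-y)\<^sup>2] (mod int l)" using c 4 by (simp add: g_def cong_mult_lcancel)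
      then have "- x = - y" using 4 xy by (intro sq) auto
      then show ?thesis by simp
    qed
  qed (use l lm m0 in \<open>auto intro!: ez_cong cong_mult simp: prime_gt_0_nat\<close>)
  also have "\<dots> = 0"
  proof -
    have "\<not> int l dvd a" using a pl l(1) by (metis coprime_absorb_left coprime_commute not_prime_unit)
    then show ?thesis using l(1) by (simp add: sum_ez prime_gt_0_nat)
  qed
  finally have *: "(\<Sum>h\<in>{-m..m}. ?F (g h)) = 0" .
  have split: "(\<Sum>h\<in>{-m..m}. f h) = (\<Sum>h\<in>{-m..<0}. f h) + f 0 + (\<Sum>h\<in>{1..m}. f h)" for f :: "int \<Rightarrow> complex"
  proof -
    have "{-m..m} = {-m..<0} \<union> ({0} \<union> {1..m})" using m0 by auto
    then show ?thesis by (simp only:) (subst sum.union_disjoint, auto simp: add.assoc)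
  qed
  have refl: "(\<Sum>h\<in>{-m..<0}. f (h\<^sup>2)) = (\<Sum>h\<in>{1..m}. f (h\<^sup>2))" for f :: "int \<Rightarrow> complex"
    by (rule sum.reindex_bij_witness[of _ uminus uminus]) auto
  define A where "A = (\<Sum>h\<in>{1..m}. ?F (h\<^sup>2))"
  define B where "B = (\<Sum>h\<in>{1..m}. ?F (u * h\<^sup>2))"
  have "(\<Sum>h\<in>{-m..<0}. ?F (g h)) = (\<Sum>h\<in>{-m..<0}. ?F (u * h\<^sup>2))"
    by (intro sum.cong) (auto simp: g_def)
  moreover have "(\<Sum>h\<in>{1..m}. ?F (g h)) = A" unfolding A_def
    by (intro sum.cong) (auto simp: g_def)
  ultimately have "(\<Sum>h\<in>{-m..m}. ?F (g h)) = B + 1 + A"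
    using refl[of "\<lambda>x. ?F (u * x)"] by (simp add: split g_def B_def)
  moreover have "gs l a 0 = A + 1 + A"
    unfolding gs_odd_symmetric[OF l(2)] m_def[symmetric] split refl[of ?F] by (simp add: A_def)
  moreover have "gs l (a * u) 0 = B + 1 + B"
    unfolding gs_odd_symmetric[OF l(2)] m_def[symmetric] split mult.assoc refl[of "\<lambda>x. ?F (u * x)"] by (simp add: B_def)
  ultimately have "gs l (a * u) 0 + gs l a 0 = 2 * (\<Sum>h\<in>{-m..m}. ?F (g h))" by simp
  with * show ?thesis by (simp add: eq_neg_iff_add_eq_0)
qed

text \<open>If every unit were a square, squaring would be onto the residues modulo l, hence
  injective; but 1 and l - 1 have the same square and differ for l > 2.\<close>

lemma ex_nonresidue:
  fixes l :: nat
  assumes l: "prime l" "odd l"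
  shows "\<exists>u. coprime u (int l) \<and> \<not> QuadRes (int l) u"
proof (rule ccontr)
  assume contra: "\<not> ?thesis"
  have l2: "l > 2" using l prime_gt_1_nat[of l] by (cases "l = 2") auto
  let ?f = "\<lambda>h::int. h\<^sup>2 mod int l"
  have "{0..<int l} \<subseteq> ?f ` {0..<int l}"
  proof
    fix u assume u: "u \<in> {0..<int l}"
    have "QuadRes (int l) u"
    proof (cases "coprime u (int l)")
      case True then show ?thesis using contra by auto
    next
      case False
      then have "int l dvd u" using l by (metis coprime_commute prime_imp_coprime prime_int_nat_transfer nat_int of_nat_0_le_iff)
      then have "[0\<^sup>2 = u] (mod int l)" by (simp add: cong_iff_dvd_diff)
      then show ?thesis unfolding QuadRes_def by blast
    qed
    then obtain y where "[y\<^sup>2 = u] (mod int l)" by (auto simp: QuadRes_def)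
    then have "?f (y mod int l) = u" using u by (simp add: cong_def power_mod)
    moreover have "y mod int l \<in> {0..<int l}" using l2 by simp
    ultimately show "u \<in> ?f ` {0..<int l}" by blast
  qed
  then have "{0..<int l} = ?f ` {0..<int l}"
    using l2 by (intro equalityI) auto
  then have inj: "inj_on ?f {0..<int l}" by (intro eq_card_imp_inj_on) auto
  have "?f 1 = ?f (int l - 1)"
  proof -
    have "(int l - 1)\<^sup>2 - 1\<^sup>2 = int l * (int l - 2)" by (simp add: power2_eq_square algebra_simps)
    then have "int l dvd (int l - 1)\<^sup>2 - 1\<^sup>2" by simp
    then have "[(int l - 1)\<^sup>2 = 1\<^sup>2] (mod int l)" by (simp add: cong_iff_dvd_diff)
    then show ?thesis by (simp add: cong_def)
  qed
  then have "1 = int l - 1" by (rule inj_onD[OF inj]) (use l2 in auto)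
  then show False using l2 by simp
qed

text \<open>For odd q this is the Jacobi symbol of -1; \<open>eps_sym q\<close> is its square root,
  which makes \<open>eps_sym q * sqrt q\<close> a square root of \<open>jsgn q * q\<close>.\<close>

definition jsgn :: "nat \<Rightarrow> complex" where "jsgn q = (eps_sym q)\<^sup>2"

lemma jsgn_eq: "jsgn q = (if q mod 4 = 1 then 1 else -1)"
  by (simp add: jsgn_def eps_sym_def)

lemma jsgn_mult: "odd m \<Longrightarrow> odd n \<Longrightarrow> jsgn (m * n) = jsgn m * jsgn n"
proof -
  assume "odd m" "odd n"
  then have "m mod 4 = 1 \<or> m mod 4 = 3" "n mod 4 = 1 \<or> n mod 4 = 3" by presburger+
  moreover have "(m * n) mod 4 = ((m mod 4) * (n mod 4)) mod 4" by (simp add: mod_mult_eq)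
  ultimately show ?thesis by (auto simp: jsgn_eq)
qed

lemma jsgn_square_mult: "odd l \<Longrightarrow> odd t \<Longrightarrow> jsgn (l\<^sup>2 * t) = jsgn t"
  by (simp add: jsgn_mult power2_eq_square) (simp add: jsgn_eq)

text \<open>Conjugation replaces a by -a, which multiplies the sum by the Legendre symbol of -1: by
  \<open>gs_mult_square\<close> if -1 is a residue, by \<open>gs_prime_nonresidue\<close> otherwise.
  The known absolute value then becomes a value for the square.\<close>

lemma gs_prime_squared:
  fixes l :: nat
  assumes l: "prime l" "odd l" and a: "coprime a (int l)"
  shows "(gs l a 0)\<^sup>2 = jsgn l * of_nat l"
proof -
  have l2: "l > 2" using l prime_gt_1_nat[of l] by (cases "l = 2") auto
  have euler: "[Legendre (-1) (int l) = (-1) ^ ((l - 1) div 2)] (mod int l)"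
    using euler_criterion[of l "-1"] l l2 by simp
  have neq: "\<not> [1 = -1] (mod int l)" "\<not> [-1 = 1] (mod int l)"
    using l2 zdvd_imp_le[of "int l" 2] by (auto simp: cong_iff_dvd_diff)
  have "\<not> int l dvd -1" using l2 by auto
  then have nz: "\<not> [-1 = 0] (mod int l)" by (simp add: cong_iff_dvd_diff)
  have QR: "QuadRes (int l) (-1) \<longleftrightarrow> l mod 4 = 1"
  proof (cases "l mod 4 = 1")
    case True
    then have "even ((l - 1) div 2)" using l(2) by presburger
    then have "[Legendre (-1) (int l) = 1] (mod int l)" using euler by simp
    then show ?thesis using nz neq True by (auto simp: Legendre_def split: if_splits)
  next
    case False
    then have "odd ((l - 1) div 2)" using l(2) by presburger
    then have "[Legendre (-1) (int l) = -1] (mod int l)" using euler by simp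
    then show ?thesis using nz neq False by (auto simp: Legendre_def split: if_splits)
  qed
  have "gs l (- a) 0 = jsgn l * gs l a 0"
  proof (cases "l mod 4 = 1")
    case True
    then obtain y where y: "[y\<^sup>2 = -1] (mod int l)" using QR by (auto simp: QuadRes_def)
    have "coprime (y\<^sup>2) (int l)" using y cong_imp_coprime[OF cong_sym[OF y]] by simp
    then have "coprime y (int l)" by simp
    then have "gs l a 0 = gs l (a * y\<^sup>2) 0" by (simp add: gs_mult_square)
    also have "\<dots> = gs l (a * (-1)) 0" by (intro gs_cong cong_mult cong_refl y)
    finally show ?thesis using True by (simp add: jsgn_eq)
  next
    case False
    then show ?thesis using gs_prime_nonresidue[OF l, of "-1" a] QR a by (simp add: jsgn_eq)
  qed
  then have "jsgn l * (gs l a 0 * gs l a 0) = of_nat l"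
    using norm_gs_odd[OF l(2) a] by (simp add: cnj_gs algebra_simps)
  then have "jsgn l * (jsgn l * (gs l a 0 * gs l a 0)) = jsgn l * of_nat l" by simp
  moreover have "jsgn l * jsgn l = 1" by (simp add: jsgn_eq)
  ultimately show ?thesis by (simp add: power2_eq_square flip: mult.assoc)
qed

text \<open>The square does not depend on the unit a, so the twists by the cofactors in
  \<open>gs_coprime_mult\<close> do no harm. The induction removes a prime by
  \<open>gs_square_mult\<close> if its square divides q and by \<open>gs_coprime_mult\<close>
  otherwise.\<close>

lemma gs_odd_squared:
  assumes "odd q" "coprime a (int q)"
  shows "(gs q a 0)\<^sup>2 = jsgn q * of_nat q"
  using assms
proof (induction q arbitrary: a rule: less_induct)
  case (less q)
  show ?case
  proof (cases "q = 1")
    case True then show ?thesis by (simp add: jsgn_eq)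
  next
    case False
    then obtain l where l: "prime l" "l dvd q" using prime_factor_nat by blast
    have lodd: "odd l" using l less.prems(1) by (meson dvd_trans)
    have q0: "q > 0" using less.prems(1) by (auto intro: Nat.gr0I)
    obtain t where t: "q = l * t" using l(2) by blast
    have todd: "odd t" using t less.prems(1) by simp
    have t0: "t > 0" using t q0 by simp
    have cop: "coprime a (int l)" "coprime a (int t)" using less.prems(2) t by auto
    show ?thesis
    proof (cases "l dvd t")
      case True
      then obtain s where s: "t = l * s" by blast
      then have qs: "q = l\<^sup>2 * s" using t by (simp add: power2_eq_square)
      have s0: "s > 0" "odd s" using s t0 todd by auto
      have "s < q" using qs s0 one_less_power[OF prime_gt_1_nat[OF l(1)], of 2] by simp
      moreover have "coprime a (int s)" using cop s by simp
      ultimately have "(gs s a 0)\<^sup>2 = jsgn s * of_nat s" using less.IH s0 by blast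
      then show ?thesis unfolding qs gs_square_mult[OF lodd s0(1) cop(1)]
        using lodd s0 by (simp add: jsgn_square_mult power_mult_distrib)
    next
      case False
      then have c: "coprime l t" using l(1) by (simp add: prime_imp_coprime)
      have "t < q" using t t0 l(1) prime_gt_1_nat[of l] by simp
      moreover have "coprime (a * int l) (int t)" using cop c by simp
      ultimately have "(gs t (a * int l) 0)\<^sup>2 = jsgn t * of_nat t" using less.IH todd by blast
      moreover have "coprime (a * int t) (int l)" using cop c by (simp add: coprime_commute)
      then have "(gs l (a * int t) 0)\<^sup>2 = jsgn l * of_nat l" using gs_prime_squared l(1) lodd by blast
      ultimately show ?thesis
        unfolding t gs_coprime_mult[OF c prime_gt_0_nat[OF l(1)] t0]
        using lodd todd by (simp add: power_mult_distrib jsgn_mult)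
    qed
  qed
qed

lemma gs_odd_square:
  assumes "odd k" "coprime a (int k)"
  shows "gs (k\<^sup>2) a 0 = of_nat k"
  using gs_square_mult[OF assms(1) _ assms(2), of 1] by simp

lemma ex_coprime_crt:
  fixes m n :: nat and a b :: int
  assumes "coprime m n" "coprime a (int m)" "coprime b (int n)" "m > 0" "n > 0"
  shows "\<exists>u. [u = a] (mod int m) \<and> [u = b] (mod int n) \<and> coprime u (int (m * n))"
proof -
  obtain u where u: "[u = a] (mod int m)" "[u = b] (mod int n)"
    using binary_chinese_remainder_int[of "int m" "int n" a b] assms(1) by auto
  then have "coprime u (int m)" "coprime u (int n)"
    using assms cong_imp_coprime cong_sym by blast+
  then show ?thesis using u by auto
qed

lemma is_square_mult_square: "k > 0 \<Longrightarrow> is_square (k\<^sup>2 * n) \<longleftrightarrow> is_square n"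
proof
  assume k: "k > 0" and "is_square (k\<^sup>2 * n)"
  then obtain j where j: "k\<^sup>2 * n = j\<^sup>2" by (auto simp: is_square_def)
  then have "k\<^sup>2 dvd j\<^sup>2" by (metis dvd_triv_left)
  then have "k dvd j" by simp
  then obtain i where "j = k * i" by blast
  then have "n = i\<^sup>2" using j k by (simp add: power_mult_distrib)
  then show "is_square n" by (auto simp: is_square_def)
next
  assume "is_square n"
  then show "is_square (k\<^sup>2 * n)" by (auto simp: is_square_def simp flip: power_mult_distrib)
qed

text \<open>A non-square has a prime factor of odd exponent. Squares of primes are divided out until
  the chosen prime l divides exactly once; then u is a non-residue modulo l and 1 modulo the
  cofactor.\<close>

lemma gs_sign_change_odd:
  assumes "odd q" "\<not> is_square q"
  shows "\<exists>u. coprime u (int q) \<and> (\<forall>a. coprime a (int q) \<longrightarrow> gs q (a * u) 0 = - gs q a 0)"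
  using assms
proof (induction q rule: less_induct)
  case (less q)
  have "q \<noteq> 1" using less.prems(2) unfolding is_square_def by (metis power_one)
  then obtain l where l: "prime l" "l dvd q" using prime_factor_nat by blast
  have lodd: "odd l" using l less.prems(1) by (meson dvd_trans)
  have q0: "q > 0" using less.prems(1) by (auto intro: Nat.gr0I)
  obtain t where t: "q = l * t" using l(2) by blast
  have todd: "odd t" using t less.prems(1) by simp
  have t0: "t > 0" "l > 0" using t q0 by auto
  show ?case
  proof (cases "l dvd t")
    case True
    then obtain s where s: "t = l * s" by blast
    then have qs: "q = l\<^sup>2 * s" using t by (simp add: power2_eq_square)
    have s0: "s > 0" "odd s" using s t0 todd by auto
    have "s < q" using qs s0 one_less_power[OF prime_gt_1_nat[OF l(1)], of 2] by simp
    moreover have "\<not> is_square s" using less.prems(2) qs t0 by (simp add: is_square_mult_square)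
    ultimately obtain u where u: "coprime u (int s)" "\<And>a. coprime a (int s) \<Longrightarrow> gs s (a * u) 0 = - gs s a 0"
      using less.IH s0 by blast
    \<comment> \<open>The unit found modulo s may fail to be prime to l once l no longer divides s;
      it is then changed to 1 modulo l without altering its class modulo s.\<close>
    obtain u' where u': "[u' = u] (mod int s)" "coprime u' (int q)"
    proof (cases "l dvd s")
      case True
      then have "coprime u (int l)" using u(1) by (metis coprime_commute coprime_divisors dvd_refl int_dvd_int_iff)
      then show ?thesis using u(1) that[of u] qs by simp
    next
      case False
      then have "coprime s l" using l(1) by (simp add: prime_imp_coprime coprime_commute)
      then obtain v where v: "[v = u] (mod int s)" "[v = 1] (mod int l)" "coprime v (int (s * l))"
        using ex_coprime_crt[of s l u 1] u(1) s0 t0 by auto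
      then have "coprime v (int q)" using qs by simp
      then show ?thesis using that v by blast
    qed
    have "gs q (a * u') 0 = - gs q a 0" if "coprime a (int q)" for a
    proof -
      have c: "coprime a (int l)" "coprime a (int s)" "coprime (a * u') (int l)"
        using that qs u'(2) by auto
      have "gs s (a * u') 0 = gs s (a * u) 0" by (intro gs_cong cong_mult cong_refl u')
      then show ?thesis unfolding qs gs_square_mult[OF lodd s0(1) c(1)] gs_square_mult[OF lodd s0(1) c(3)]
        using u(2) c(2) by simp
    qed
    then show ?thesis using u' by blast
  next
    case False
    then have c: "coprime l t" using l(1) by (simp add: prime_imp_coprime)
    obtain v where v: "coprime v (int l)" "\<not> QuadRes (int l) v" using ex_nonresidue l lodd by blast
    obtain u where u: "[u = v] (mod int l)" "[u = 1] (mod int t)" "coprime u (int q)"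
      using ex_coprime_crt[OF c v(1), of 1] t0 t by auto
    have "gs q (a * u) 0 = - gs q a 0" if "coprime a (int q)" for a
    proof -
      have a: "coprime (a * int t) (int l)" using that c t by (simp add: coprime_commute)
      have "gs t (a * u * int l) 0 = gs t (a * 1 * int l) 0" by (intro gs_cong cong_mult cong_refl u)
      moreover have "gs l (a * u * int t) 0 = gs l (a * v * int t) 0" by (intro gs_cong cong_mult cong_refl u)
      moreover have "\<dots> = - gs l (a * int t) 0"
        using gs_prime_nonresidue[OF l(1) lodd v(2) a] by (simp add: mult_ac)
      ultimately show ?thesis unfolding t gs_coprime_mult[OF c t0(2) t0(1)] by simp
    qed
    then show ?thesis using u by blast
  qed
qed

lemma e_half: "e (1 / 2) = - 1"
  by (simp add: e_def complex_eq_iff Re_exp Im_exp mult.commute[of _ pi])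

lemma atLeastLessThan_4: "{0..<4::int} = {0, 1, 2, 3}"
  and atLeastLessThan_8: "{0..<8::int} = {0, 1, 2, 3, 4, 5, 6, 7}"
  by auto

lemma e_odd_half: "odd a \<Longrightarrow> e (real_of_int a / 2) = - 1"
  using e_add_int[of "1 / 2"] by (auto elim!: oddE simp: e_half add_divide_distrib add.commute)

lemma gs_4:
  assumes "odd a"
  shows "gs 4 a 0 = 2 * (1 + ez 4 a)"
proof -
  have "ez 4 (a * 9) = ez 4 a" by (rule ez_cong) (simp add: cong_iff_dvd_diff)
  moreover have "ez 4 (a * 4) = 1" by (rule ez_dvd) simp
  ultimately show ?thesis
    by (simp add: gs_def atLeastLessThan_4)
qed

lemma ez_4_odd:
  assumes "odd a"
  shows "ez 4 a \<in> {\<i>, - \<i>}"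
proof -
  have "(ez 4 a)\<^sup>2 = e (real_of_int a / 2)"
    by (simp add: ez_def power2_eq_square flip: e_add)
  then have "(ez 4 a)\<^sup>2 = \<i>\<^sup>2" using assms by (simp add: e_odd_half)
  then show ?thesis unfolding power2_eq_iff by simp
qed

lemma gs_8:
  assumes "odd a"
  shows "gs 8 a 0 = 4 * ez 8 a"
proof -
  have "ez 8 (a * k) = ez 8 a" if "8 dvd k - 1" for k
  proof (rule ez_cong)
    have "a * k - a = a * (k - 1)" by (simp add: algebra_simps)
    then show "[a * k = a] (mod int 8)" using that by (simp add: cong_iff_dvd_diff)
  qed
  note 1 = this[of 9] this[of 25] this[of 49]
  have 2: "ez 8 (a * 16) = 1" by (rule ez_dvd) simp
  have 3: "ez 8 (a * 4) = - 1" "ez 8 (a * 36) = - 1"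
    using e_odd_half[of "a"] e_odd_half[of "a * 9"] assms by (simp_all add: ez_def mult.commute)
  show ?thesis using 1 2 3 by (simp add: gs_def atLeastLessThan_8)
qed

text \<open>The square of \<open>ez 8 a\<close> is \<i> or -\<i>, so on the unit circle the squares
  of its real and imaginary parts are both 1/2.\<close>

lemma ez_8_odd:
  assumes "odd a"
  shows "\<exists>s\<in>{1, -1}. \<exists>t\<in>{1,-1}. sqrt 2 * ez 8 a = s + t * \<i>"
proof -
  define z where "z = ez 8 a"
  have "z * z = ez 4 a" by (simp add: z_def ez_def flip: e_add)
  then have "z * z \<in> {\<i>, - \<i>}" using ez_4_odd[OF assms] by simp
  then have zz: "Re z * Re z = Im z * Im z" "2 * (Re z * Im z) = 1 \<or> 2 * (Re z * Im z) = -1"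
    by (auto simp: complex_eq_iff mult.commute)
  have "cmod z = 1" by (simp add: z_def)
  then have n: "(Re z)\<^sup>2 + (Im z)\<^sup>2 = 1" by (metis cmod_power2 one_power2)
  have "(sqrt 2 * Re z)\<^sup>2 = 1" "(sqrt 2 * Im z)\<^sup>2 = 1"
    using zz(1) n unfolding power_mult_distrib by (simp_all add: power2_eq_square)
  then have "sqrt 2 * Re z \<in> {1,-1}" "sqrt 2 * Im z \<in> {1,-1}" by (auto simp: power2_eq_1_iff)
  then show ?thesis unfolding z_def[symmetric]
    by (intro bexI[of _ "complex_of_real (sqrt 2 * Re z)"] bexI[of _ "complex_of_real (sqrt 2 * Im z)"])
      (auto simp: complex_eq_iff)
qed

text \<open>The support of \<open>lawX\<close>. It is stable under conjugation and under
  multiplication by \<i>, which absorbs the factors \<open>eps_sym r\<close> and the signs.\<close>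

definition corners :: "complex set" where "corners = {1 + \<i>, 1 - \<i>, -1 + \<i>, -1 - \<i>}"

lemma gs_4_mult:
  assumes "odd r" "coprime a (int (4 * r))"
  shows "gs (4 * r) a 0 = gs r (4 * a) 0 * (2 * (1 + ez 4 (a * int r)))"
proof -
  have "odd a" using assms(2) by auto
  then show ?thesis
    using gs_coprime_mult[of 4 r a] gs_4[of "a * int r"] assms(1) odd_pos[OF assms(1)]
    by (simp add: coprime_4_8_odd mult.commute)
qed

lemma gs_8_mult:
  assumes "odd r" "coprime a (int (8 * r))"
  shows "gs (8 * r) a 0 = gs r (8 * a) 0 * (4 * ez 8 (a * int r))"
proof -
  have "odd a" using assms(2) by auto
  then show ?thesis
    using gs_coprime_mult[of 8 r a] gs_8[of "a * int r"] assms(1) odd_pos[OF assms(1)]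
    by (simp add: coprime_4_8_odd mult.commute)
qed

lemma gs_odd_values:
  assumes "odd q" "coprime a (int q)"
  shows "\<exists>s\<in>{1,-1}. gs q a 0 = s * (eps_sym q * sqrt q)"
proof -
  have "(gs q a 0)\<^sup>2 = (eps_sym q * sqrt q)\<^sup>2"
    using gs_odd_squared[OF assms] by (simp add: jsgn_def power_mult_distrib flip: of_real_power)
  then show ?thesis by (auto simp: power2_eq_iff)
qed

lemma is_square_4_mult: "is_square (4 * n) \<longleftrightarrow> is_square n"
  using is_square_mult_square[of 2 n] by simp

lemma not_is_square_8_mult: "odd r \<Longrightarrow> \<not> is_square (8 * r)"
proof
  assume "odd r" "is_square (8 * r)"
  then have "is_square (2 * r)" using is_square_4_mult[of "2 * r"] by simp
  then obtain k where k: "2 * r = k\<^sup>2" by (auto simp: is_square_def)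
  then have "even (k\<^sup>2)" by (metis dvd_triv_left)
  then have "even k" by simp
  then have "4 dvd k\<^sup>2" by (auto elim!: evenE simp: power2_eq_square)
  then show False using k \<open>odd r\<close> by presburger
qed

text \<open>The induction rule that matches \<open>gs_four_mult\<close>: dividing by 4 is possible
  as long as the quotient is still divisible by 4, and stops at 4 or 8 times an odd number.\<close>

lemma four_dvd_induct [consumes 2, case_names four eight step]:
  fixes q :: nat
  assumes "4 dvd q" "q > 0"
    and four: "\<And>r. odd r \<Longrightarrow> P (4 * r)" and eight: "\<And>r. odd r \<Longrightarrow> P (8 * r)"
    and step: "\<And>t. 4 dvd t \<Longrightarrow> t > 0 \<Longrightarrow> P t \<Longrightarrow> P (4 * t)"
  shows "P q"
  using assms(1,2)
proof (induction q rule: less_induct)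
  case (less q)
  then obtain t where t: "q = 4 * t" by blast
  consider "odd t" | "even t" "\<not> 4 dvd t" | "4 dvd t" by blast
  then show ?case
  proof cases
    case 1 then show ?thesis using four t by simp
  next
    case 2
    then obtain r where "t = 2 * r" by blast
    with 2 have "odd r" "q = 8 * r" using t by auto
    then show ?thesis using eight by simp
  next
    case 3
    have "t < q" "t > 0" using t less.prems by auto
    then show ?thesis using less.IH[of t] 3 step t by simp
  qed
qed

lemma gs_four_dvd_values:
  assumes "4 dvd q" "q > 0" "coprime a (int q)"
  shows "gs q a 0 / sqrt q \<in> corners"
  using assms
proof (induction q rule: four_dvd_induct)
  case (four r)
  have r: "r > 0" using odd_pos[OF four(1)] .
  have c: "coprime (4 * a) (int r)" "odd (a * int r)" using four by (auto simp: coprime_4_8_odd)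
  have "sqrt (real (4 * r)) = 2 * sqrt r" using real_sqrt_mult[of 4 r] by simp
  moreover obtain s where s: "s \<in> {1,-1}" "gs r (4 * a) 0 = s * (eps_sym r * sqrt r)"
    using gs_odd_values[OF four(1) c(1)] by blast
  moreover have "ez 4 (a * int r) \<in> {\<i>, - \<i>}" using ez_4_odd[OF c(2)] .
  ultimately have "gs (4 * r) a 0 / sqrt (real (4 * r)) = s * eps_sym r * (1 + ez 4 (a * int r))"
      "ez 4 (a * int r) \<in> {\<i>, - \<i>}"
    unfolding gs_4_mult[OF four] using r by (simp_all add: divide_simps)
  then show ?case using s(1) by (auto simp: corners_def eps_sym_def algebra_simps)
next
  case (eight r)
  have r: "r > 0" using odd_pos[OF eight(1)] .
  have c: "coprime (8 * a) (int r)" "odd (a * int r)" using eight by (auto simp: coprime_4_8_odd)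
  have "sqrt (real (8 * r)) = 2 * (sqrt 2 * sqrt r)"
    using real_sqrt_mult[of 4 "2 * r"] real_sqrt_mult[of 2 r] by simp
  then have "complex_of_real (sqrt (real (8 * r))) * sqrt 2 = 4 * sqrt r"
    by (simp flip: of_real_mult)
  moreover obtain s where s: "s \<in> {1,-1}" "gs r (8 * a) 0 = s * (eps_sym r * sqrt r)"
    using gs_odd_values[OF eight(1) c(1)] by blast
  ultimately have "gs (8 * r) a 0 = s * eps_sym r * (sqrt 2 * ez 8 (a * int r)) * sqrt (real (8 * r))"
    unfolding gs_8_mult[OF eight] by (simp add: algebra_simps)
  then have "gs (8 * r) a 0 / sqrt (real (8 * r)) = s * eps_sym r * (sqrt 2 * ez 8 (a * int r))"
    using r by simp
  moreover obtain s' t' where st: "s' \<in> {1,-1}" "t' \<in> {1,-1}" "sqrt 2 * ez 8 (a * int r) = s' + t' * \<i>"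
    using ez_8_odd[OF c(2)] by blast
  ultimately have eq: "gs (8 * r) a 0 / sqrt (real (8 * r)) = s * eps_sym r * (s' + t' * \<i>)" by simp
  show ?case unfolding eq using s(1) st(1,2) by (auto simp: corners_def eps_sym_def algebra_simps)
next
  case (step t)
  have "sqrt (real (4 * t)) = 2 * sqrt t" using real_sqrt_mult[of 4 t] by simp
  moreover have "odd a" "coprime a (int t)" using step by auto
  ultimately show ?case using step by (simp add: gs_four_mult)
qed

text \<open>If q is a square, dividing by 4 ends at 4 r with r an odd square. The sum modulo r is
  then exactly the positive root of r, and only the factor 1 + \<open>ez 4 _\<close> is left to
  vary.\<close>

lemma gs_four_dvd_square_values:
  assumes "4 dvd q" "q > 0" "coprime a (int q)" "is_square q"
  shows "gs q a 0 / sqrt q \<in> {1 + \<i>, 1 - \<i>}"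
  using assms
proof (induction q rule: four_dvd_induct)
  case (four r)
  then have "is_square r" by (simp add: is_square_4_mult)
  then obtain k where k: "r = k\<^sup>2" by (auto simp: is_square_def)
  have kodd: "odd k" using four(1) k by simp
  have "coprime (4 * a) (int k)" "odd (a * int r)" using four k kodd by (auto simp: coprime_4_8_odd)
  then have "gs r (4 * a) 0 = of_nat k" "ez 4 (a * int r) \<in> {\<i>, - \<i>}"
    unfolding k using gs_odd_square[OF kodd] ez_4_odd k by auto
  moreover have "sqrt (real (4 * r)) = 2 * k" using k real_sqrt_mult[of 4 r] by simp
  ultimately have "gs (4 * r) a 0 / sqrt (real (4 * r)) = 1 + ez 4 (a * int r)" "ez 4 (a * int r) \<in> {\<i>, - \<i>}"
    unfolding gs_4_mult[OF four(1,2)] using odd_pos[OF kodd] by (simp_all add: divide_simps)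
  then show ?case by auto
next
  case (eight r)
  then show ?case using not_is_square_8_mult by simp
next
  case (step t)
  have "sqrt (real (4 * t)) = 2 * sqrt t" using real_sqrt_mult[of 4 t] by simp
  moreover have "odd a" "coprime a (int t)" "is_square t" using step by (auto simp: is_square_4_mult)
  ultimately show ?case using step by (simp add: gs_four_mult)
qed

text \<open>In the base case 4 r the sign comes from the odd non-square r, with u = 1 modulo 4. In
  the base case 8 r it comes from the prime 2: u = 5 modulo 8 and 1 modulo r, since
  \<open>ez 8\<close> changes sign when an odd argument is multiplied by 5.\<close>

lemma gs_sign_change_four_dvd:
  assumes "4 dvd q" "q > 0" "\<not> is_square q"
  shows "\<exists>u. coprime u (int q) \<and> (\<forall>a. coprime a (int q) \<longrightarrow> gs q (a * u) 0 = - gs q a 0)"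
  using assms
proof (induction q rule: four_dvd_induct)
  case (four r)
  then have "\<not> is_square r" by (simp add: is_square_4_mult)
  then obtain v where v: "coprime v (int r)" "\<And>a. coprime a (int r) \<Longrightarrow> gs r (a * v) 0 = - gs r a 0"
    using gs_sign_change_odd four(1) by blast
  have "coprime 4 r" using four(1) by (simp add: coprime_4_8_odd)
  then obtain u where u: "[u = 1] (mod int 4)" "[u = v] (mod int r)" "coprime u (int (4 * r))"
    using ex_coprime_crt[of 4 r 1 v] v(1) odd_pos[OF four(1)] by auto
  have "gs (4 * r) (a * u) 0 = - gs (4 * r) a 0" if a: "coprime a (int (4 * r))" for a
  proof -
    have "coprime (a * u) (int (4 * r))" using a u(3) by simp
    moreover have "ez 4 (a * u * int r) = ez 4 (a * 1 * int r)"
      using u(1) by (intro ez_cong cong_mult cong_refl) auto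
    moreover have "gs r (4 * (a * u)) 0 = gs r (4 * (a * v)) 0"
      by (intro gs_cong cong_mult cong_refl u)
    moreover have "coprime (4 * a) (int r)" using a four(1) by (auto simp: coprime_4_8_odd)
    ultimately show ?thesis using v(2)[of "4 * a"] a by (simp add: gs_4_mult[OF four(1)] mult.assoc)
  qed
  then show ?case using u by blast
next
  case (eight r)
  have "coprime 8 r" using eight(1) by (simp add: coprime_4_8_odd)
  moreover have "coprime 5 (int 8)" by (simp add: coprime_iff_gcd_eq_1 gcd_non_0_int)
  ultimately obtain u where u: "[u = 5] (mod int 8)" "[u = 1] (mod int r)" "coprime u (int (8 * r))"
    using ex_coprime_crt[of 8 r 5 1] odd_pos[OF eight(1)] by auto
  have "gs (8 * r) (a * u) 0 = - gs (8 * r) a 0" if a: "coprime a (int (8 * r))" for a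
  proof -
    have c: "coprime (a * u) (int (8 * r))" using a u(3) by simp
    have "odd (a * int r)" using a eight(1) by auto
    then have half: "ez 8 (a * int r * 4) = -1" using e_odd_half[of "a * int r"] by (simp add: ez_def)
    have "ez 8 (a * u * int r) = ez 8 (a * 5 * int r)"
      using u(1) by (intro ez_cong cong_mult cong_refl) auto
    also have "a * 5 * int r = a * int r + a * int r * 4" by (simp add: algebra_simps)
    also have "ez 8 \<dots> = - ez 8 (a * int r)" by (simp only: ez_add half) simp
    finally have "ez 8 (a * u * int r) = - ez 8 (a * int r)" .
    moreover have "gs r (8 * (a * u)) 0 = gs r (8 * (a * 1)) 0"
      by (intro gs_cong cong_mult cong_refl u)
    ultimately show ?thesis using a c by (simp add: gs_8_mult[OF eight(1)])
  qed
  then show ?case using u by blast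
next
  case (step t)
  then obtain u where u: "coprime u (int t)" "\<And>a. coprime a (int t) \<Longrightarrow> gs t (a * u) 0 = - gs t a 0"
    by (auto simp: is_square_4_mult)
  have "even t" using step(1) by (elim dvdE) simp
  then have "odd u" using coprime_common_divisor[OF u(1), of 2] by auto
  then have "coprime u (2 ^ 2)" by (simp only: coprime_power_right_iff) simp
  then have "coprime u (int (4 * t))" using u(1) by simp
  moreover have "gs (4 * t) (a * u) 0 = - gs (4 * t) a 0" if "coprime a (int (4 * t))" for a
  proof -
    have "odd a" "coprime a (int t)" using that by auto
    then show ?thesis using u(2) step(1,2) \<open>odd u\<close> by (simp add: gs_four_mult)
  qed
  ultimately show ?case by blast
qed

section \<open>Counting square roots and Kloosterman sums\<close>

lemma gs_complete_square:
  assumes "[a * b = 1] (mod int q)" "[k = 2 * n] (mod int q)"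
  shows "gs q a k = ez q (- (b * n\<^sup>2)) * gs q a 0"
proof -
  have "gs q a k = (\<Sum>h\<in>{0..<int q}. ez q (- (b * n\<^sup>2)) * ez q (a * (h + b * n)\<^sup>2))"
    unfolding gs_def
  proof (intro sum.cong refl, unfold ez_add[symmetric], rule ez_cong)
    fix h
    have "- (b * n\<^sup>2) + a * (h + b * n)\<^sup>2 = - (b * n\<^sup>2) + a * h\<^sup>2 + 2 * n * h * (a * b) + b * n\<^sup>2 * (a * b)"
      by (simp add: power2_eq_square algebra_simps)
    also have "[\<dots> = - (b * n\<^sup>2) + a * h\<^sup>2 + 2 * n * h * 1 + b * n\<^sup>2 * 1] (mod int q)"
      by (intro cong_add cong_mult cong_refl assms)
    also have "- (b * n\<^sup>2) + a * h\<^sup>2 + 2 * n * h * 1 + b * n\<^sup>2 * 1 = a * h\<^sup>2 + 2 * n * h" by simp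
    also have "[\<dots> = a * h\<^sup>2 + k * h] (mod int q)"
      using assms(2) by (intro cong_add cong_mult cong_refl) (rule cong_sym)
    finally show "[a * h\<^sup>2 + k * h = - (b * n\<^sup>2) + a * (h + b * n)\<^sup>2] (mod int q)" by (rule cong_sym)
  qed
  also have "\<dots> = ez q (- (b * n\<^sup>2)) * (\<Sum>h\<in>{0..<int q}. ez q (a * (h + b * n)\<^sup>2))"
    by (simp add: sum_distrib_left)
  also have "(\<Sum>h\<in>{0..<int q}. ez q (a * (h + b * n)\<^sup>2)) = gs q a 0"
    unfolding gs_def mult_zero_left add_0_right
    by (rule sum_residues_shift[where F="\<lambda>h. ez q (a * h\<^sup>2)"]) (auto intro!: ez_cong cong_mult cong_pow)
  finally show ?thesis .
qed

lemma gs_shift_zero: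
  assumes "\<And>h. ez q (a * (h + c)\<^sup>2 + k * (h + c)) = - ez q (a * h\<^sup>2 + k * h)"
  shows "gs q a k = 0"
proof -
  have "gs q a k = (\<Sum>h\<in>{0..<int q}. ez q (a * (h + c)\<^sup>2 + k * (h + c)))"
    unfolding gs_def by (rule sum_residues_shift[where F="\<lambda>h. ez q (a * h\<^sup>2 + k * h)", symmetric])
      (auto intro!: ez_cong cong_mult cong_pow cong_add)
  also have "\<dots> = - gs q a k" unfolding assms gs_def by (simp add: sum_negf)
  finally show ?thesis by simp
qed

lemma ez_2_odd: "odd a \<Longrightarrow> ez 2 a = - 1"
  by (simp add: ez_def e_odd_half)

lemma gs_four_dvd_odd:
  assumes "4 dvd q" "q > 0" "odd k"
  shows "gs q a k = 0"
proof -
  obtain r where r: "q = 4 * r" using assms(1) by blast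
  show ?thesis
  proof (rule gs_shift_zero[of q a "int (2 * r)" k])
    fix h
    have "a * (h + int (2 * r))\<^sup>2 + k * (h + int (2 * r)) =
       (a * h\<^sup>2 + k * h) + (k * int (2 * r) + int (4 * r) * (a * h + a * int r))"
      by (simp add: power2_eq_square algebra_simps)
    moreover have "ez (4 * r) (k * int (2 * r)) = - 1"
      using ez_scale[of "2 * r" 2 k] ez_2_odd[OF assms(3)] r assms(2) by simp
    ultimately show "ez q (a * (h + int (2 * r))\<^sup>2 + k * (h + int (2 * r))) = - ez q (a * h\<^sup>2 + k * h)"
      unfolding r by (simp only: ez_add) (simp add: ez_dvd)
  qed
qed

text \<open>A shift by r multiplies each term by 1 or -1 according to the parity of k. For even k
  the sum is its own negative. For odd k the terms have period r, and the even representatives 2 x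
  turn the modulus 2 r into r.\<close>

lemma gs_twice_odd:
  assumes "odd r" "odd a"
  shows "gs (2 * r) a k = (if odd k then 2 * gs r (2 * a) k else 0)"
proof -
  have r: "r > 0" using odd_pos[OF assms(1)] .
  let ?F = "\<lambda>h. ez (2 * r) (a * h\<^sup>2 + k * h)"
  have F: "?F (h + int r) = ez 2 (a * int r + k) * ?F h" for h
  proof -
    have "a * (h + int r)\<^sup>2 + k * (h + int r) = (a * h\<^sup>2 + k * h) + ((a * int r + k) * int r + int (2 * r) * (a * h))"
      by (simp add: power2_eq_square algebra_simps)
    then show ?thesis using ez_scale[OF r, of 2 "a * int r + k"] by (simp only: ez_add) (simp add: ez_dvd)
  qed
  show ?thesis
  proof (cases "odd k")
    case False
    then have "ez 2 (a * int r + k) = - 1" using assms by (intro ez_2_odd) simp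
    then show ?thesis using False F by (auto intro!: gs_shift_zero[where c="int r"])
  next
    case True
    have "even (a * int r + k)" using assms True by simp
    then have "int 2 dvd a * int r + k" by simp
    then have e1: "ez 2 (a * int r + k) = 1" by (rule ez_dvd)
    have F1: "?F (h + int r * int n) = ?F h" for h n
    proof (induction n)
      case (Suc n)
      have "?F (h + int r * int (Suc n)) = ?F (h + int r * int n + int r)" by (simp add: algebra_simps)
      then show ?case using F[of "h + int r * int n", unfolded e1] Suc by simp
    qed simp
    have per: "?F x = ?F y" if c: "[x = y] (mod int r)" for x y
    proof -
      obtain n where n: "y = x + int r * n" using c by (auto simp: cong_iff_lin)
      show ?thesis
      proof (cases "n \<ge> 0")
        case True then show ?thesis using F1[of x "nat n"] n by simp
      next
        case False then show ?thesis using F1[of y "nat (-n)"] n by simp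
      qed
    qed
    have "gs (2 * r) a k = (\<Sum>h\<in>{0..<int (r * 2)}. ?F h)" by (simp add: gs_def mult.commute)
    also have "\<dots> = (\<Sum>x\<in>{0..<int r}. \<Sum>y\<in>{0..<int 2}. ?F (x + int r * y))"
      using r by (intro sum_residues_split) (auto intro!: per intro: cong_modulus_mult)
    also have "\<dots> = (\<Sum>x\<in>{0..<int r}. 2 * ?F x)"
    proof (intro sum.cong refl)
      fix x
      have "?F (x + int r * y) = ?F x" for y by (rule per) (simp add: cong_iff_dvd_diff)
      then show "(\<Sum>y\<in>{0..<int 2}. ?F (x + int r * y)) = 2 * ?F x" by simp
    qed
    also have "\<dots> = 2 * (\<Sum>x\<in>{0..<int r}. ?F (2 * x))"
      using assms(1) by (subst sum_residues_mult[where F="?F", OF per]) (simp_all add: sum_distrib_left)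
    also have "(\<Sum>x\<in>{0..<int r}. ?F (2 * x)) = gs r (2 * a) k"
      unfolding gs_def
    proof (intro sum.cong refl)
      fix x show "?F (2 * x) = ez r (2 * a * x\<^sup>2 + k * x)"
        using ez_scale[of 2 r "2 * a * x\<^sup>2 + k * x"] by (simp add: algebra_simps)
    qed
    finally show ?thesis using True by simp
  qed
qed

section \<open>Square roots modulo q and the mean square of Gauss sums\<close>

lemma card_residue_class_le:
  assumes "L > 0"
  shows "card {x \<in> {0..<int (L * g)}. [x = c] (mod int L)} \<le> g"
proof -
  let ?S = "{x \<in> {0..<int (L * g)}. [x = c] (mod int L)}"
  have "inj_on (\<lambda>x. x div int L) ?S"
  proof (rule inj_onI)
    fix x y assume "x \<in> ?S" "y \<in> ?S" "x div int L = y div int L"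
    then have "x div int L = y div int L" "x mod int L = y mod int L" by (auto simp: cong_def)
    then show "x = y" by (metis div_mult_mod_eq)
  qed
  moreover have "(\<lambda>x. x div int L) ` ?S \<subseteq> {0..<int g}"
  proof (clarsimp simp: assms pos_imp_zdiv_nonneg_iff)
    fix x assume "x < int L * int g"
    moreover have "int L * (x div int L) \<le> x"
      using assms by (metis mult_div_mod_eq le_add_same_cancel1 of_nat_0_less_iff pos_mod_sign)
    ultimately have "int L * (x div int L) < int L * int g" by linarith
    then show "x div int L < int g" using assms by simp
  qed
  ultimately have "card ?S \<le> card {0..<int g}" by (intro card_inj_on_le) auto
  then show ?thesis by simp
qed

text \<open>If q divides (x - h)(x + h), some divisor d of q divides x - h while its cofactor
  divides x + h. For fixed d these congruences fix x modulo the lcm, leaving at most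
  \<open>gcd d (q div d)\<close> residues modulo q, and they are compatible only if that gcd divides
  2 h.\<close>

lemma card_square_roots_le:
  assumes "q > 0"
  shows "card {x \<in> {0..<int q}. [x\<^sup>2 = h\<^sup>2] (mod int q)} \<le>
    (\<Sum>d | d dvd q. if int (gcd d (q div d)) dvd 2 * h then gcd d (q div d) else 0)"
proof -
  define S where "S = (\<lambda>d. {x \<in> {0..<int q}. int d dvd x - h \<and> int (q div d) dvd x + h})"
  have fin: "finite {d. d dvd q}" using assms by simp
  have sub: "{x \<in> {0..<int q}. [x\<^sup>2 = h\<^sup>2] (mod int q)} \<subseteq> (\<Union>d\<in>{d. d dvd q}. S d)"
  proof
    fix x assume x: "x \<in> {x \<in> {0..<int q}. [x\<^sup>2 = h\<^sup>2] (mod int q)}"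
    then have "int q dvd (x - h) * (x + h)"
      by (simp add: cong_iff_dvd_diff power2_eq_square algebra_simps)
    then obtain b c where bc: "int q = b * c" "b dvd x - h" "c dvd x + h"
      using division_decomp[of "int q" "x - h" "x + h"] by blast
    define d where "d = nat \<bar>b\<bar>"
    have q: "q = d * nat \<bar>c\<bar>" using bc(1) unfolding d_def
      by (metis abs_mult abs_of_nat nat_abs_mult_distrib nat_int)
    then have "d dvd q" "q div d = nat \<bar>c\<bar>" using assms by auto
    then show "x \<in> (\<Union>d\<in>{d. d dvd q}. S d)"
      using x bc by (auto simp: S_def d_def intro!: exI[of _ d])
  qed
  have S: "card (S d) \<le> (if int (gcd d (q div d)) dvd 2 * h then gcd d (q div d) else 0)" if d: "d dvd q" for d
  proof (cases "S d = {}")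
    case False
    then obtain x0 where x0: "x0 \<in> S d" by blast
    let ?g = "gcd d (q div d)" let ?L = "lcm d (q div d)"
    have q: "q = ?L * ?g" using d by (simp add: mult.commute prod_gcd_lcm_nat[symmetric])
    have L: "?L > 0" using assms d by (intro lcm_pos_nat) (auto intro: Nat.gr0I)
    have "int ?g dvd int d" "int ?g dvd int (q div d)" by (simp_all only: of_nat_dvd_iff gcd_dvd1 gcd_dvd2)
    then have "int ?g dvd x0 + h" "int ?g dvd x0 - h" using x0 unfolding S_def
      by (auto intro: dvd_trans)
    then have "int ?g dvd (x0 + h) - (x0 - h)" by (rule dvd_diff)
    then have g: "int ?g dvd 2 * h" by simp
    have "S d \<subseteq> {x \<in> {0..<int (?L * ?g)}. [x = x0] (mod int ?L)}"
    proof
      fix x assume x: "x \<in> S d"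
      have "int d dvd x - h" "int d dvd x0 - h" "int (q div d) dvd x + h" "int (q div d) dvd x0 + h"
        using x x0 by (auto simp: S_def)
      then have "int d dvd (x - h) - (x0 - h)" "int (q div d) dvd (x + h) - (x0 + h)"
        by (blast intro: dvd_diff)+
      then have "lcm (int d) (int (q div d)) dvd x - x0" by (intro lcm_least) auto
      then have "int ?L dvd x - x0" by (simp add: lcm_int_int_eq)
      then show "x \<in> {x \<in> {0..<int (?L * ?g)}. [x = x0] (mod int ?L)}"
        using x q unfolding S_def by (simp add: cong_iff_dvd_diff del: lcm_int_int_eq)
    qed
    then have "card (S d) \<le> card {x \<in> {0..<int (?L * ?g)}. [x = x0] (mod int ?L)}"
      by (intro card_mono finite_subset[of "{x \<in> {0..<int (?L * ?g)}. [x = x0] (mod int ?L)}" "{0..<int (?L * ?g)}"]) auto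
    also have "\<dots> \<le> ?g" using L by (rule card_residue_class_le)
    finally show ?thesis using g by simp
  qed simp
  have "card {x \<in> {0..<int q}. [x\<^sup>2 = h\<^sup>2] (mod int q)} \<le> card (\<Union>d\<in>{d. d dvd q}. S d)"
    using fin by (intro card_mono sub finite_UN_I) (auto simp: S_def intro: finite_subset[of _ "{0..<int q}"])
  also have "\<dots> \<le> (\<Sum>d | d dvd q. card (S d))" by (rule card_UN_le[OF fin])
  also have "\<dots> \<le> (\<Sum>d | d dvd q. if int (gcd d (q div d)) dvd 2 * h then gcd d (q div d) else 0)"
    by (intro sum_mono S) auto
  finally show ?thesis .
qed

text \<open>For a unit h the gcd in the general bound is prime to h, so it divides 2 whenever its
  term is present.\<close>

lemma card_square_roots_unit_le:
  assumes "q > 0" "coprime h (int q)"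
  shows "card {x \<in> {0..<int q}. [x\<^sup>2 = h\<^sup>2] (mod int q)} \<le> 2 * num_divisors q"
proof -
  have "(if int (gcd d (q div d)) dvd 2 * h then gcd d (q div d) else 0) \<le> 2" if "d dvd q" for d
  proof -
    have "int (gcd d (q div d)) dvd int q" using that by (simp only: of_nat_dvd_iff) auto
    then have "coprime (int (gcd d (q div d))) h" using assms(2)
      by (meson coprime_commute coprime_divisors dvd_refl)
    then have "int (gcd d (q div d)) dvd 2 * h \<Longrightarrow> int (gcd d (q div d)) dvd 2"
      by (simp add: coprime_dvd_mult_left_iff)
    then have "int (gcd d (q div d)) dvd 2 * h \<Longrightarrow> int (gcd d (q div d)) \<le> 2"
      using zdvd_imp_le by fastforce
    then show ?thesis by simp
  qed
  then have "(\<Sum>d | d dvd q. if int (gcd d (q div d)) dvd 2 * h then gcd d (q div d) else 0) \<le> (\<Sum>d | d dvd q. 2)"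
    by (intro sum_mono) simp
  then show ?thesis using card_square_roots_le[OF assms(1), of h] by (simp add: num_divisors_def)
qed

text \<open>The frequencies may coincide modulo q, so congruence of frequencies replaces the
  diagonal. Taking squares as frequencies brings in square roots modulo q; taking sums x + y of
  units gives the fourth moment.\<close>

lemma ez_parseval:
  fixes z :: "'a \<Rightarrow> complex" and \<alpha> :: "'a \<Rightarrow> int"
  assumes "q > 0"
  shows "(\<Sum>a\<in>{0..<int q}. (\<Sum>i\<in>I. z i * ez q (a * \<alpha> i)) * cnj (\<Sum>i\<in>I. z i * ez q (a * \<alpha> i))) =
    of_nat q * (\<Sum>i\<in>I. \<Sum>j\<in>I. if [\<alpha> i = \<alpha> j] (mod int q) then z i * cnj (z j) else 0)"
proof -
  have "(\<Sum>a\<in>{0..<int q}. (\<Sum>i\<in>I. z i * ez q (a * \<alpha> i)) * cnj (\<Sum>i\<in>I. z i * ez q (a * \<alpha> i))) =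
     (\<Sum>a\<in>{0..<int q}. \<Sum>i\<in>I. \<Sum>j\<in>I. z i * cnj (z j) * ez q ((\<alpha> i - \<alpha> j) * a))"
  proof -
    have "ez q ((\<alpha> i - \<alpha> j) * a) = ez q (a * \<alpha> i) * cnj (ez q (a * \<alpha> j))" for a i j
      by (simp add: algebra_simps flip: ez_diff)
    then show ?thesis unfolding cnj_sum sum_product by (simp add: mult_ac)
  qed
  also have "\<dots> = (\<Sum>i\<in>I. \<Sum>j\<in>I. \<Sum>a\<in>{0..<int q}. z i * cnj (z j) * ez q ((\<alpha> i - \<alpha> j) * a))"
    by (subst sum.swap) (intro sum.cong refl sum.swap)
  also have "\<dots> = (\<Sum>i\<in>I. \<Sum>j\<in>I. of_nat q * (if [\<alpha> i = \<alpha> j] (mod int q) then z i * cnj (z j) else 0))"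
    by (intro sum.cong refl) (simp add: sum_ez[OF assms] cong_iff_dvd_diff flip: sum_distrib_left)
  finally show ?thesis by (simp add: sum_distrib_left)
qed

text \<open>The right-hand side only sees the values of \<open>f\<close> on equidistributed subsets of at least
  \<open>sqrt q\<close> points, because \<open>gcd d (q div d)\<close> squared divides \<open>q\<close>.\<close>

lemma mean_square_gsum_le:
  fixes f :: "real \<Rightarrow> complex"
  assumes q: "q > 0"
    and R: "\<And>M. M > 0 \<Longrightarrow> q \<le> M\<^sup>2 \<Longrightarrow> (\<Sum>j<M. (cmod (f (real j / real M)))\<^sup>2) \<le> R * real M"
  shows "(\<Sum>p\<in>{0..<int q}. (cmod (\<Sum>h<q. f (real h / real q) * ez q (p * (int h)\<^sup>2)))\<^sup>2)
     \<le> 2 * real (num_divisors q) * (real q)\<^sup>2 * R"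
proof -
  define c where "c = (\<lambda>h::int. f (real_of_int h / real q))"
  define s where "s = (\<lambda>p. \<Sum>h\<in>{0..<int q}. c h * ez q (p * h\<^sup>2))"
  have s: "(\<Sum>h<q. f (real h / real q) * ez q (p * (int h)\<^sup>2)) = s p" for p
    unfolding s_def c_def by (rule sum.reindex_bij_witness[of _ nat int]) auto
  let ?I = "{0..<int q}"
  have *: "complex_of_real (\<Sum>p\<in>?I. (cmod (s p))\<^sup>2) =
     of_nat q * (\<Sum>i\<in>?I. \<Sum>j\<in>?I. if [i\<^sup>2 = j\<^sup>2] (mod int q) then c i * cnj (c j) else 0)"
    using ez_parseval[OF q, where I="?I" and z=c and \<alpha>="\<lambda>h. h\<^sup>2"] by (simp add: s_def complex_norm_square del: of_real_power)
  have "(\<Sum>p\<in>?I. (cmod (s p))\<^sup>2) = cmod (complex_of_real (\<Sum>p\<in>?I. (cmod (s p))\<^sup>2))"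
    by (simp add: sum_nonneg del: of_real_sum)
  also have "\<dots> \<le> real q * (\<Sum>i\<in>?I. \<Sum>j\<in>?I. if [i\<^sup>2 = j\<^sup>2] (mod int q) then cmod (c i) * cmod (c j) else 0)"
    unfolding * norm_mult by (auto intro!: mult_left_mono sum_norm_le simp: norm_mult)
  also have "\<dots> \<le> real q * (\<Sum>i\<in>?I. (cmod (c i))\<^sup>2 * real (card {j\<in>?I. [j\<^sup>2 = i\<^sup>2] (mod int q)}))"
  proof (intro mult_left_mono)
    \<comment> \<open>The relation is symmetric in i and j, so bounding a product by the mean of the
      two squares leaves each square weighted by a number of square roots.\<close>
    have "(\<Sum>i\<in>?I. \<Sum>j\<in>?I. if [i\<^sup>2 = j\<^sup>2] (mod int q) then cmod (c i) * cmod (c j) else 0) \<le>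
       (\<Sum>i\<in>?I. \<Sum>j\<in>?I. (if [j\<^sup>2 = i\<^sup>2] (mod int q) then (cmod (c i))\<^sup>2 / 2 else 0) + (if [i\<^sup>2 = j\<^sup>2] (mod int q) then (cmod (c j))\<^sup>2 / 2 else 0))"
    proof (intro sum_mono)
      fix i j
      have "0 \<le> (cmod (c i) - cmod (c j))\<^sup>2" by simp
      then show "(if [i\<^sup>2 = j\<^sup>2] (mod int q) then cmod (c i) * cmod (c j) else 0) \<le>
         (if [j\<^sup>2 = i\<^sup>2] (mod int q) then (cmod (c i))\<^sup>2 / 2 else 0) + (if [i\<^sup>2 = j\<^sup>2] (mod int q) then (cmod (c j))\<^sup>2 / 2 else 0)"
        by (simp add: cong_sym_eq[of "j\<^sup>2" "i\<^sup>2"] power2_diff field_simps)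
    qed
    also have "\<dots> = 2 * (\<Sum>i\<in>?I. \<Sum>j\<in>?I. (if [j\<^sup>2 = i\<^sup>2] (mod int q) then (cmod (c i))\<^sup>2 / 2 else 0))"
    proof -
      have "(\<Sum>i\<in>?I. \<Sum>j\<in>?I. (if [i\<^sup>2 = j\<^sup>2] (mod int q) then (cmod (c j))\<^sup>2 / 2 else 0)) =
        (\<Sum>i\<in>?I. \<Sum>j\<in>?I. (if [j\<^sup>2 = i\<^sup>2] (mod int q) then (cmod (c i))\<^sup>2 / 2 else 0))"
        by (rule sum.swap)
      then show ?thesis unfolding sum.distrib by simp
    qed
    also have "\<dots> = (\<Sum>i\<in>?I. (cmod (c i))\<^sup>2 * real (card {j\<in>?I. [j\<^sup>2 = i\<^sup>2] (mod int q)}))"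
      unfolding sum_distrib_left by (intro sum.cong refl) (simp flip: sum.inter_filter sum_distrib_left)
    finally show "(\<Sum>i\<in>?I. \<Sum>j\<in>?I. if [i\<^sup>2 = j\<^sup>2] (mod int q) then cmod (c i) * cmod (c j) else 0) \<le>
       (\<Sum>i\<in>?I. (cmod (c i))\<^sup>2 * real (card {j\<in>?I. [j\<^sup>2 = i\<^sup>2] (mod int q)}))" .
  qed simp
  also have "\<dots> \<le> real q * (\<Sum>i\<in>?I. (cmod (c i))\<^sup>2 *
      real (\<Sum>d | d dvd q. if int (gcd d (q div d)) dvd 2 * i then gcd d (q div d) else 0))"
    by (intro mult_left_mono sum_mono of_nat_mono card_square_roots_le q) auto
  also have "\<dots> = real q * (\<Sum>d | d dvd q. \<Sum>i\<in>?I.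
      if int (gcd d (q div d)) dvd 2 * i then real (gcd d (q div d)) * (cmod (c i))\<^sup>2 else 0)"
    unfolding of_nat_sum sum_distrib_left
    by (subst sum.swap) (intro sum.cong refl, auto)
  also have "\<dots> \<le> real q * (\<Sum>d | d dvd q. 2 * real q * R)"
  proof (intro mult_left_mono sum_mono)
    fix d assume d: "d \<in> {d. d dvd q}"
    define g where "g = gcd d (q div d)"
    \<comment> \<open>The condition that g divides 2 i confines i to multiples of g'. As g'^2
      divides q, there are M = q / g' of them with q \<le> M^2, and on them i / q runs through the
      fractions j / M.\<close>
    define g' where "g' = (if even g then g div 2 else g)"
    have g0: "g > 0" using d q by (auto simp: g_def intro: Nat.gr0I)
    have g'g: "g' dvd g" "g \<le> 2 * g'" "g' > 0" using g0 by (auto simp: g'_def elim: evenE)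
    have "g * g dvd q"
    proof -
      have "g * g dvd d * (q div d)" unfolding g_def by (intro mult_dvd_mono) auto
      then show ?thesis using d by simp
    qed
    then have g'2: "g' * g' dvd q" using g'g(1) by (meson dvd_trans mult_dvd_mono)
    then obtain t where t: "q = g' * g' * t" by blast
    define M where "M = g' * t"
    have qM: "q = g' * M" by (simp add: M_def t)
    have M0: "M > 0" using qM q by (auto intro: Nat.gr0I)
    have "t > 0" using t q by (auto intro: Nat.gr0I)
    then have "q \<le> M\<^sup>2" unfolding M_def t by (simp add: power2_eq_square)
    have dv: "int g' dvd i" if "int g dvd 2 * i" for i
    proof (cases "even g")
      case True then show ?thesis using that by (auto simp: g'_def elim!: evenE)
    next
      case False
      then have "coprime (int g) 2" by (simp add: coprime_right_2_iff_odd)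
      then have "int g dvd i" using that by (simp add: coprime_dvd_mult_right_iff)
      then show ?thesis using False by (simp add: g'_def)
    qed
    have "(\<Sum>i\<in>?I. if int g dvd 2 * i then real g * (cmod (c i))\<^sup>2 else 0) \<le>
       (\<Sum>i\<in>?I. if int g' dvd i then 2 * real g' * (cmod (c i))\<^sup>2 else 0)"
      using dv g'g(2) by (intro sum_mono) (auto intro!: mult_right_mono)
    also have "\<dots> = (\<Sum>i\<in>{i\<in>?I. int g' dvd i}. 2 * real g' * (cmod (c i))\<^sup>2)"
      by (subst sum.inter_filter) auto
    also have "\<dots> = (\<Sum>j<M. 2 * real g' * (cmod (f (real j / real M)))\<^sup>2)"
    proof (rule sum.reindex_bij_witness[of _ "\<lambda>j. int (g' * j)" "\<lambda>i. nat (i div int g')"])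
      fix i assume "i \<in> {i\<in>?I. int g' dvd i}"
      then obtain k where k: "i = int g' * k" "0 \<le> i" "i < int q" by auto
      then have k0: "k \<ge> 0" "k < int M" using g'g(3) qM by (auto simp: zero_le_mult_iff)
      then show "int (g' * nat (i div int g')) = i" "nat (i div int g') \<in> {..<M}"
        using k g'g(3) by auto
      have "real_of_int i / real q = real (nat k) / real M"
        using k k0 g'g(3) M0 by (simp add: qM)
      then show "2 * real g' * (cmod (f (real (nat (i div int g')) / real M)))\<^sup>2 = 2 * real g' * (cmod (c i))\<^sup>2"
        using k g'g(3) by (simp add: c_def)
    qed (use g'g(3) qM in auto)
    also have "\<dots> \<le> 2 * real g' * (R * real M)"
      using R[OF M0 \<open>q \<le> M\<^sup>2\<close>] g'g(3) by (simp flip: sum_distrib_left)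
    also have "\<dots> = 2 * real q * R" by (simp add: qM)
    finally show "(\<Sum>i\<in>?I. if int (gcd d (q div d)) dvd 2 * i then real (gcd d (q div d)) * (cmod (c i))\<^sup>2 else 0) \<le> 2 * real q * R"
      by (simp only: g_def)
  qed simp
  also have "\<dots> = 2 * real (num_divisors q) * (real q)\<^sup>2 * R"
    by (simp add: num_divisors_def power2_eq_square)
  finally show ?thesis by (simp only: s)
qed


section \<open>Units, inverses and weighted Kloosterman sums\<close>

definition units_mod :: "nat \<Rightarrow> int set" where
  "units_mod q = {x \<in> {0..<int q}. coprime x (int q)}"

lemma finite_units_mod [simp]: "finite (units_mod q)"
  by (rule finite_subset[of _ "{0..<int q}"]) (auto simp: units_mod_def)

lemma card_units_mod: "q > 0 \<Longrightarrow> card (units_mod q) = totient q"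
proof -
  assume q: "q > 0"
  show ?thesis
  \<comment> \<open>Modulo 1 the unit is represented by 0 here but by 1 among the totatives, so
    \<open>nat\<close> gives a bijection only for q > 1.\<close>
  proof (cases "q = 1")
    case True
    then have "units_mod q = {0}" by (auto simp: units_mod_def)
    then show ?thesis using True by simp
  next
    case False
    then have q1: "q > 1" using q by simp
    have "bij_betw nat (units_mod q) (totatives q)"
    proof (rule bij_betw_byWitness[where f'=int])
      show "nat ` units_mod q \<subseteq> totatives q"
      proof
        fix y assume "y \<in> nat ` units_mod q"
        then obtain x where x: "x \<in> units_mod q" "y = nat x" by blast
        then have "int y = x" by (auto simp: units_mod_def)
        then have "int y \<in> units_mod q" using x(1) by simp
        then have y: "0 \<le> int y" "int y < int q" "coprime (int y) (int q)" by (auto simp: units_mod_def)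
        then have "y \<noteq> 0" using q1 by (intro notI) simp
        then show "y \<in> totatives q" using y by (auto simp: totatives_def)
      qed
      show "int ` totatives q \<subseteq> units_mod q"
        using q1 totatives_less by (auto simp: totatives_def units_mod_def)
    qed (auto simp: units_mod_def)
    then show ?thesis by (simp add: totient_def bij_betw_same_card)
  qed
qed

lemma sum_units_mod_mult:
  fixes F :: "int \<Rightarrow> 'b::comm_monoid_add"
  assumes per: "\<And>a b. [a = b] (mod int q) \<Longrightarrow> F a = F b" and u: "coprime u (int q)"
  shows "(\<Sum>x\<in>units_mod q. F (u * x)) = (\<Sum>x\<in>units_mod q. F x)"
proof -
  let ?G = "\<lambda>x. if coprime x (int q) then F x else 0"
  have "?G a = ?G b" if "[a = b] (mod int q)" for a b
    using that per cong_imp_coprime cong_sym by metis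
  then have "(\<Sum>h\<in>{0..<int q}. ?G (u * h)) = (\<Sum>h\<in>{0..<int q}. ?G h)"
    using u by (rule sum_residues_mult[where F="?G"])
  moreover have "?G (u * h) = (if coprime h (int q) then F (u * h) else 0)" for h using u by simp
  ultimately show ?thesis unfolding units_mod_def by (subst (1 2) sum.inter_filter) auto
qed

abbreviation minv :: "nat \<Rightarrow> int \<Rightarrow> int" where
  "minv q x \<equiv> modular_inverse (int q) x"

lemma minv_cong: "coprime x (int q) \<Longrightarrow> [x * minv q x = 1] (mod int q)"
  by (rule cong_modular_inverse1)

lemma cong_minv_iff:
  assumes "coprime x (int q)"
  shows "[y = minv q x] (mod int q) \<longleftrightarrow> [x * y = 1] (mod int q)"
proof -
  have "[x * y = 1] (mod int q) \<longleftrightarrow> [x * y = x * minv q x] (mod int q)"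
    using minv_cong[OF assms] by (meson cong_sym cong_trans)
  also have "\<dots> \<longleftrightarrow> [y = minv q x] (mod int q)" by (rule cong_mult_lcancel[OF assms])
  finally show ?thesis by simp
qed

lemma coprime_minv: "coprime x (int q) \<Longrightarrow> coprime (minv q x) (int q)"
  by (rule coprime_modular_inverse)

lemma minv_mod_cong:
  assumes "[x = y] (mod int q)" "coprime x (int q)"
  shows "[minv q x = minv q y] (mod int q)"
proof -
  have y: "coprime y (int q)" using assms cong_imp_coprime by blast
  have "[y * minv q x = x * minv q x] (mod int q)" using assms(1) by (intro cong_mult cong_refl) (rule cong_sym)
  also have "[x * minv q x = 1] (mod int q)" using assms(2) by (rule minv_cong)
  finally show ?thesis using y by (simp add: cong_minv_iff)
qed

lemma minv_mult_cong:
  assumes "coprime x (int q)" "coprime y (int q)"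
  shows "[minv q (x * y) = minv q x * minv q y] (mod int q)"
proof -
  have "[(x * minv q x) * (y * minv q y) = 1 * 1] (mod int q)"
    by (intro cong_mult minv_cong assms)
  then have "[x * y * (minv q x * minv q y) = 1] (mod int q)" by (simp add: mult_ac)
  then show ?thesis using assms by (subst cong_sym_eq) (simp add: cong_minv_iff)
qed

lemma minv_minv_cong: "coprime x (int q) \<Longrightarrow> [minv q (minv q x) = x] (mod int q)"
  using minv_cong[of x q] by (subst cong_sym_eq) (simp add: cong_minv_iff coprime_minv mult.commute)

lemma minv_units_mod: "q > 0 \<Longrightarrow> x \<in> units_mod q \<Longrightarrow> minv q x \<in> units_mod q"
  by (auto simp: units_mod_def coprime_minv modular_inverse_int_nonneg modular_inverse_int_less)

text \<open>The class of weights for which sums can be twisted by u^2. Indicators of a value of the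
  Gauss sum belong to it by \<open>gs_mult_square\<close>.\<close>

definition square_invariant :: "nat \<Rightarrow> (int \<Rightarrow> complex) \<Rightarrow> bool" where
  "square_invariant q w \<longleftrightarrow> (\<forall>x y. [x = y] (mod int q) \<longrightarrow> w x = w y) \<and>
     (\<forall>x u. coprime x (int q) \<longrightarrow> coprime u (int q) \<longrightarrow> w (x * u\<^sup>2) = w x) \<and> (\<forall>x. cmod (w x) \<le> 1)"

definition kloosterman :: "nat \<Rightarrow> (int \<Rightarrow> complex) \<Rightarrow> int \<Rightarrow> int \<Rightarrow> complex" where
  "kloosterman q w m n = (\<Sum>x\<in>units_mod q. w x * ez q (m * x + n * minv q x))"

lemma kloosterman_mod_cong:
  assumes "[m = m'] (mod int q)" "[n = n'] (mod int q)"
  shows "kloosterman q w m n = kloosterman q w m' n'"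
  unfolding kloosterman_def
  by (intro sum.cong refl arg_cong2[where f="(*)"] ez_cong cong_add cong_mult assms cong_refl)

text \<open>Substitute u^2 x for x. Only square multipliers leave the weight unchanged, which is why
  u enters through its square.\<close>

lemma kloosterman_twist:
  assumes w: "square_invariant q w" and u: "coprime u (int q)"
  shows "kloosterman q w (m * u\<^sup>2) (n * (minv q u)\<^sup>2) = kloosterman q w m n"
proof -
  define F where "F = (\<lambda>x. if coprime x (int q) then w x * ez q (m * x + n * minv q x) else 0)"
  have per: "F a = F b" if ab: "[a = b] (mod int q)" for a b
  proof (cases "coprime a (int q)")
    case True
    then have "coprime b (int q)" using ab cong_imp_coprime by blast
    then show ?thesis using True ab w minv_mod_cong[OF ab True] unfolding F_def square_invariant_def
      by (auto intro!: arg_cong2[where f="(*)"] ez_cong cong_add cong_mult)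
  next
    case False
    then have "\<not> coprime b (int q)" using ab cong_imp_coprime cong_sym by blast
    then show ?thesis using False by (simp add: F_def)
  qed
  have "kloosterman q w m n = (\<Sum>x\<in>units_mod q. F x)"
    by (simp add: kloosterman_def F_def units_mod_def)
  also have "\<dots> = (\<Sum>x\<in>units_mod q. F (u\<^sup>2 * x))"
    using u by (intro sum_units_mod_mult[symmetric] per) auto
  also have "\<dots> = (\<Sum>x\<in>units_mod q. w x * ez q (m * u\<^sup>2 * x + n * (minv q u)\<^sup>2 * minv q x))"
  proof (intro sum.cong refl)
    fix x assume "x \<in> units_mod q"
    then have x: "coprime x (int q)" by (simp add: units_mod_def)
    have "[minv q (u * (u * x)) = minv q u * minv q (u * x)] (mod int q)"
      using u x by (intro minv_mult_cong) auto
    also have "[minv q u * minv q (u * x) = minv q u * (minv q u * minv q x)] (mod int q)"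
      using u x by (intro cong_mult cong_refl minv_mult_cong)
    finally have "[minv q (u\<^sup>2 * x) = (minv q u)\<^sup>2 * minv q x] (mod int q)"
      by (simp add: power2_eq_square mult.assoc)
    then have "ez q (m * (u\<^sup>2 * x) + n * minv q (u\<^sup>2 * x)) = ez q (m * (u\<^sup>2 * x) + n * ((minv q u)\<^sup>2 * minv q x))"
      by (intro ez_cong cong_add cong_mult cong_refl)
    moreover have "w (u\<^sup>2 * x) = w x" using w x u by (simp add: square_invariant_def mult.commute)
    ultimately show "F (u\<^sup>2 * x) = w x * ez q (m * u\<^sup>2 * x + n * (minv q u)\<^sup>2 * minv q x)"
      using x u by (simp add: F_def mult_ac)
  qed
  also have "\<dots> = kloosterman q w (m * u\<^sup>2) (n * (minv q u)\<^sup>2)" by (simp add: kloosterman_def)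
  finally show ?thesis by simp
qed

text \<open>Inversion of x exchanges the two frequencies and composes the weight with inversion. A
  bound in terms of the gcd of the first frequency with q thus yields one in terms of the
  second.\<close>

lemma kloosterman_swap:
  assumes q: "q > 0" and w: "square_invariant q w"
  shows "\<exists>w'. square_invariant q w' \<and> (\<forall>m n. kloosterman q w m n = kloosterman q w' n m)"
proof (intro exI conjI allI)
  let ?w = "\<lambda>x. w (minv q x)"
  \<comment> \<open>Congruent arguments are known to have congruent inverses only if they are units,
    so cutting off at the units keeps the new weight periodic.\<close>
  define w' where "w' = (\<lambda>x. if coprime x (int q) then ?w x else 0)"
  show "square_invariant q w'"
    unfolding square_invariant_def
  proof (intro conjI allI impI)
    fix x y assume xy: "[x = y] (mod int q)"
    show "w' x = w' y"
    proof (cases "coprime x (int q)")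
      case True
      then have "coprime y (int q)" using xy cong_imp_coprime by blast
      moreover have "?w x = ?w y" using minv_mod_cong[OF xy True] w by (simp add: square_invariant_def)
      ultimately show ?thesis using True by (simp add: w'_def)
    next
      case False
      then have "\<not> coprime y (int q)" using xy cong_imp_coprime cong_sym by blast
      then show ?thesis using False by (simp add: w'_def)
    qed
  next
    fix x u assume x: "coprime x (int q)" and u: "coprime u (int q)"
    have "[minv q (x * u * u) = minv q (x * u) * minv q u] (mod int q)"
      using u x by (intro minv_mult_cong) auto
    also have "[minv q (x * u) * minv q u = minv q x * minv q u * minv q u] (mod int q)"
      using u x by (intro cong_mult cong_refl minv_mult_cong)
    finally have "[minv q (x * u\<^sup>2) = minv q x * (minv q u)\<^sup>2] (mod int q)"
      by (simp add: power2_eq_square mult.assoc)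
    then have "?w (x * u\<^sup>2) = w (minv q x * (minv q u)\<^sup>2)" using w by (simp add: square_invariant_def)
    also have "\<dots> = ?w x" using w x u coprime_minv by (simp add: square_invariant_def)
    finally show "w' (x * u\<^sup>2) = w' x" using x u by (simp add: w'_def)
  next
    fix x show "cmod (w' x) \<le> 1" using w by (simp add: square_invariant_def w'_def)
  qed
  have ii: "minv q (minv q x) = x" if x: "x \<in> units_mod q" for x
  proof -
    have "minv q (minv q x) \<in> units_mod q" using x q by (simp add: minv_units_mod)
    moreover have "[minv q (minv q x) = x] (mod int q)" using x by (intro minv_minv_cong) (simp add: units_mod_def)
    ultimately show ?thesis using x unfolding units_mod_def by (intro cong_less_imp_eq) auto
  qed
  fix m n
  show "kloosterman q w m n = kloosterman q w' n m"
    unfolding kloosterman_def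
  proof (rule sum.reindex_bij_witness[of _ "minv q" "minv q"])
    fix x assume x: "x \<in> units_mod q"
    show "minv q (minv q x) = x" using ii x .
    show "minv q x \<in> units_mod q" using x q by (simp add: minv_units_mod)
    then have "coprime (minv q x) (int q)" by (simp add: units_mod_def)
    then show "w' (minv q x) * ez q (n * minv q x + m * minv q (minv q x)) = w x * ez q (m * x + n * minv q x)"
      using ii[OF x] by (simp add: w'_def add.commute)
  qed (use q ii in \<open>auto simp: minv_units_mod\<close>)
qed


section \<open>The fourth moment of Kloosterman sums\<close>

lemma card_dvd_translate:
  assumes "P dvd q" "P > 0"
  shows "card {x \<in> {0..<int q}. int P dvd x + c} \<le> q div P"
proof -
  have q: "q = P * (q div P)" using assms by simp
  have "{x \<in> {0..<int q}. int P dvd x + c} = {x \<in> {0..<int (P * (q div P))}. [x = - c] (mod int P)}"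
    unfolding q[symmetric] by (simp add: cong_iff_dvd_diff)
  then show ?thesis using card_residue_class_le[OF assms(2)] by simp
qed

definition additive_quads :: "nat \<Rightarrow> ((int \<times> int) \<times> (int \<times> int)) set" where
  "additive_quads q = {((x, y), (z, v)). x \<in> units_mod q \<and> y \<in> units_mod q \<and> z \<in> units_mod q \<and> v \<in> units_mod q \<and>
     [x + y = z + v] (mod int q) \<and> [minv q x + minv q y = minv q z + minv q v] (mod int q)}"

text \<open>Multiplying the equation between inverses by x y z v gives (x + y) z v = (z + v) x y
  modulo q; once v is eliminated by z + v = x + y, the difference of the two sides factors.\<close>

lemma additive_quads_dvd:
  assumes "((x, y), (z, v)) \<in> additive_quads q"
  shows "int q dvd (x + y) * (z - x) * (z - y)"
proof -
  have U: "coprime x (int q)" "coprime y (int q)" "coprime z (int q)" "coprime v (int q)"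
    and s: "[x + y = z + v] (mod int q)"
    and i: "[minv q x + minv q y = minv q z + minv q v] (mod int q)"
    using assms by (auto simp: additive_quads_def units_mod_def)
  have A: "[(minv q x + minv q y) * (x * y * z * v) = (x + y) * (z * v)] (mod int q)"
  proof -
    have "(minv q x + minv q y) * (x * y * z * v) = y * (z * v) * (x * minv q x) + x * (z * v) * (y * minv q y)"
      by (simp add: algebra_simps)
    also have "[\<dots> = y * (z * v) * 1 + x * (z * v) * 1] (mod int q)"
      using U by (intro cong_add cong_mult cong_refl minv_cong)
    finally show ?thesis by (simp add: algebra_simps)
  qed
  have B: "[(minv q z + minv q v) * (x * y * z * v) = (z + v) * (x * y)] (mod int q)"
  proof -
    have "(minv q z + minv q v) * (x * y * z * v) = v * (x * y) * (z * minv q z) + z * (x * y) * (v * minv q v)"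
      by (simp add: algebra_simps)
    also have "[\<dots> = v * (x * y) * 1 + z * (x * y) * 1] (mod int q)"
      using U by (intro cong_add cong_mult cong_refl minv_cong)
    finally show ?thesis by (simp add: algebra_simps)
  qed
  have "[(x + y) * (z * v) = (minv q x + minv q y) * (x * y * z * v)] (mod int q)" using A by (rule cong_sym)
  also have "[(minv q x + minv q y) * (x * y * z * v) = (minv q z + minv q v) * (x * y * z * v)] (mod int q)"
    by (intro cong_mult cong_refl i)
  also have "[(minv q z + minv q v) * (x * y * z * v) = (z + v) * (x * y)] (mod int q)" by (rule B)
  also have "[(z + v) * (x * y) = (x + y) * (x * y)] (mod int q)" by (intro cong_mult cong_refl cong_sym[OF s])
  finally have 1: "int q dvd (x + y) * (z * v) - (x + y) * (x * y)" by (simp add: cong_iff_dvd_diff)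
  have 2: "int q dvd (x + y) * z * (x + y - (z + v))" using s by (simp add: cong_iff_dvd_diff)
  have "(x + y) * (z - x) * (z - y) = - ((x + y) * (z * v) - (x + y) * (x * y)) - (x + y) * z * (x + y - (z + v))"
    by (simp add: algebra_simps)
  then show ?thesis using 1 2 by (metis dvd_diff dvd_minus_iff)
qed

text \<open>The modulus q could be spread over the three factors in many ways, whereas a prime
  divisor P must divide one of them. Each possibility is a linear condition modulo P on (x, y, z),
  and these three coordinates determine v.\<close>

lemma card_additive_quads_le:
  assumes P: "prime P" "P dvd q" and q: "q > 0"
  shows "card (additive_quads q) \<le> 3 * q\<^sup>2 * (q div P)"
proof -
  let ?I = "{0..<int q}"
  \<comment> \<open>The constrained coordinate is listed last, so that a single count
    \<open>S\<close> serves all three sets; for T1 this permutes the coordinates.\<close>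
  define T1 where "T1 = (SIGMA y:?I. SIGMA z:?I. {x\<in>?I. int P dvd x + y})"
  define T2 where "T2 = (SIGMA x:?I. SIGMA y:?I. {z\<in>?I. int P dvd z + (- x)})"
  define T3 where "T3 = (SIGMA x:?I. SIGMA y:?I. {z\<in>?I. int P dvd z + (- y)})"
  have fin: "finite {x\<in>?I. int P dvd x + c}" for c by (rule finite_subset[of _ ?I]) auto
  have P0: "P > 0" using P(1) by (simp add: prime_gt_0_nat)
  have card_le: "card {x\<in>?I. int P dvd x + c} \<le> q div P" for c using card_dvd_translate[OF P(2) P0] .
  have S: "card (SIGMA y:?I. SIGMA z:?I. {x\<in>?I. int P dvd x + f y z}) \<le> q\<^sup>2 * (q div P)" for f
  proof -
    have "card (SIGMA y:?I. SIGMA z:?I. {x\<in>?I. int P dvd x + f y z}) =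
       (\<Sum>y\<in>?I. \<Sum>z\<in>?I. card {x\<in>?I. int P dvd x + f y z})"
      using fin by (subst card_SigmaI; simp)+
    also have "\<dots> \<le> (\<Sum>y\<in>?I. \<Sum>z\<in>?I. q div P)" by (intro sum_mono card_le)
    also have "\<dots> = q\<^sup>2 * (q div P)" by (simp add: power2_eq_square)
    finally show ?thesis .
  qed
  have finS: "finite (SIGMA y:?I. SIGMA z:?I. {x\<in>?I. int P dvd x + f y z})" for f
    using fin by (intro finite_SigmaI) auto
  define \<pi> where "\<pi> = (\<lambda>((x::int, y::int), (z::int, v::int)). (x, y, z))"
  let ?T = "(\<lambda>(y,z,x). (x,y,z)) ` T1 \<union> (T2 \<union> T3)"
  have "inj_on \<pi> (additive_quads q)"
  proof (rule inj_onI)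
    fix s t assume st: "s \<in> additive_quads q" "t \<in> additive_quads q" "\<pi> s = \<pi> t"
    obtain x y z v where s: "s = ((x,y),(z,v))" by (metis surj_pair)
    obtain x' y' z' v' where t: "t = ((x',y'),(z',v'))" by (metis surj_pair)
    have eq: "x' = x" "y' = y" "z' = z" using st(3) by (auto simp: s t \<pi>_def)
    have "[z + v = x + y] (mod int q)" "[x + y = z + v'] (mod int q)"
      using st(1,2) eq by (auto simp: s t additive_quads_def cong_sym_eq)
    then have "[z + v = z + v'] (mod int q)" by (rule cong_trans)
    then have "[v = v'] (mod int q)" by (simp add: cong_add_lcancel)
    moreover have "v \<in> ?I" "v' \<in> ?I" using st(1,2) by (auto simp: s t additive_quads_def units_mod_def)
    ultimately have "v = v'" by (rule cong_less_imp_eq)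
    then show "s = t" using eq by (simp add: s t)
  qed
  moreover have "\<pi> ` additive_quads q \<subseteq> ?T"
  proof
    fix w assume "w \<in> \<pi> ` additive_quads q"
    then obtain x y z v where w: "((x,y),(z,v)) \<in> additive_quads q" "w = (x, y, z)"
      by (auto simp: \<pi>_def)
    have "int P dvd int q" using P(2) by simp
    then have "int P dvd (x + y) * (z - x) * (z - y)" using additive_quads_dvd[OF w(1)] by (rule dvd_trans)
    then have "int P dvd x + y \<or> int P dvd z - x \<or> int P dvd z - y"
      using P(1) by (simp add: prime_dvd_mult_iff)
    moreover have "x \<in> ?I" "y \<in> ?I" "z \<in> ?I" using w(1) by (auto simp: additive_quads_def units_mod_def)
    ultimately show "w \<in> ?T" unfolding w(2) T1_def T2_def T3_def
      by (auto simp: image_iff)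
  qed
  moreover have "finite ?T" unfolding T1_def T2_def T3_def by (intro finite_UnI finite_imageI finS)
  ultimately have "card (additive_quads q) \<le> card ?T" by (rule card_inj_on_le)
  also have "\<dots> \<le> card ((\<lambda>(y,z,x). (x,y,z)) ` T1) + (card T2 + card T3)"
    by (rule order_trans[OF card_Un_le add_left_mono[OF card_Un_le]])
  also have "card ((\<lambda>(y,z,x). (x,y,z)) ` T1) \<le> card T1"
    unfolding T1_def by (intro card_image_le finS)
  also have "card T1 + (card T2 + card T3) \<le> 3 * (q\<^sup>2 * (q div P))"
    using S[of "\<lambda>y z. y"] S[of "\<lambda>x y. - x"] S[of "\<lambda>x y. - y"] unfolding T1_def T2_def T3_def by linarith
  finally show ?thesis by simp
qed

lemma kloosterman_fourth_moment:
  assumes q: "q > 0" and w: "\<And>x. cmod (w x) \<le> 1"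
  shows "(\<Sum>a\<in>{0..<int q}. \<Sum>b\<in>{0..<int q}. (cmod (kloosterman q w a b)) ^ 4) \<le> (real q)\<^sup>2 * real (card (additive_quads q))"
proof -
  let ?I = "{0..<int q}" let ?U = "units_mod q"
  let ?V = "?U \<times> ?U"
  define z where "z = (\<lambda>(x,y). w x * w y)"
  define \<alpha> where "\<alpha> = (\<lambda>(x::int,y::int). x + y)"
  define \<beta> where "\<beta> = (\<lambda>(x,y). minv q x + minv q y)"
  have sq: "(kloosterman q w a b)\<^sup>2 = (\<Sum>i\<in>?V. z i * ez q (b * \<beta> i) * ez q (a * \<alpha> i))" for a b
    unfolding kloosterman_def power2_eq_square sum_product sum.cartesian_product
    by (intro sum.cong refl) (auto simp: z_def \<alpha>_def \<beta>_def distrib_left ez_add mult_ac)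
  have "complex_of_real (\<Sum>b\<in>?I. \<Sum>a\<in>?I. (cmod (kloosterman q w a b)) ^ 4) =
     (\<Sum>b\<in>?I. \<Sum>a\<in>?I. (kloosterman q w a b)\<^sup>2 * cnj ((kloosterman q w a b)\<^sup>2))"
  proof (simp only: of_real_sum, intro sum.cong refl)
    fix a b
    have "(cmod (kloosterman q w a b)) ^ 4 = (cmod ((kloosterman q w a b)\<^sup>2))\<^sup>2"
      by (simp add: norm_power)
    then show "complex_of_real ((cmod (kloosterman q w a b)) ^ 4) = (kloosterman q w a b)\<^sup>2 * cnj ((kloosterman q w a b)\<^sup>2)"
      by (simp only: complex_norm_square)
  qed
  also have "\<dots> = (\<Sum>b\<in>?I. of_nat q * (\<Sum>i\<in>?V. \<Sum>j\<in>?V. if [\<alpha> i = \<alpha> j] (mod int q)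
       then (z i * ez q (b * \<beta> i)) * cnj (z j * ez q (b * \<beta> j)) else 0))"
    unfolding sq by (intro sum.cong refl ez_parseval q)
  also have "\<dots> = of_nat q * (\<Sum>i\<in>?V. \<Sum>j\<in>?V. if [\<alpha> i = \<alpha> j] (mod int q)
       then z i * cnj (z j) * (\<Sum>b\<in>?I. ez q ((\<beta> i - \<beta> j) * b)) else 0)"
  proof -
    have "ez q ((\<beta> i - \<beta> j) * b) = ez q (b * \<beta> i) * cnj (ez q (b * \<beta> j))" for b i j
      by (simp add: algebra_simps flip: ez_diff)
    then have *: "(\<Sum>b\<in>?I. if [\<alpha> i = \<alpha> j] (mod int q) then (z i * ez q (b * \<beta> i)) * cnj (z j * ez q (b * \<beta> j)) else 0)
      = (if [\<alpha> i = \<alpha> j] (mod int q) then z i * cnj (z j) * (\<Sum>b\<in>?I. ez q ((\<beta> i - \<beta> j) * b)) else 0)" for i j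
      by (simp add: sum_distrib_left mult_ac)
    have "(\<Sum>b\<in>?I. \<Sum>i\<in>?V. \<Sum>j\<in>?V. h b i j) = (\<Sum>i\<in>?V. \<Sum>j\<in>?V. \<Sum>b\<in>?I. h b i j)" for h :: "_ \<Rightarrow> _ \<Rightarrow> _ \<Rightarrow> complex"
      by (subst sum.swap) (intro sum.cong refl sum.swap)
    then show ?thesis unfolding sum_distrib_left[symmetric] by (simp only: *)
  qed
  also have "\<dots> = of_nat q * (\<Sum>i\<in>?V. \<Sum>j\<in>?V. if (i, j) \<in> additive_quads q then z i * cnj (z j) * of_nat q else 0)"
    unfolding sum_ez[OF q]
    by (intro sum.cong refl arg_cong2[where f="(*)"])
      (auto simp: additive_quads_def \<alpha>_def \<beta>_def cong_iff_dvd_diff)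
  finally have *: "complex_of_real (\<Sum>b\<in>?I. \<Sum>a\<in>?I. (cmod (kloosterman q w a b)) ^ 4) = \<dots>" .
  have "(\<Sum>b\<in>?I. \<Sum>a\<in>?I. (cmod (kloosterman q w a b)) ^ 4) =
     cmod (complex_of_real (\<Sum>b\<in>?I. \<Sum>a\<in>?I. (cmod (kloosterman q w a b)) ^ 4))"
    by (simp add: sum_nonneg del: of_real_sum)
  also have "\<dots> \<le> real q * (\<Sum>i\<in>?V. \<Sum>j\<in>?V. if (i, j) \<in> additive_quads q then real q else 0)"
    unfolding * norm_mult
  proof (intro mult_mono sum_norm_le)
    fix i j
    have "cmod (z k) \<le> 1" for k
      using w by (auto simp: z_def norm_mult intro!: mult_le_one split: prod.split)
    then have "cmod (z i) * cmod (z j) \<le> 1" by (intro mult_le_one) auto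
    then show "cmod (if (i, j) \<in> additive_quads q then z i * cnj (z j) * of_nat q else 0) \<le>
        (if (i, j) \<in> additive_quads q then real q else 0)"
      using mult_right_mono[of "cmod (z i) * cmod (z j)" 1 "real q"] by (auto simp: norm_mult)
  qed (auto intro!: sum_nonneg)
  also have "\<dots> = real q * (\<Sum>p\<in>?V \<times> ?V. if p \<in> additive_quads q then real q else 0)"
    by (simp add: sum.cartesian_product case_prod_unfold)
  also have "\<dots> = (real q)\<^sup>2 * real (card {p \<in> ?V \<times> ?V. p \<in> additive_quads q})"
    by (subst sum.inter_filter[symmetric]) (auto simp: power2_eq_square)
  also have "{p \<in> ?V \<times> ?V. p \<in> additive_quads q} = additive_quads q"
    by (auto simp: additive_quads_def)
  finally show ?thesis by (subst sum.swap)
qed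

lemma sum_le_card_fibres:
  fixes G :: "'b \<Rightarrow> real"
  assumes "finite A" "finite T" "f ` A \<subseteq> T" "\<And>t. t \<in> T \<Longrightarrow> G t \<ge> 0"
    and "\<And>a. a \<in> A \<Longrightarrow> card {b \<in> A. f b = f a} \<le> c"
  shows "(\<Sum>a\<in>A. G (f a)) \<le> real c * (\<Sum>t\<in>T. G t)"
proof -
  have "(\<Sum>a\<in>A. G (f a)) = (\<Sum>t\<in>T. \<Sum>a\<in>{a\<in>A. f a = t}. G (f a))"
    using sum.group[OF assms(1,2,3), of "\<lambda>a. G (f a)"] by simp
  also have "\<dots> = (\<Sum>t\<in>T. real (card {a\<in>A. f a = t}) * G t)"
    by (intro sum.cong refl) simp
  also have "\<dots> \<le> (\<Sum>t\<in>T. real c * G t)"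
  proof (intro sum_mono mult_right_mono of_nat_mono)
    fix t assume t: "t \<in> T"
    show "G t \<ge> 0" using assms(4) t .
    show "card {a\<in>A. f a = t} \<le> c"
    proof (cases "\<exists>a\<in>A. f a = t")
      case True then show ?thesis using assms(5) by auto
    next
      case False then have "{a\<in>A. f a = t} = {}" by auto
      then show ?thesis by (simp only: card.empty)
    qed
  qed
  finally show ?thesis by (simp add: sum_distrib_left)
qed

text \<open>Cancelling g = gcd(m, q) leaves a congruence between u^2 and a^2 modulo q / g. This
  allows at most g values of u^2 modulo q, each with at most \<open>2 * num_divisors q\<close> roots
  among the units.\<close>

lemma card_square_multiple_fibre:
  assumes q: "q > 0"
  shows "card {u \<in> units_mod q. [m * u\<^sup>2 = m * a\<^sup>2] (mod int q)} \<le> nat (gcd m (int q)) * (2 * num_divisors q)"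
proof -
  let ?A = "{u \<in> units_mod q. [m * u\<^sup>2 = m * a\<^sup>2] (mod int q)}"
  define g where "g = nat (gcd m (int q))"
  have gi: "int g = gcd m (int q)" by (simp add: g_def)
  have "g dvd q" by (metis gcd_dvd2 gi of_nat_dvd_iff)
  then obtain L where L: "q = L * g" by (metis dvd_def mult.commute)
  have g0: "g > 0" "L > 0" using L q by (auto intro: Nat.gr0I)
  let ?T = "{c \<in> {0..<int q}. [c = a\<^sup>2] (mod int L)}"
  have sub: "(\<lambda>u. u\<^sup>2 mod int q) ` ?A \<subseteq> ?T"
  proof
    fix c assume "c \<in> (\<lambda>u. u\<^sup>2 mod int q) ` ?A"
    then obtain u where u: "c = u\<^sup>2 mod int q" "int q dvd m * (u\<^sup>2 - a\<^sup>2)"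
      by (auto simp: cong_iff_dvd_diff algebra_simps)
    obtain m' where m': "m = m' * int g" "coprime m' (int L)"
    proof -
      have "gcd m (int q) \<noteq> 0" using q by simp
      then obtain m' q' where "m = m' * gcd m (int q)" "int q = q' * gcd m (int q)" "coprime m' q'"
        using gcd_coprime_exists[of m "int q"] by blast
      moreover then have "q' = int L" using L g0 gi by (metis mult_cancel_right of_nat_0_less_iff of_nat_mult less_irrefl)
      ultimately show ?thesis using that gi by auto
    qed
    have "int L * int g dvd (m' * (u\<^sup>2 - a\<^sup>2)) * int g" using u(2) by (simp add: L m'(1) mult_ac)
    then have "int L dvd m' * (u\<^sup>2 - a\<^sup>2)" using g0 by simp
    then have "int L dvd u\<^sup>2 - a\<^sup>2" using m'(2) by (simp add: coprime_dvd_mult_right_iff coprime_commute)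
    moreover have "[c = u\<^sup>2] (mod int L)"
    proof (rule cong_dvd_modulus)
      show "[c = u\<^sup>2] (mod int q)" unfolding u(1) by (simp add: cong_def)
      show "int L dvd int q" unfolding L by simp
    qed
    moreover have "[u\<^sup>2 = a\<^sup>2] (mod int L)" using \<open>int L dvd u\<^sup>2 - a\<^sup>2\<close> by (simp add: cong_iff_dvd_diff)
    ultimately have "[c = a\<^sup>2] (mod int L)" using cong_trans by blast
    then show "c \<in> ?T" using u(1) q by simp
  qed
  have finT: "finite ?T" by (rule finite_subset[of _ "{0..<int q}"]) auto
  have finA: "finite ?A" by (rule finite_subset[OF _ finite_units_mod[of q]]) auto
  have "(\<Sum>u\<in>?A. 1) \<le> real (2 * num_divisors q) * (\<Sum>t\<in>?T. 1)"
  proof (rule sum_le_card_fibres[OF finA finT sub, where G="\<lambda>_. 1"])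
    fix u assume u: "u \<in> ?A"
    have "{b \<in> ?A. b\<^sup>2 mod int q = u\<^sup>2 mod int q} \<subseteq> {x \<in> {0..<int q}. [x\<^sup>2 = u\<^sup>2] (mod int q)}"
      by (auto simp: units_mod_def cong_def)
    then have "card {b \<in> ?A. b\<^sup>2 mod int q = u\<^sup>2 mod int q} \<le> card {x \<in> {0..<int q}. [x\<^sup>2 = u\<^sup>2] (mod int q)}"
      by (intro card_mono finite_subset[of "{x \<in> {0..<int q}. [x\<^sup>2 = u\<^sup>2] (mod int q)}" "{0..<int q}"]) auto
    also have "\<dots> \<le> 2 * num_divisors q" using u by (intro card_square_roots_unit_le q) (simp add: units_mod_def)
    finally show "card {b \<in> ?A. b\<^sup>2 mod int q = u\<^sup>2 mod int q} \<le> 2 * num_divisors q" .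
  qed auto
  then have "real (card ?A) \<le> real (2 * num_divisors q * card ?T)" by simp
  then have "card ?A \<le> 2 * num_divisors q * card ?T" by (simp only: of_nat_le_iff)
  also have "card ?T \<le> g" using card_residue_class_le[OF g0(2), of g "a\<^sup>2"] L by simp
  finally show ?thesis by (simp add: g_def mult.commute)
qed

text \<open>The pairs \<open>(m * u\<^sup>2, n * u\<^sup>-\<^sup>2)\<close> all give the same sum, so a single large sum would force
  a large fourth moment.\<close>

lemma kloosterman_bound_left:
  assumes q: "q > 0" and P: "prime P" "P dvd q" and w: "square_invariant q w"
  shows "real (totient q) * (cmod (kloosterman q w m n)) ^ 4 \<le>
    6 * real_of_int (gcd m (int q)) * real (num_divisors q) * real q ^ 5 / real P"
proof -
  let ?I = "{0..<int q}"
  define f where "f = (\<lambda>u. (m * u\<^sup>2 mod int q, n * (minv q u)\<^sup>2 mod int q))"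
  define G where "G = (\<lambda>(a,b). (cmod (kloosterman q w a b)) ^ 4)"
  define c where "c = nat (gcd m (int q)) * (2 * num_divisors q)"
  have "G (f u) = (cmod (kloosterman q w m n)) ^ 4" if "u \<in> units_mod q" for u
  proof -
    have "kloosterman q w (m * u\<^sup>2 mod int q) (n * (minv q u)\<^sup>2 mod int q) =
        kloosterman q w (m * u\<^sup>2) (n * (minv q u)\<^sup>2)"
      by (rule kloosterman_mod_cong) auto
    also have "\<dots> = kloosterman q w m n" using that by (intro kloosterman_twist w) (simp add: units_mod_def)
    finally show ?thesis by (simp add: G_def f_def)
  qed
  then have "real (totient q) * (cmod (kloosterman q w m n)) ^ 4 = (\<Sum>u\<in>units_mod q. G (f u))"
    using q by (simp add: card_units_mod)
  also have "\<dots> \<le> real c * (\<Sum>t\<in>?I\<times>?I. G t)"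
  proof (rule sum_le_card_fibres)
    fix a assume a: "a \<in> units_mod q"
    have "{b \<in> units_mod q. f b = f a} \<subseteq> {u \<in> units_mod q. [m * u\<^sup>2 = m * a\<^sup>2] (mod int q)}"
      by (auto simp: f_def cong_def)
    then have "card {b \<in> units_mod q. f b = f a} \<le> card {u \<in> units_mod q. [m * u\<^sup>2 = m * a\<^sup>2] (mod int q)}"
      by (intro card_mono) auto
    also have "\<dots> \<le> c" unfolding c_def by (rule card_square_multiple_fibre[OF q])
    finally show "card {b \<in> units_mod q. f b = f a} \<le> c" .
  qed (use q in \<open>auto simp: f_def G_def\<close>)
  also have "(\<Sum>t\<in>?I\<times>?I. G t) = (\<Sum>a\<in>?I. \<Sum>b\<in>?I. (cmod (kloosterman q w a b)) ^ 4)"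
    by (simp add: G_def sum.cartesian_product case_prod_unfold)
  also have "real c * \<dots> \<le> real c * ((real q)\<^sup>2 * real (card (additive_quads q)))"
    using w by (intro mult_left_mono kloosterman_fourth_moment q) (auto simp: square_invariant_def)
  also have "\<dots> \<le> real c * ((real q)\<^sup>2 * (3 * (real q)\<^sup>2 * (real q / real P)))"
  proof (intro mult_left_mono)
    have "real (card (additive_quads q)) \<le> real (3 * q\<^sup>2 * (q div P))"
      using card_additive_quads_le[OF P q] by (simp only: of_nat_le_iff)
    also have "\<dots> \<le> 3 * (real q)\<^sup>2 * (real q / real P)"
      unfolding of_nat_mult of_nat_power of_nat_numeral
      by (intro mult_left_mono of_nat_div_le_of_nat) auto
    finally show "real (card (additive_quads q)) \<le> 3 * (real q)\<^sup>2 * (real q / real P)" .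
  qed auto
  \<comment> \<open>The constant is 2 from the count of square roots times 3 from the three factors
    in \<open>additive_quads_dvd\<close>.\<close>
  also have "\<dots> = 6 * real_of_int (gcd m (int q)) * real (num_divisors q) * real q ^ 5 / real P"
    by (simp add: c_def power2_eq_square eval_nat_numeral)
  finally show ?thesis .
qed

section \<open>Moduli with boundedly many divisors\<close>

text \<open>The totients of the divisors of q add up to q, and none of them exceeds
  \<open>totient q\<close>.\<close>

lemma le_num_divisors_totient: "q > 0 \<Longrightarrow> q \<le> num_divisors q * totient q"
proof -
  assume q: "q > 0"
  have "q = (\<Sum>d | d dvd q. totient d)" by (simp add: totient_divisor_sum)
  also have "\<dots> \<le> (\<Sum>d | d dvd q. totient q)" using q by (intro sum_mono totient_dvd_mono) auto
  finally show ?thesis by (simp add: num_divisors_def)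
qed

text \<open>Both the number of prime factors and their exponents are at most the number of divisors.
  If all primes were at most B, then q would be at most ((B + 1)^N)^N.\<close>

lemma large_prime_factor:
  fixes N B :: nat
  shows "\<exists>q0. \<forall>q\<ge>q0. num_divisors q \<le> N \<longrightarrow> (\<exists>P. prime P \<and> P dvd q \<and> P > B)"
proof (rule exI[of _ "((B + 1) ^ N) ^ N + 1"], intro allI impI)
  fix q assume q: "((B + 1) ^ N) ^ N + 1 \<le> q" and d: "num_divisors q \<le> N"
  have q0: "q > 0" using q by simp
  have fin: "finite {d. d dvd q}" using q0 by simp
  show "\<exists>P. prime P \<and> P dvd q \<and> P > B"
  proof (rule ccontr)
    assume contra: "\<not> ?thesis"
    have mult: "multiplicity p q \<le> N" if p: "prime p" for p
    proof -
      have "(\<lambda>i. p ^ i) ` {..multiplicity p q} \<subseteq> {d. d dvd q}"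
        by (auto intro: multiplicity_dvd')
      moreover have "inj_on (\<lambda>i. p ^ i) {..multiplicity p q}"
        using prime_gt_1_nat[OF p] by (intro inj_onI) simp
      ultimately have "card {..multiplicity p q} \<le> card {d. d dvd q}"
        using fin by (metis card_image card_mono)
      then show ?thesis using d by (simp add: num_divisors_def)
    qed
    have "prime_factors q \<subseteq> {d. d dvd q}" by auto
    then have "card (prime_factors q) \<le> card {d. d dvd q}" using fin by (rule card_mono[rotated])
    then have cpf: "card (prime_factors q) \<le> N" using d by (simp add: num_divisors_def)
    have "q = (\<Prod>p\<in>prime_factors q. p ^ multiplicity p q)"
      using q0 by (simp add: prime_factorization_nat)
    also have "\<dots> \<le> (\<Prod>p\<in>prime_factors q. (B + 1) ^ N)"
    proof (intro prod_mono conjI)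
      fix p assume p: "p \<in> prime_factors q"
      then have pp: "prime p" "p \<le> B" using contra by (auto simp: not_less)
      have "p ^ multiplicity p q \<le> (B + 1) ^ multiplicity p q" using pp by (intro power_mono) auto
      also have "\<dots> \<le> (B + 1) ^ N" using mult[OF pp(1)] by (intro power_increasing) auto
      finally show "p ^ multiplicity p q \<le> (B + 1) ^ N" .
    qed auto
    also have "\<dots> = ((B + 1) ^ N) ^ card (prime_factors q)" by simp
    also have "\<dots> \<le> ((B + 1) ^ N) ^ N" using cpf by (intro power_increasing) auto
    finally show False using q by simp
  qed
qed

lemma kloosterman_bound:
  assumes q: "q > 0" and P: "prime P" "P dvd q" and w: "square_invariant q w"
    and g: "gcd m (int q) \<le> G \<or> gcd n (int q) \<le> G"
  shows "real (totient q) * (cmod (kloosterman q w m n)) ^ 4 \<le>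
    6 * real_of_int G * real (num_divisors q) * real q ^ 5 / real P"
proof -
  have mono: "6 * real_of_int (gcd k (int q)) * real (num_divisors q) * real q ^ 5 / real P \<le>
     6 * real_of_int G * real (num_divisors q) * real q ^ 5 / real P" if "gcd k (int q) \<le> G" for k
    using that by (intro divide_right_mono mult_right_mono mult_left_mono) auto
  obtain w' where w': "square_invariant q w'" "\<And>m n. kloosterman q w m n = kloosterman q w' n m"
    using kloosterman_swap[OF q w] by blast
  show ?thesis
    using g kloosterman_bound_left[OF q P w, of m n] kloosterman_bound_left[OF q P w'(1), of n m]
      mono[of m] mono[of n] w'(2) by (metis order_trans)
qed

text \<open>The form in which the bound is applied: uniform in the weight and in all pairs of
  frequencies of which one has bounded gcd with q, and measured against the number of units.\<close>

lemma kloosterman_small: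
  assumes "\<epsilon> > 0" "G > 0"
  shows "\<exists>q0. \<forall>q\<ge>q0. num_divisors q \<le> N \<longrightarrow> (\<forall>w m n. square_invariant q w \<longrightarrow>
     (gcd m (int q) \<le> G \<or> gcd n (int q) \<le> G) \<longrightarrow> cmod (kloosterman q w m n) \<le> \<epsilon> * real (totient q))"
proof -
  \<comment> \<open>Chosen so that P > B makes 6 G N^6 / P at most \<epsilon>^4. Five factors N come
    from q^5 with q \<le> \<open>N * totient q\<close>, the sixth is the bound on the number of
    divisors.\<close>
  define B where "B = nat \<lceil>6 * real_of_int G * real N ^ 6 / \<epsilon> ^ 4\<rceil>"
  obtain q0 where q0: "\<And>q. q \<ge> q0 \<Longrightarrow> num_divisors q \<le> N \<Longrightarrow> \<exists>P. prime P \<and> P dvd q \<and> P > B"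
    using large_prime_factor[of N B] by blast
  show ?thesis
  proof (intro exI[of _ "q0 + 1"] allI impI)
    fix q w m n
    assume q: "q \<ge> q0 + 1" "num_divisors q \<le> N" and w: "square_invariant q w"
      and g: "gcd m (int q) \<le> G \<or> gcd n (int q) \<le> G"
    have qp: "q > 0" using q by simp
    obtain P where P: "prime P" "P dvd q" "P > B" using q0[of q] q by auto
    define t where "t = real (totient q)"
    define K where "K = cmod (kloosterman q w m n)"
    have t: "t > 0" using qp by (simp add: t_def)
    have P0: "real P > 0" using P(1) prime_gt_0_nat by simp
    have "q \<le> N * totient q" using le_num_divisors_totient[OF qp] q(2) by (meson mult_le_mono1 order_trans)
    then have qt: "real q \<le> real N * t" unfolding t_def by (metis of_nat_le_iff of_nat_mult)
    have BP: "6 * real_of_int G * real N ^ 6 / \<epsilon> ^ 4 \<le> real P"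
      using P(3) unfolding B_def by linarith
    have "t * K ^ 4 \<le> 6 * real_of_int G * real (num_divisors q) * real q ^ 5 / real P"
      unfolding t_def K_def by (rule kloosterman_bound[OF qp P(1,2) w g])
    also have "\<dots> \<le> 6 * real_of_int G * real N * (real N * t) ^ 5 / real P"
      using assms(2) q(2) qt by (intro divide_right_mono mult_mono power_mono) auto
    also have "\<dots> = t * (6 * real_of_int G * real N ^ 6 / real P * t ^ 4)"
      by (simp add: power_mult_distrib eval_nat_numeral)
    finally have "K ^ 4 \<le> 6 * real_of_int G * real N ^ 6 / real P * t ^ 4"
      by (rule mult_left_le_imp_le[OF _ t])
    also have "\<dots> \<le> \<epsilon> ^ 4 * t ^ 4"
      using BP P0 assms(1) t by (intro mult_right_mono) (auto simp: field_simps)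
    finally have "K ^ 4 \<le> (\<epsilon> * t) ^ 4" by (simp add: power_mult_distrib)
    then show "cmod (kloosterman q w m n) \<le> \<epsilon> * real (totient q)"
      using assms(1) t unfolding K_def[symmetric] t_def[symmetric]
      by (intro power_le_imp_le_base[of K 3 "\<epsilon> * t"]) auto
  qed
qed

section \<open>Families of moduli with a common Gauss sum formula\<close>

definition gw :: "(real \<Rightarrow> complex) \<Rightarrow> nat \<Rightarrow> int \<Rightarrow> complex" where
  "gw f q x = (\<Sum>h<q. f (real h / real q) * ez q (x * (int h)\<^sup>2))"

lemma gsum_eq_gw: "gsum f p q = gw f q (int p)"
  by (simp add: gsum_def gw_def ez_def)

definition trig :: "int set \<Rightarrow> (int \<Rightarrow> complex) \<Rightarrow> real \<Rightarrow> complex" where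
  "trig S a x = (\<Sum>k\<in>S. a k * e (real_of_int k * x))"

lemma gw_diff: "gw (\<lambda>x. f x - g x) q x = gw f q x - gw g q x"
  by (simp add: gw_def sum_subtractf left_diff_distrib)

lemma gw_trig: "gw (trig S a) q x = (\<Sum>k\<in>S. a k * gs q x k)"
proof -
  have 1: "gs q x k = (\<Sum>h<q. e (real_of_int k * (real h / real q)) * ez q (x * (int h)\<^sup>2))" for k
  proof -
    have "gs q x k = (\<Sum>h<q. ez q (x * (int h)\<^sup>2 + k * int h))"
      unfolding gs_def by (rule sum.reindex_bij_witness[of _ int nat]) auto
    also have "\<dots> = (\<Sum>h<q. e (real_of_int k * (real h / real q)) * ez q (x * (int h)\<^sup>2))"
      unfolding ez_add by (intro sum.cong refl) (simp add: ez_def)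
    finally show ?thesis .
  qed
  have "gw (trig S a) q x = (\<Sum>h<q. \<Sum>k\<in>S. a k * (e (real_of_int k * (real h / real q)) * ez q (x * (int h)\<^sup>2)))"
    unfolding gw_def trig_def sum_distrib_right by (simp add: mult.assoc)
  also have "\<dots> = (\<Sum>k\<in>S. a k * gs q x k)"
    by (subst sum.swap) (simp add: 1 sum_distrib_left)
  finally show ?thesis .
qed

text \<open>A family of moduli on which completing the square gives
  \<open>gs q p k = \<nu> q p * e (x * (k / c)\<^sup>2)\<close> with \<open>x = t q * p\<^sup>-\<^sup>1 / q\<close> for \<open>k \<in> c * J\<close>, and \<open>0\<close> for the other \<open>k\<close>.\<close>

locale moduli_class =
  fixes Q :: "nat set" and N :: nat and \<nu> :: "nat \<Rightarrow> int \<Rightarrow> complex" and t :: "nat \<Rightarrow> int"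
    and c :: int and J :: "int set"
  assumes Q: "\<And>q. q \<in> Q \<Longrightarrow> q > 0 \<and> num_divisors q \<le> N"
    and gcd_t: "\<And>q n. q \<in> Q \<Longrightarrow> n \<noteq> 0 \<Longrightarrow> gcd (n * t q) (int q) \<le> 2 * \<bar>n\<bar>"
    and c_pos: "c > 0"
    and norm_\<nu>: "\<And>q x. q \<in> Q \<Longrightarrow> coprime x (int q) \<Longrightarrow> (cmod (\<nu> q x))\<^sup>2 \<ge> real q"
    and gs_formula: "\<And>q x k. q \<in> Q \<Longrightarrow> coprime x (int q) \<Longrightarrow>
       gs q x k = (if c dvd k \<and> k div c \<in> J then \<nu> q x * ez q (t q * minv q x * (k div c)\<^sup>2) else 0)"

text \<open>The bound 2 in place of 1 accommodates q = 2 r with r odd, where the multiplier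
  \<open>t q\<close> is even.\<close>

lemma gcd_mult_coprime_le:
  assumes "q > 0" "n \<noteq> 0" "gcd s (int q) \<le> 2"
  shows "gcd (n * s) (int q) \<le> 2 * \<bar>n\<bar>"
proof -
  have "gcd (n * s) (int q) dvd gcd (n * s) (n * int q)" by (intro gcd_greatest) auto
  also have "\<dots> = \<bar>n\<bar> * gcd s (int q)" by (simp add: gcd_mult_distrib_int)
  finally have "gcd (n * s) (int q) \<le> \<bar>n\<bar> * gcd s (int q)"
    using assms by (intro zdvd_imp_le) auto
  also have "\<dots> \<le> \<bar>n\<bar> * 2" using assms by (intro mult_left_mono) auto
  finally show ?thesis by simp
qed

text \<open>Only even frequencies survive, since a shift by q / 2 changes the sign of the terms for
  odd k; hence c = 2, and completing the square with k / 2 gives the multiplier -1.\<close>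

lemma four_dvd_class:
  assumes "\<And>q. q \<in> Q \<Longrightarrow> q > 0 \<and> num_divisors q \<le> N \<and> 4 dvd q"
  shows "moduli_class Q N (\<lambda>q x. gs q x 0) (\<lambda>q. -1) 2 UNIV"
proof
  fix q n assume "q \<in> Q" "n \<noteq> (0::int)"
  then show "gcd (n * -1) (int q) \<le> 2 * \<bar>n\<bar>" using assms by (intro gcd_mult_coprime_le) auto
next
  fix q x assume q: "q \<in> Q" and x: "coprime x (int q)"
  then have "gs q x 0 / sqrt q \<in> corners" using assms by (intro gs_four_dvd_values) auto
  moreover have "(cmod z)\<^sup>2 = 2" if "z \<in> corners" for z
    using that unfolding corners_def by (auto simp: cmod_power2)
  ultimately have "(cmod (gs q x 0 / sqrt q))\<^sup>2 = 2" by blast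
  moreover have "q > 0" using assms q by auto
  ultimately show "(cmod (gs q x 0))\<^sup>2 \<ge> real q" by (simp add: norm_divide power_divide field_simps)
next
  fix q x k assume q: "q \<in> Q" and x: "coprime x (int q)"
  show "gs q x k = (if 2 dvd k \<and> k div 2 \<in> UNIV then gs q x 0 * ez q (-1 * minv q x * (k div 2)\<^sup>2) else 0)"
  proof (cases "even k")
    case True
    then show ?thesis using gs_complete_square[OF minv_cong[OF x], of k "k div 2"] by simp
  next
    case False then show ?thesis using assms[OF q] by (simp add: gs_four_dvd_odd)
  qed
qed (use assms in auto)

lemma half_mod_odd: "odd (r::nat) \<Longrightarrow> [2 * int ((r + 1) div 2) = 1] (mod int r)"
  by (auto elim!: oddE simp: cong_iff_dvd_diff)

lemma coprime_half_mod: "odd r \<Longrightarrow> coprime (int ((r + 1) div 2)) (int r)"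
  using half_mod_odd[of r] by (metis coprime_iff_invertible_int mult.commute)

lemma norm_gs_odd_sqrt:
  assumes "odd q" "coprime a (int q)"
  shows "cmod (gs q a 0) = sqrt q"
  using gs_odd_values[OF assms] by (auto simp: norm_mult eps_sym_def)

text \<open>Every frequency survives: half of k exists modulo q as k (q + 1) / 2, and the square of
  (q + 1) / 2 goes into the multiplier.\<close>

lemma odd_class:
  assumes "\<And>q. q \<in> Q \<Longrightarrow> q > 0 \<and> num_divisors q \<le> N \<and> odd q"
  shows "moduli_class Q N (\<lambda>q x. gs q x 0) (\<lambda>q. - (int ((q + 1) div 2))\<^sup>2) 1 UNIV"
proof
  fix q n assume q: "q \<in> Q" "n \<noteq> (0::int)"
  have "coprime (- (int ((q + 1) div 2))\<^sup>2) (int q)" using coprime_half_mod[of q] assms q by simp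
  then show "gcd (n * (- (int ((q + 1) div 2))\<^sup>2)) (int q) \<le> 2 * \<bar>n\<bar>" using assms q
    by (intro gcd_mult_coprime_le) (auto simp: coprime_iff_gcd_eq_1)
next
  fix q x assume q: "q \<in> Q" and x: "coprime x (int q)"
  then show "(cmod (gs q x 0))\<^sup>2 \<ge> real q" using assms[OF q] by (simp add: norm_gs_odd_sqrt)
next
  fix q x k assume q: "q \<in> Q" and x: "coprime x (int q)"
  let ?h = "int ((q + 1) div 2)"
  have "[k = 2 * (?h * k)] (mod int q)"
    using cong_sym[OF cong_mult[OF half_mod_odd[of q] cong_refl[of k]]] assms[OF q]
    unfolding mult.assoc mult_1 by blast
  from gs_complete_square[OF minv_cong[OF x] this]
  show "gs q x k = (if 1 dvd k \<and> k div 1 \<in> UNIV then gs q x 0 * ez q (- ?h\<^sup>2 * minv q x * (k div 1)\<^sup>2) else 0)"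
    by (simp add: power_mult_distrib mult_ac)
qed (use assms in auto)

text \<open>The sum is reduced to the modulus r = \<open>q div 2\<close> with 2 x in place of x. Let
  h be the inverse of 2 modulo r: one factor h comes from inverting 2 x, two from halving k, and
  returning from denominator r to q doubles the numerator.\<close>

lemma twice_odd_class:
  assumes "\<And>q. q \<in> Q \<Longrightarrow> q > 0 \<and> num_divisors q \<le> N \<and> q mod 4 = 2"
  shows "moduli_class Q N (\<lambda>q x. 2 * gs (q div 2) (2 * x) 0)
     (\<lambda>q. - 2 * (int ((q div 2 + 1) div 2)) ^ 3) 1 {k. odd k}"
proof
  fix q n assume q: "q \<in> Q" "n \<noteq> (0::int)"
  define r where "r = q div 2"
  have r: "q = 2 * r" "odd r" using assms[OF q(1)] unfolding r_def by presburger+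
  let ?h = "int ((r + 1) div 2)"
  have cop: "coprime (- (?h ^ 3)) (int r)" using coprime_half_mod[OF r(2)] by simp
  have "gcd (- 2 * ?h ^ 3) (int q) = 2 * gcd (- (?h ^ 3)) (int r)"
    using gcd_mult_distrib_int[of 2 "- (?h ^ 3)" "int r"] r by simp
  also have "\<dots> = 2" using cop by (simp add: coprime_iff_gcd_eq_1)
  finally show "gcd (n * (- 2 * (int ((q div 2 + 1) div 2)) ^ 3)) (int q) \<le> 2 * \<bar>n\<bar>" using assms q
    unfolding r_def by (intro gcd_mult_coprime_le) auto
next
  fix q x assume q: "q \<in> Q" and x: "coprime x (int q)"
  define r where "r = q div 2"
  have r: "q = 2 * r" "odd r" using assms[OF q(1)] unfolding r_def by presburger+
  have "coprime (2 * x) (int r)" using x r by simp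
  then have "cmod (gs r (2 * x) 0) = sqrt r" using r by (intro norm_gs_odd_sqrt)
  then show "(cmod (2 * gs (q div 2) (2 * x) 0))\<^sup>2 \<ge> real q"
    unfolding r_def[symmetric] r(1) by (simp add: norm_mult power_mult_distrib)
next
  fix q x k assume q: "q \<in> Q" and x: "coprime x (int q)"
  define r where "r = q div 2"
  have r: "q = 2 * r" "odd r" using assms[OF q(1)] unfolding r_def by presburger+
  have xo: "odd x" "coprime x (int r)" using x r by auto
  let ?h = "int ((r + 1) div 2)"
  have half: "[2 * ?h = 1] (mod int r)" using half_mod_odd r(2) by blast
  have k: "[k = 2 * (?h * k)] (mod int r)"
    using cong_sym[OF cong_mult[OF half cong_refl[of k]]] unfolding mult.assoc mult_1 .
  have "[x * minv q x = 1] (mod int r)"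
    by (rule cong_dvd_modulus[OF minv_cong[OF x]]) (simp add: r)
  from cong_mult[OF half this] have i: "[2 * x * (?h * minv q x) = 1] (mod int r)" by (simp add: mult_ac)
  have "gs r (2 * x) k = ez r (- (?h * minv q x * (?h * k)\<^sup>2)) * gs r (2 * x) 0"
    by (rule gs_complete_square[OF i k])
  also have "ez r (- (?h * minv q x * (?h * k)\<^sup>2)) = ez q (- (?h * minv q x * (?h * k)\<^sup>2) * int 2)"
    unfolding r(1) by (subst mult.commute[of 2 r], rule ez_scale[symmetric]) simp
  also have "- (?h * minv q x * (?h * k)\<^sup>2) * int 2 = - 2 * ?h ^ 3 * minv q x * (k div 1)\<^sup>2"
    by (simp add: power2_eq_square power3_eq_cube)
  finally show "gs q x k = (if 1 dvd k \<and> k div 1 \<in> {k. odd k} then 2 * gs (q div 2) (2 * x) 0 *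
     ez q (- 2 * int ((q div 2 + 1) div 2) ^ 3 * minv q x * (k div 1)\<^sup>2) else 0)"
    using gs_twice_odd[OF r(2) xo(1), of k] unfolding r_def[symmetric] by (simp add: r(1))
qed (use assms in auto)

lemma sum_units_of_bool_eq:
  assumes per: "\<And>x y. [x = y] (mod int q) \<Longrightarrow> V x = V y" and u: "coprime u (int q)"
    and \<sigma>: "inj \<sigma>" "\<And>x. coprime x (int q) \<Longrightarrow> V (u * x) = \<sigma> (V x)"
  shows "(\<Sum>x\<in>units_mod q. of_bool (V x = v) :: real) = (\<Sum>x\<in>units_mod q. of_bool (V x = \<sigma> v))"
proof -
  have "(\<Sum>x\<in>units_mod q. of_bool (V x = \<sigma> v) :: real) = (\<Sum>x\<in>units_mod q. of_bool (V (u * x) = \<sigma> v))"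
    using per by (intro sum_units_mod_mult[where F="\<lambda>x. of_bool (V x = \<sigma> v)", symmetric] u) metis
  also have "\<dots> = (\<Sum>x\<in>units_mod q. of_bool (V x = v))"
    using \<sigma> by (intro sum.cong refl) (auto simp: units_mod_def inj_eq)
  finally show ?thesis by simp
qed

lemma sum_units_of_bool_total:
  assumes "q > 0" "finite S" "\<And>x. coprime x (int q) \<Longrightarrow> V x \<in> S"
  shows "(\<Sum>v\<in>S. \<Sum>x\<in>units_mod q. of_bool (V x = v) :: real) = real (totient q)"
proof -
  have "(\<Sum>v\<in>S. \<Sum>x\<in>units_mod q. of_bool (V x = v) :: real) = (\<Sum>x\<in>units_mod q. \<Sum>v\<in>S. of_bool (V x = v))"
    by (rule sum.swap)
  also have "\<dots> = (\<Sum>x\<in>units_mod q. 1)"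
    using assms by (intro sum.cong refl) (auto simp: units_mod_def of_bool_def sum.delta)
  finally show ?thesis using assms(1) by (simp add: card_units_mod)
qed

section \<open>Trigonometric approximation\<close>

text \<open>The completed measure is used because a Riemann integrable function, or the indicator of
  a set with null frontier, is Lebesgue measurable but possibly not Borel measurable. The limit laws
  are defined on \<open>unifT\<close>; for Borel functions the two integrals agree by
  \<open>integral_unifT\<close>.\<close>

abbreviation M01 :: "real measure" where "M01 \<equiv> lebesgue_on {0..1}"

lemma emeasure_M01: "emeasure M01 (space M01) = 1"
  by (simp add: emeasure_restrict_space space_restrict_space)

interpretation M01: prob_space M01
  by (rule prob_spaceI) (rule emeasure_M01)

lemma space_M01 [simp]: "space M01 = {0..1}"
  by (simp add: space_restrict_space)

lemma M01_measurable_borel: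
  fixes f :: "real \<Rightarrow> 'b::euclidean_space"
  shows "f \<in> borel_measurable borel \<Longrightarrow> f \<in> borel_measurable M01"
  by (intro measurable_restrict_space1 measurable_completion) simp

lemma M01_measurable_cont:
  "continuous_on {0..1} f \<Longrightarrow> f \<in> borel_measurable M01"
  by (rule continuous_imp_measurable_on_sets_lebesgue) auto

lemma M01_integrable_bounded:
  fixes f :: "real \<Rightarrow> 'b::{banach, second_countable_topology}"
  assumes "f \<in> borel_measurable M01" "\<And>x. x \<in> {0..1} \<Longrightarrow> norm (f x) \<le> B"
  shows "integrable M01 f"
  by (rule M01.integrable_const_bound[of _ B]) (use assms in \<open>auto intro!: AE_I2\<close>)

lemma M01_integrable_cont:
  fixes f :: "real \<Rightarrow> 'b::{banach, second_countable_topology}"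
  assumes "continuous_on {0..1} f"
  shows "integrable M01 f"
proof -
  have "compact (f ` {0..1})" using assms by (intro compact_continuous_image) auto
  then obtain B where "\<And>x. x \<in> {0..1} \<Longrightarrow> norm (f x) \<le> B"
    using compact_imp_bounded bounded_iff by (metis image_eqI)
  then show ?thesis using assms by (intro M01_integrable_bounded M01_measurable_cont)
qed

lemma integral_unifT:
  fixes f :: "real \<Rightarrow> 'b::{banach, second_countable_topology}"
  assumes f: "f \<in> borel_measurable borel"
  shows "integral\<^sup>L unifT f = integral\<^sup>L M01 f"
proof -
  have u: "unifT = density lborel (\<lambda>x. ennreal (indicator {0..1} x))"
    by (simp add: unifT_def uniform_measure_def ennreal_indicator divide_ennreal_def)
  have "integral\<^sup>L unifT f = (\<integral>x. indicator {0..1} x *\<^sub>R f x \<partial>lborel)"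
    unfolding u using f by (intro integral_density) auto
  also have "\<dots> = (\<integral>x. indicator {0..1} x *\<^sub>R f x \<partial>lebesgue)"
    using f by (intro integral_completion[symmetric]) measurable
  also have "\<dots> = integral\<^sup>L M01 f"
    by (rule integral_restrict_space[symmetric]) auto
  finally show ?thesis .
qed

lemma fcoeff_eq_M01:
  assumes "\<phi> \<in> borel_measurable M01" "\<And>x. x \<in> {0..1} \<Longrightarrow> cmod (\<phi> x) \<le> B"
  shows "fcoeff \<phi> k = (\<integral>x. \<phi> x * cnj (e (real_of_int k * x)) \<partial>M01)"
proof -
  have "(\<lambda>x. cnj (e (real_of_int k * x))) \<in> borel_measurable M01"
    by (intro M01_measurable_cont continuous_intros)
  then have "(\<lambda>x. \<phi> x * cnj (e (real_of_int k * x))) \<in> borel_measurable M01"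
    using assms(1) by (rule borel_measurable_times[rotated])
  then have "integrable M01 (\<lambda>x. \<phi> x * cnj (e (real_of_int k * x)))"
    by (rule M01_integrable_bounded[of _ B]) (use assms(2) in \<open>simp add: norm_mult\<close>)
  then have "(\<integral>x. \<phi> x * cnj (e (real_of_int k * x)) \<partial>M01) = integral {0..1} (\<lambda>x. \<phi> x * cnj (e (real_of_int k * x)))"
    by (rule lebesgue_integral_eq_integral) auto
  then show ?thesis by (simp add: fcoeff_def e_minus)
qed

lemma integral_e: "(\<integral>x. e (real_of_int k * x) \<partial>M01) = (if k = 0 then 1 else 0)"
proof (cases "k = 0")
  case True
  then show ?thesis using M01.prob_space by (simp add: measure_restrict_space)
next
  case False
  define c where "c = 2 * complex_of_real pi * \<i> * of_int k"
  have c: "c \<noteq> 0" using False by (simp add: c_def)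
  have ec: "e (real_of_int k * x) = exp (c * of_real x)" for x by (simp add: e_def c_def mult_ac)
  have "((\<lambda>x. exp (c * of_real x)) has_integral (exp (c * of_real 1) / c - exp (c * of_real 0) / c)) {0..1}"
  proof (rule fundamental_theorem_of_calculus)
    fix x :: real assume "x \<in> {0..1}"
    have "((\<lambda>x. exp (c * x) / c) has_field_derivative exp (c * of_real x)) (at (of_real x))"
      using c by (auto intro!: derivative_eq_intros)
    then have "((\<lambda>x. exp (c * of_real x) / c) has_vector_derivative exp (c * of_real x)) (at x)"
      by (rule has_vector_derivative_real_field)
    then show "((\<lambda>x. exp (c * of_real x) / c) has_vector_derivative exp (c * of_real x)) (at x within {0..1})"
      by (rule has_vector_derivative_at_within)
  qed simp
  moreover have "exp (c * of_real 1) = 1" using ec[of 1] e_of_int[of k] by simp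
  ultimately have "((\<lambda>x. e (real_of_int k * x)) has_integral 0) {0..1}" by (simp add: ec)
  moreover have "(\<integral>x. e (real_of_int k * x) \<partial>M01) = integral {0..1} (\<lambda>x. e (real_of_int k * x))"
    by (intro lebesgue_integral_eq_integral M01_integrable_cont continuous_intros) auto
  ultimately show ?thesis using False by (simp add: integral_unique)
qed

lemma continuous_on_trig [continuous_intros]: "continuous_on A (trig S a)"
  unfolding trig_def by (intro continuous_intros)

lemma norm_trig_le: "cmod (trig S a x) \<le> (\<Sum>k\<in>S. cmod (a k))"
  unfolding trig_def by (rule sum_norm_le) (simp add: norm_mult)

lemma integral_trig: "finite S \<Longrightarrow> (\<integral>x. trig S a x \<partial>M01) = (if 0 \<in> S then a 0 else 0)"
proof -
  assume S: "finite S"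
  have "(\<integral>x. trig S a x \<partial>M01) = (\<Sum>k\<in>S. \<integral>x. a k * e (real_of_int k * x) \<partial>M01)"
    unfolding trig_def by (intro Bochner_Integration.integral_sum M01_integrable_cont continuous_intros)
  also have "\<dots> = (\<Sum>k\<in>S. if k = 0 then a k else 0)"
    by (intro sum.cong refl) (simp add: integral_e)
  also have "\<dots> = (if 0 \<in> S then a 0 else 0)" using S by (simp add: sum.delta)
  finally show ?thesis .
qed

definition is_trig :: "(real \<Rightarrow> complex) \<Rightarrow> bool" where
  "is_trig h \<longleftrightarrow> (\<exists>S a. finite S \<and> h = trig S a)"

lemma is_trig_monom: "is_trig (\<lambda>x. c * e (real_of_int k * x))"
  unfolding is_trig_def by (intro exI[of _ "{k}"] exI[of _ "\<lambda>_. c"]) (auto simp: trig_def)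

lemma is_trig_const: "is_trig (\<lambda>x. c)"
  using is_trig_monom[of c 0] by simp

lemma is_trig_add:
  assumes "is_trig f" "is_trig g"
  shows "is_trig (\<lambda>x. f x + g x)"
proof -
  obtain S a T b where f: "finite S" "f = trig S a" and g: "finite T" "g = trig T b"
    using assms by (auto simp: is_trig_def)
  define c where "c = (\<lambda>k. (if k \<in> S then a k else 0) + (if k \<in> T then b k else 0))"
  have "f x + g x = trig (S \<union> T) c x" for x
  proof -
    have "trig (S \<union> T) c x = (\<Sum>k\<in>S \<union> T. (if k \<in> S then a k * e (real_of_int k * x) else 0)) +
        (\<Sum>k\<in>S \<union> T. (if k \<in> T then b k * e (real_of_int k * x) else 0))"
      unfolding trig_def sum.distrib[symmetric] by (intro sum.cong refl) (auto simp: c_def distrib_right)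
    also have "(\<Sum>k\<in>S \<union> T. (if k \<in> S then a k * e (real_of_int k * x) else 0)) = trig S a x"
      unfolding trig_def using f(1) g(1) by (intro sum.mono_neutral_cong_right) auto
    also have "(\<Sum>k\<in>S \<union> T. (if k \<in> T then b k * e (real_of_int k * x) else 0)) = trig T b x"
      unfolding trig_def using f(1) g(1) by (intro sum.mono_neutral_cong_right) auto
    finally show ?thesis by (simp add: f g)
  qed
  then show ?thesis unfolding is_trig_def using f(1) g(1) by (intro exI[of _ "S \<union> T"] exI[of _ c]) auto
qed

lemma is_trig_sum: "finite I \<Longrightarrow> (\<And>i. i \<in> I \<Longrightarrow> is_trig (f i)) \<Longrightarrow> is_trig (\<lambda>x. \<Sum>i\<in>I. f i x)"
  by (induction I rule: finite_induct) (auto intro: is_trig_const is_trig_add)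

lemma is_trig_mult:
  assumes "is_trig f" "is_trig g"
  shows "is_trig (\<lambda>x. f x * g x)"
proof -
  obtain S a T b where f: "finite S" "f = trig S a" and g: "finite T" "g = trig T b"
    using assms by (auto simp: is_trig_def)
  have "f x * g x = (\<Sum>k\<in>S. \<Sum>l\<in>T. (a k * b l) * e (real_of_int (k + l) * x))" for x
    unfolding f g trig_def sum_product
    by (intro sum.cong refl) (simp add: distrib_right e_add)
  moreover have "is_trig (\<lambda>x. \<Sum>k\<in>S. \<Sum>l\<in>T. (a k * b l) * e (real_of_int (k + l) * x))"
    using f g by (intro is_trig_sum is_trig_monom)
  ultimately show ?thesis by simp
qed

lemma is_trig_Re_Im: "is_trig (\<lambda>x. of_real (Re (e x)))" "is_trig (\<lambda>x. of_real (Im (e x)))"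
proof -
  have "complex_of_real (Re (e x)) = 1 / 2 * e (real_of_int 1 * x) + 1 / 2 * e (real_of_int (-1) * x)" for x
    by (simp add: e_minus complex_eq_iff)
  then show "is_trig (\<lambda>x. of_real (Re (e x)))"
    by (simp only:) (intro is_trig_add is_trig_monom)
  have "complex_of_real (Im (e x)) = - \<i> / 2 * e (real_of_int 1 * x) + \<i> / 2 * e (real_of_int (-1) * x)" for x
    by (simp add: e_minus complex_eq_iff)
  then show "is_trig (\<lambda>x. of_real (Im (e x)))"
    by (simp only:) (intro is_trig_add is_trig_monom)
qed

text \<open>Stone-Weierstrass on the circle yields polynomials in two real coordinates; composed
  with \<open>e\<close> they become trigonometric polynomials.\<close>

lemma is_trig_polynomial:
  assumes "real_polynomial_function p"
  shows "is_trig (\<lambda>x. complex_of_real (p (e x)))"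
  using assms
proof (induction p rule: real_polynomial_function.induct)
  case (linear f)
  interpret bounded_linear f by fact
  have "f z = Re z * f 1 + Im z * f \<i>" for z
  proof -
    have "z = Re z *\<^sub>R 1 + Im z *\<^sub>R \<i>" by (simp add: complex_eq_iff)
    then have "f z = f (Re z *\<^sub>R 1 + Im z *\<^sub>R \<i>)" by simp
    then show ?thesis by (simp add: add scaleR)
  qed
  then have "complex_of_real (f (e x)) = of_real (Re (e x)) * of_real (f 1) + of_real (Im (e x)) * of_real (f \<i>)" for x
    by (metis of_real_add of_real_mult)
  then show ?case by (simp only:) (intro is_trig_add is_trig_mult is_trig_const is_trig_Re_Im)
next
  case (const c) show ?case by (rule is_trig_const)
next
  case (add f g) then show ?case by (simp add: is_trig_add)
next
  case (mult f g) then show ?case by (simp add: is_trig_mult)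
qed

text \<open>The function \<open>\<gamma>\<close> descends to the unit circle; it is continuous there because its graph is
  the compact image of \<open>[0, 1]\<close>.\<close>

lemma trig_approx_continuous:
  fixes \<gamma> :: "real \<Rightarrow> complex"
  assumes cont: "continuous_on {0..1} \<gamma>" and eq: "\<gamma> 0 = \<gamma> 1" and \<epsilon>: "\<epsilon> > 0"
  shows "\<exists>S a. finite S \<and> (\<forall>x\<in>{0..1}. cmod (\<gamma> x - trig S a x) < \<epsilon>)"
proof -
  define C where "C = e ` {0..1}"
  \<comment> \<open>On [0, 1] only the arguments 0 and 1 share a value of \<open>e\<close>, and
    \<gamma> agrees there, so the choice of a preimage does not affect the value.\<close>
  define F where "F = (\<lambda>z. \<gamma> (SOME t. t \<in> {0..1} \<and> e t = z))"
  have F: "F (e t) = \<gamma> t" if t: "t \<in> {0..1}" for t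
  proof -
    define s where "s = (SOME s. s \<in> {0..1} \<and> e s = e t)"
    have s: "s \<in> {0..1}" "e s = e t" using someI[of "\<lambda>s. s \<in> {0..1} \<and> e s = e t" t] t by (auto simp: s_def)
    have "e (s - t) = 1" using e_add[of s "-t"] s(2) by (simp add: e_minus complex_norm_square[symmetric])
    then obtain k where k: "s - t = real_of_int k" by (auto simp: e_eq_1_iff Ints_def)
    have "\<bar>real_of_int k\<bar> \<le> 1" using k s(1) t by auto
    then have "k = 0 \<or> k = 1 \<or> k = -1" by linarith
    then have "\<gamma> s = \<gamma> t"
    proof (elim disjE)
      assume "k = 1" then have "s = 1" "t = 0" using k s(1) t by auto
      then show ?thesis using eq by simp
    next
      assume "k = -1" then have "s = 0" "t = 1" using k s(1) t by auto
      then show ?thesis using eq by simp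
    qed (use k in simp)
    then show ?thesis by (simp add: F_def s_def)
  qed
  have "compact C" unfolding C_def by (intro compact_continuous_image continuous_intros) auto
  moreover have "continuous_on C F"
  proof (rule continuous_from_closed_graph)
    show "compact (\<gamma> ` {0..1})" using cont by (intro compact_continuous_image) auto
    show "F \<in> C \<rightarrow> \<gamma> ` {0..1}" using F by (auto simp: C_def)
    have "(\<lambda>z. (z, F z)) ` C = (\<lambda>t. (e t, \<gamma> t)) ` {0..1}"
      unfolding C_def image_image using F by (intro image_cong) auto
    moreover have "compact ((\<lambda>t. (e t, \<gamma> t)) ` {0..1})"
      using cont by (intro compact_continuous_image continuous_intros) auto
    ultimately show "closed ((\<lambda>z. (z, F z)) ` C)" by (simp add: compact_imp_closed)
  qed
  ultimately have "\<exists>g. polynomial_function g \<and> (\<forall>z\<in>C. cmod (F z - g z) < \<epsilon>)"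
    using \<epsilon> by (rule Stone_Weierstrass_polynomial_function)
  then obtain g where g: "polynomial_function g" "\<And>z. z \<in> C \<Longrightarrow> cmod (F z - g z) < \<epsilon>"
    by blast
  have "real_polynomial_function (Re \<circ> g)" "real_polynomial_function (Im \<circ> g)"
    using g(1) bounded_linear_Re bounded_linear_Im unfolding polynomial_function_def by blast+
  then have "is_trig (\<lambda>x. complex_of_real ((Re \<circ> g) (e x)) + complex_of_real ((Im \<circ> g) (e x)) * \<i>)"
    by (intro is_trig_add is_trig_mult is_trig_polynomial is_trig_const)
  moreover have "complex_of_real ((Re \<circ> g) (e x)) + complex_of_real ((Im \<circ> g) (e x)) * \<i> = g (e x)" for x
    by (rule complex_eqI) simp_all
  ultimately have "is_trig (\<lambda>x. g (e x))" by (simp only:)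
  then obtain S a where Sa: "finite S" "(\<lambda>x. g (e x)) = trig S a" unfolding is_trig_def by blast
  have "cmod (\<gamma> x - trig S a x) < \<epsilon>" if "x \<in> {0..1}" for x
    using g(2)[of "e x"] F[OF that] fun_cong[OF Sa(2), of x] that by (simp add: C_def)
  then show ?thesis using Sa(1) by blast
qed

text \<open>For M > |k| with k nonzero the sum of e(k j / M) over j is exactly zero, so the Riemann
  sums of a fixed trigonometric polynomial are eventually equal to its integral.\<close>

lemma riemann_sum_trig:
  assumes "finite S"
  shows "(\<lambda>M. (\<Sum>j<M. trig S a (real j / real M)) / of_nat M) \<longlonglongrightarrow> (\<integral>x. trig S a x \<partial>M01)"
proof -
  have e_sum: "(\<lambda>M. (\<Sum>j<M. e (real_of_int k * (real j / real M))) / of_nat M) \<longlonglongrightarrow> (if k = 0 then 1 else 0)" for k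
  proof (rule tendsto_eventually, rule eventually_sequentiallyI[of "nat \<bar>k\<bar> + 1"])
    fix M assume M: "nat \<bar>k\<bar> + 1 \<le> M"
    have "(\<Sum>j<M. e (real_of_int k * (real j / real M))) = (\<Sum>h\<in>{0..<int M}. ez M (k * h))"
      by (rule sum.reindex_bij_witness[of _ nat int]) (auto simp: ez_def)
    also have "\<dots> = (if int M dvd k then of_nat M else 0)" using M by (intro sum_ez) auto
    also have "int M dvd k \<longleftrightarrow> k = 0" using M dvd_imp_le_int[of k "int M"] by (cases "k = 0") auto
    finally show "(\<Sum>j<M. e (real_of_int k * (real j / real M))) / of_nat M = (if k = 0 then 1 else 0)"
      using M by auto
  qed
  have "(\<lambda>M. \<Sum>k\<in>S. a k * ((\<Sum>j<M. e (real_of_int k * (real j / real M))) / of_nat M)) \<longlonglongrightarrow> (\<Sum>k\<in>S. a k * (if k = 0 then 1 else 0))"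
    by (intro tendsto_sum tendsto_mult tendsto_const e_sum)
  also have "(\<lambda>M. \<Sum>k\<in>S. a k * ((\<Sum>j<M. e (real_of_int k * (real j / real M))) / of_nat M)) =
      (\<lambda>M. (\<Sum>j<M. trig S a (real j / real M)) / of_nat M)"
  proof
    fix M
    have "(\<Sum>j<M. trig S a (real j / real M)) = (\<Sum>k\<in>S. a k * (\<Sum>j<M. e (real_of_int k * (real j / real M))))"
      unfolding trig_def by (subst sum.swap) (simp add: sum_distrib_left)
    then show "(\<Sum>k\<in>S. a k * ((\<Sum>j<M. e (real_of_int k * (real j / real M))) / of_nat M)) =
      (\<Sum>j<M. trig S a (real j / real M)) / of_nat M"
      by (simp only: sum_divide_distrib[of _ S] times_divide_eq_right)
  qed
  also have "(\<Sum>k\<in>S. a k * (if k = 0 then 1 else 0)) = (\<integral>x. trig S a x \<partial>M01)"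
    using assms by (simp add: integral_trig mult_if_delta sum.delta if_distrib[of "\<lambda>y. _ * y"] cong: if_cong)
  finally show ?thesis .
qed

text \<open>Supplies the Riemann sum clause for continuous periodic majorants; uniform approximation
  reduces it to trigonometric polynomials.\<close>

lemma riemann_sum_upper:
  fixes h :: "real \<Rightarrow> real"
  assumes cont: "continuous_on {0..1} h" and eq: "h 0 = h 1" and \<epsilon>: "(\<integral>x. h x \<partial>M01) < \<epsilon>"
  shows "\<forall>\<^sub>F M in sequentially. (\<Sum>j<M. h (real j / real M)) \<le> \<epsilon> * real M"
proof -
  define I where "I = (\<integral>x. h x \<partial>M01)"
  \<comment> \<open>One third each for replacing h by a polynomial at the sample points, for the
    convergence of the Riemann sums of that polynomial, and for the change of the integral.\<close>
  define d where "d = (\<epsilon> - I) / 3"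
  have d: "d > 0" using \<epsilon> by (simp add: d_def I_def)
  have "continuous_on {0..1} (\<lambda>x. complex_of_real (h x))" using cont by (intro continuous_intros)
  then obtain S a where Sa: "finite S" "\<And>x. x \<in> {0..1} \<Longrightarrow> cmod (of_real (h x) - trig S a x) < d"
    using trig_approx_continuous[of "\<lambda>x. of_real (h x)" d] eq d by metis
  define L where "L = (\<integral>x. trig S a x \<partial>M01)"
  have intg: "integrable M01 (\<lambda>x. complex_of_real (h x))" "integrable M01 (trig S a)"
    using cont by (auto intro!: M01_integrable_cont continuous_intros)
  have "cmod (of_real I - L) = cmod (\<integral>x. of_real (h x) - trig S a x \<partial>M01)"
    using intg by (simp add: I_def L_def integral_complex_of_real)
  also have "\<dots> \<le> (\<integral>x. cmod (of_real (h x) - trig S a x) \<partial>M01)" by (rule integral_norm_bound)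
  also have "\<dots> \<le> (\<integral>x. d \<partial>M01)"
    using intg Sa(2) by (intro integral_mono) (auto intro!: less_imp_le)
  also have "\<dots> = d" using M01.prob_space by simp
  finally have LI: "cmod (of_real I - L) \<le> d" .
  have "\<forall>\<^sub>F M in sequentially. cmod ((\<Sum>j<M. trig S a (real j / real M)) / of_nat M - L) < d"
    using riemann_sum_trig[OF Sa(1), of a] d unfolding L_def[symmetric] by (auto simp: tendsto_iff dist_norm)
  then show ?thesis
    using eventually_gt_at_top[of 0]
  proof eventually_elim
    case (elim M)
    have "(\<Sum>j<M. h (real j / real M)) = Re (\<Sum>j<M. of_real (h (real j / real M)))" by simp
    also have "\<dots> = Re (\<Sum>j<M. of_real (h (real j / real M)) - trig S a (real j / real M)) + Re (\<Sum>j<M. trig S a (real j / real M))"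
      by (simp add: sum_subtractf)
    also have "Re (\<Sum>j<M. of_real (h (real j / real M)) - trig S a (real j / real M)) \<le> (\<Sum>j<M. d)"
      using Sa(2) elim(2)
      by (intro order_trans[OF complex_Re_le_cmod] sum_norm_le) (auto intro!: less_imp_le)
    also have "Re (\<Sum>j<M. trig S a (real j / real M)) \<le> (I + 2 * d) * real M"
    proof -
      have "Re ((\<Sum>j<M. trig S a (real j / real M)) / of_nat M) - I =
        Re ((\<Sum>j<M. trig S a (real j / real M)) / of_nat M - L) + Re (L - of_real I)" by simp
      also have "\<dots> \<le> d + d"
        using elim(1) LI by (intro add_mono order_trans[OF complex_Re_le_cmod]) (auto simp: norm_minus_commute)
      finally have "Re (\<Sum>j<M. trig S a (real j / real M)) / real M \<le> I + 2 * d"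
        by simp
      then show ?thesis using elim(2) by (simp add: divide_le_eq)
    qed
    finally have "(\<Sum>j<M. h (real j / real M)) \<le> (I + 3 * d) * real M" by (simp add: algebra_simps)
    moreover have "I + 3 * d = \<epsilon>" by (simp add: d_def field_simps)
    ultimately show ?case by simp
  qed
qed

section \<open>Riemann integrable functions\<close>

lemma exp_sum_parseval:
  fixes z :: "'a \<Rightarrow> complex" and \<alpha> :: "'a \<Rightarrow> int"
  assumes "finite I"
  shows "complex_of_real (\<integral>x. (cmod (\<Sum>i\<in>I. z i * e (real_of_int (\<alpha> i) * x)))\<^sup>2 \<partial>M01) =
    (\<Sum>i\<in>I. \<Sum>j\<in>I. if \<alpha> i = \<alpha> j then z i * cnj (z j) else 0)"
proof -
  let ?s = "\<lambda>x. \<Sum>i\<in>I. z i * e (real_of_int (\<alpha> i) * x)"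
  have "complex_of_real (\<integral>x. (cmod (?s x))\<^sup>2 \<partial>M01) = (\<integral>x. complex_of_real ((cmod (?s x))\<^sup>2) \<partial>M01)"
    by (rule integral_complex_of_real[symmetric])
  also have "\<dots> = (\<integral>x. (\<Sum>i\<in>I. \<Sum>j\<in>I. z i * cnj (z j) * e (real_of_int (\<alpha> i - \<alpha> j) * x)) \<partial>M01)"
  proof (rule Bochner_Integration.integral_cong[OF refl])
    fix x :: real
    have "e (real_of_int (\<alpha> i - \<alpha> j) * x) = e (real_of_int (\<alpha> i) * x) * cnj (e (real_of_int (\<alpha> j) * x))" for i j
      by (simp add: left_diff_distrib flip: e_minus e_add)
    then show "complex_of_real ((cmod (?s x))\<^sup>2) = (\<Sum>i\<in>I. \<Sum>j\<in>I. z i * cnj (z j) * e (real_of_int (\<alpha> i - \<alpha> j) * x))"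
      unfolding complex_norm_square cnj_sum sum_product by (simp add: mult_ac)
  qed
  also have "\<dots> = (\<Sum>i\<in>I. \<Sum>j\<in>I. \<integral>x. z i * cnj (z j) * e (real_of_int (\<alpha> i - \<alpha> j) * x) \<partial>M01)"
    by (subst Bochner_Integration.integral_sum; intro sum.cong refl M01_integrable_cont continuous_intros
        Bochner_Integration.integral_sum)
  also have "\<dots> = (\<Sum>i\<in>I. \<Sum>j\<in>I. if \<alpha> i = \<alpha> j then z i * cnj (z j) else 0)"
    by (intro sum.cong refl) (simp add: integral_e del: of_int_diff)
  finally show ?thesis .
qed

text \<open>The exponentials with frequencies n^2 are not orthogonal, because n and -n share a
  frequency. Each index meets at most one other, which costs a factor 2.\<close>

lemma exp_square_sum_norm_le:
  assumes "finite K"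
  shows "(\<integral>x. (cmod (\<Sum>n\<in>K. b n * e (real_of_int (n\<^sup>2) * x)))\<^sup>2 \<partial>M01) \<le> 2 * (\<Sum>n\<in>K. (cmod (b n))\<^sup>2)"
proof -
  let ?L = "\<integral>x. (cmod (\<Sum>n\<in>K. b n * e (real_of_int (n\<^sup>2) * x)))\<^sup>2 \<partial>M01"
  have "?L = cmod (complex_of_real ?L)" by (simp add: Bochner_Integration.integral_nonneg)
  also have "\<dots> \<le> (\<Sum>i\<in>K. \<Sum>j\<in>K. if i\<^sup>2 = j\<^sup>2 then cmod (b i) * cmod (b j) else 0)"
    unfolding exp_sum_parseval[OF assms] by (intro sum_norm_le) (auto simp: norm_mult)
  also have "\<dots> \<le> (\<Sum>i\<in>K. \<Sum>j\<in>K. (if i\<^sup>2 = j\<^sup>2 then (cmod (b i))\<^sup>2 / 2 else 0) + (if j\<^sup>2 = i\<^sup>2 then (cmod (b j))\<^sup>2 / 2 else 0))"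
  proof (intro sum_mono)
    fix i j :: int
    have "0 \<le> (cmod (b i) - cmod (b j))\<^sup>2" by simp
    then show "(if i\<^sup>2 = j\<^sup>2 then cmod (b i) * cmod (b j) else 0) \<le>
        (if i\<^sup>2 = j\<^sup>2 then (cmod (b i))\<^sup>2 / 2 else 0) + (if j\<^sup>2 = i\<^sup>2 then (cmod (b j))\<^sup>2 / 2 else 0)"
      by (auto simp: power2_diff field_simps)
  qed
  also have "\<dots> = 2 * (\<Sum>i\<in>K. \<Sum>j\<in>K. (if i\<^sup>2 = j\<^sup>2 then (cmod (b i))\<^sup>2 / 2 else 0))"
  proof -
    have "(\<Sum>i\<in>K. \<Sum>j\<in>K. (if j\<^sup>2 = i\<^sup>2 then (cmod (b j))\<^sup>2 / 2 else 0)) = (\<Sum>i\<in>K. \<Sum>j\<in>K. (if i\<^sup>2 = j\<^sup>2 then (cmod (b i))\<^sup>2 / 2 else 0))"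
      by (rule sum.swap)
    then show ?thesis by (simp add: sum.distrib)
  qed
  also have "\<dots> \<le> 2 * (\<Sum>i\<in>K. (cmod (b i))\<^sup>2)"
  proof (intro mult_left_mono sum_mono)
    fix i
    have "(\<Sum>j\<in>K. (if i\<^sup>2 = j\<^sup>2 then (cmod (b i))\<^sup>2 / 2 else 0)) = (\<Sum>j\<in>{j\<in>K. i\<^sup>2 = j\<^sup>2}. (cmod (b i))\<^sup>2 / 2)"
      using assms by (intro sum.inter_filter[symmetric])
    also have "\<dots> \<le> (\<Sum>j\<in>{i, -i}. (cmod (b i))\<^sup>2 / 2)"
      by (intro sum_mono2) (auto simp: power2_eq_iff)
    also have "\<dots> \<le> 2 * ((cmod (b i))\<^sup>2 / 2)" by (cases "i = 0") auto
    finally show "(\<Sum>j\<in>K. (if i\<^sup>2 = j\<^sup>2 then (cmod (b i))\<^sup>2 / 2 else 0)) \<le> (cmod (b i))\<^sup>2" by simp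
  qed auto
  finally show ?thesis .
qed

lemma bessel_inequality:
  assumes f: "f \<in> borel_measurable M01" "\<And>x. x \<in> {0..1} \<Longrightarrow> cmod (f x) \<le> B" and K: "finite K"
  shows "(\<Sum>k\<in>K. (cmod (fcoeff f k))\<^sup>2) \<le> (\<integral>x. (cmod (f x))\<^sup>2 \<partial>M01)"
proof -
  define c where "c = fcoeff f"
  define s where "s = trig K c"
  have fm: "(\<lambda>x. (cmod (f x))\<^sup>2) \<in> borel_measurable M01" using f(1) by measurable
  have if2: "integrable M01 (\<lambda>x. (cmod (f x))\<^sup>2)"
    using fm by (rule M01_integrable_bounded[of _ "B\<^sup>2"]) (use f(2) in \<open>auto intro!: power_mono\<close>)
  have is2: "integrable M01 (\<lambda>x. (cmod (s x))\<^sup>2)" unfolding s_def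
    by (intro M01_integrable_cont continuous_intros)
  have ifk: "integrable M01 (\<lambda>x. f x * cnj (e (real_of_int k * x)))" for k
  proof (rule M01_integrable_bounded[of _ B])
    have "(\<lambda>x. cnj (e (real_of_int k * x))) \<in> borel_measurable M01"
      by (intro M01_measurable_cont continuous_intros)
    then show "(\<lambda>x. f x * cnj (e (real_of_int k * x))) \<in> borel_measurable M01"
      using f(1) by (rule borel_measurable_times[rotated])
  qed (use f(2) in \<open>simp add: norm_mult\<close>)
  have fs: "f x * cnj (s x) = (\<Sum>k\<in>K. cnj (c k) * (f x * cnj (e (real_of_int k * x))))" for x
    unfolding s_def trig_def cnj_sum sum_distrib_left by (simp add: mult_ac)
  have ifs: "integrable M01 (\<lambda>x. f x * cnj (s x))"
    unfolding fs by (intro Bochner_Integration.integrable_sum integrable_mult_right ifk)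
  have "(\<integral>x. f x * cnj (s x) \<partial>M01) = (\<Sum>k\<in>K. cnj (c k) * (\<integral>x. f x * cnj (e (real_of_int k * x)) \<partial>M01))"
    unfolding fs by (subst Bochner_Integration.integral_sum) (use ifk in auto)
  also have "\<dots> = (\<Sum>k\<in>K. cnj (c k) * c k)"
    unfolding c_def by (intro sum.cong refl arg_cong2[where f="(*)"] fcoeff_eq_M01[OF f, symmetric])
  also have "\<dots> = complex_of_real (\<Sum>k\<in>K. (cmod (c k))\<^sup>2)"
    by (simp only: of_real_sum complex_norm_square) (simp add: mult.commute)
  finally have 1: "(\<integral>x. f x * cnj (s x) \<partial>M01) = complex_of_real (\<Sum>k\<in>K. (cmod (c k))\<^sup>2)" .
  have "complex_of_real (\<integral>x. (cmod (s x))\<^sup>2 \<partial>M01) = (\<Sum>i\<in>K. \<Sum>j\<in>K. if i = j then c i * cnj (c j) else 0)"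
    unfolding s_def trig_def by (rule exp_sum_parseval[OF K, of c "\<lambda>k. k"])
  also have "\<dots> = complex_of_real (\<Sum>k\<in>K. (cmod (c k))\<^sup>2)"
    using K by (simp add: complex_norm_square del: of_real_power)
  finally have 2: "(\<integral>x. (cmod (s x))\<^sup>2 \<partial>M01) = (\<Sum>k\<in>K. (cmod (c k))\<^sup>2)"
    by (simp only: of_real_eq_iff)
  have "0 \<le> (\<integral>x. (cmod (f x - s x))\<^sup>2 \<partial>M01)" by (intro Bochner_Integration.integral_nonneg) auto
  also have "(\<lambda>x. (cmod (f x - s x))\<^sup>2) = (\<lambda>x. (cmod (f x))\<^sup>2 + (cmod (s x))\<^sup>2 - 2 * Re (f x * cnj (s x)))"
    unfolding cmod_power2 by (simp add: fun_eq_iff power2_eq_square algebra_simps)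
  also have "(\<integral>x. (cmod (f x))\<^sup>2 + (cmod (s x))\<^sup>2 - 2 * Re (f x * cnj (s x)) \<partial>M01) =
     (\<integral>x. (cmod (f x))\<^sup>2 \<partial>M01) + (\<integral>x. (cmod (s x))\<^sup>2 \<partial>M01) - 2 * Re (\<integral>x. f x * cnj (s x) \<partial>M01)"
    unfolding integral_Re[OF ifs, symmetric]
    using if2 is2 integrable_Re[OF ifs] by (simp del: times_complex.sel complex_cnj)
  finally show ?thesis using 1 2 by (simp add: c_def)
qed

lemma fcoeff_trig: "finite S \<Longrightarrow> fcoeff (trig S a) k = (if k \<in> S then a k else 0)"
proof -
  assume S: "finite S"
  have "fcoeff (trig S a) k = (\<integral>x. trig S a x * cnj (e (real_of_int k * x)) \<partial>M01)"
    by (rule fcoeff_eq_M01[of _ "\<Sum>k\<in>S. cmod (a k)"]) (auto intro!: M01_measurable_cont continuous_intros norm_trig_le)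
  also have "\<dots> = (\<integral>x. (\<Sum>l\<in>S. a l * e (real_of_int (l - k) * x)) \<partial>M01)"
  proof (rule Bochner_Integration.integral_cong[OF refl])
    fix x :: real
    have "e (real_of_int (l - k) * x) = e (real_of_int l * x) * cnj (e (real_of_int k * x))" for l
      by (simp add: left_diff_distrib flip: e_minus e_add)
    then show "trig S a x * cnj (e (real_of_int k * x)) = (\<Sum>l\<in>S. a l * e (real_of_int (l - k) * x))"
      unfolding trig_def sum_distrib_right by (simp add: mult.assoc)
  qed
  also have "\<dots> = (\<Sum>l\<in>S. \<integral>x. a l * e (real_of_int (l - k) * x) \<partial>M01)"
    by (intro Bochner_Integration.integral_sum M01_integrable_cont continuous_intros)
  also have "\<dots> = (\<Sum>l\<in>S. if l = k then a l else 0)"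
    by (intro sum.cong refl) (simp add: integral_e del: of_int_diff)
  finally show ?thesis using S by (simp add: sum.delta)
qed

text \<open>Closeness in mean says nothing about averages over the fractions \<open>j / M\<close>, which are what
  Gauss sums and the sampling of \<open>p / q\<close> see; hence the clause on Riemann sums.\<close>

definition trig_approx :: "(real \<Rightarrow> complex) \<Rightarrow> real \<Rightarrow> bool" where
  "trig_approx f B \<longleftrightarrow> f \<in> borel_measurable M01 \<and> (\<forall>x\<in>{0..1}. cmod (f x) \<le> B) \<and>
    (\<forall>\<epsilon>>0. \<exists>S a H. finite S \<and> (\<forall>x\<in>{0..1}. cmod (trig S a x) \<le> B + 1 \<and> cmod (f x - trig S a x) \<le> H x) \<and>
      integrable M01 H \<and> (\<integral>x. H x \<partial>M01) < \<epsilon> \<and>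
      (\<forall>\<^sub>F M in sequentially. (\<Sum>j<M. H (real j / real M)) \<le> \<epsilon> * real M))"

text \<open>Approximation by continuous functions with equal end values is enough. Replacing them
  uniformly by trigonometric polynomials within d adds the constant d to the majorant, and d \<le> 1
  is the reason for the bound B + 1 in \<open>trig_approx\<close>.\<close>

lemma trig_approxI:
  fixes f :: "real \<Rightarrow> complex"
  assumes f: "f \<in> borel_measurable M01" "\<And>x. x \<in> {0..1} \<Longrightarrow> cmod (f x) \<le> B"
    and approx: "\<And>\<epsilon>. \<epsilon> > 0 \<Longrightarrow> \<exists>\<gamma> H. continuous_on {0..1} \<gamma> \<and> \<gamma> 0 = \<gamma> 1 \<and>
      (\<forall>x\<in>{0..1}. cmod (\<gamma> x) \<le> B \<and> cmod (f x - \<gamma> x) \<le> H x) \<and> integrable M01 H \<and> (\<integral>x. H x \<partial>M01) < \<epsilon> \<and>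
      (\<forall>\<^sub>F M in sequentially. (\<Sum>j<M. H (real j / real M)) \<le> \<epsilon> * real M)"
  shows "trig_approx f B"
  unfolding trig_approx_def
proof (intro conjI ballI allI impI f)
  fix \<epsilon> :: real assume \<epsilon>: "\<epsilon> > 0"
  obtain \<gamma> H where \<gamma>: "continuous_on {0..1} \<gamma>" "\<gamma> 0 = \<gamma> 1"
      and \<gamma>H: "\<forall>x\<in>{0..1}. cmod (\<gamma> x) \<le> B \<and> cmod (f x - \<gamma> x) \<le> H x"
      and H: "integrable M01 H" "(\<integral>x. H x \<partial>M01) < \<epsilon> / 2"
      "\<forall>\<^sub>F M in sequentially. (\<Sum>j<M. H (real j / real M)) \<le> \<epsilon> / 2 * real M"
    using approx[OF half_gt_zero[OF \<epsilon>]] by blast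
  define d where "d = min 1 (\<epsilon> / 2)"
  have d: "d > 0" "d \<le> 1" "d \<le> \<epsilon> / 2" using \<epsilon> by (auto simp: d_def)
  obtain S a where S: "finite S" "\<And>x. x \<in> {0..1} \<Longrightarrow> cmod (\<gamma> x - trig S a x) < d"
    using trig_approx_continuous[OF \<gamma>(1,2) d(1)] by blast
  show "\<exists>S a H. finite S \<and> (\<forall>x\<in>{0..1}. cmod (trig S a x) \<le> B + 1 \<and> cmod (f x - trig S a x) \<le> H x) \<and>
      integrable M01 H \<and> (\<integral>x. H x \<partial>M01) < \<epsilon> \<and>
      (\<forall>\<^sub>F M in sequentially. (\<Sum>j<M. H (real j / real M)) \<le> \<epsilon> * real M)"
  proof (intro exI conjI ballI)
    show "finite S" by fact
    fix x :: real assume x: "x \<in> {0..1}"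
    show "cmod (trig S a x) \<le> B + 1"
      using norm_triangle_sub[of "trig S a x" "\<gamma> x"] bspec[OF \<gamma>H x] S(2)[OF x] d by (simp add: norm_minus_commute)
    show "cmod (f x - trig S a x) \<le> H x + d"
      using norm_triangle_ineq[of "f x - \<gamma> x" "\<gamma> x - trig S a x"] bspec[OF \<gamma>H x] S(2)[OF x] by simp
  next
    show "integrable M01 (\<lambda>x. H x + d)" using H(1) by simp
    have "(\<integral>x. H x + d \<partial>M01) = (\<integral>x. H x \<partial>M01) + d" using H(1) M01.prob_space by simp
    then show "(\<integral>x. H x + d \<partial>M01) < \<epsilon>" using H(2) d by simp
    show "\<forall>\<^sub>F M in sequentially. (\<Sum>j<M. H (real j / real M) + d) \<le> \<epsilon> * real M"
      using H(3)
    proof eventually_elim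
      case (elim M)
      have "(\<Sum>j<M. H (real j / real M) + d) = (\<Sum>j<M. H (real j / real M)) + real M * d" by (simp add: sum.distrib)
      also have "\<dots> \<le> \<epsilon> / 2 * real M + real M * (\<epsilon> / 2)" using elim d by (intro add_mono mult_left_mono) auto
      finally show ?case by simp
    qed
  qed
qed

lemma partition_cover:
  fixes X :: "nat \<Rightarrow> real"
  assumes "X 0 \<le> x" "x \<le> X n" "n > 0" "X 0 \<le> X (Suc 0)"
  shows "\<exists>i<n. X i \<le> x \<and> x \<le> X (Suc i)"
proof -
  define m where "m = (LEAST m. x \<le> X m)"
  have m: "x \<le> X m" "m \<le> n" unfolding m_def using assms(2) by (auto intro: LeastI Least_le)
  show ?thesis
  proof (cases m)
    case 0
    then have "x = X 0" using m assms(1) by simp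
    then show ?thesis using assms by auto
  next
    case (Suc j)
    then have "\<not> x \<le> X j" unfolding m_def by (metis lessI not_less_Least)
    then show ?thesis using Suc m by (intro exI[of _ j]) auto
  qed
qed

lemma card_fractions_le:
  fixes a b :: real
  assumes "a \<le> b" "M > 0"
  shows "(\<Sum>j<M. indicator {a..b} (real j / real M)) \<le> real M * (b - a) + 1"
proof -
  let ?A = "{j \<in> {..<M}. real j / real M \<in> {a..b}}"
  have "(\<Sum>j<M. indicator {a..b} (real j / real M) :: real) = real (card ?A)"
    by (simp add: indicator_def of_bool_def sum.inter_filter[symmetric])
  also have "card ?A \<le> card {\<lceil>a * real M\<rceil>..\<lfloor>b * real M\<rfloor>}"
    using assms(2) by (intro card_inj_on_le[of int]) (auto simp: field_simps ceiling_le_iff le_floor_iff)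
  also have "real (card {\<lceil>a * real M\<rceil>..\<lfloor>b * real M\<rfloor>}) \<le> real M * (b - a) + 1"
  proof -
    have "real_of_int (\<lfloor>b * real M\<rfloor> - \<lceil>a * real M\<rceil> + 1) \<le> b * real M - a * real M + 1"
      by linarith
    moreover have "0 \<le> real M * (b - a) + 1" using assms by simp
    ultimately show ?thesis by (simp add: algebra_simps)
  qed
  finally show ?thesis by simp
qed

text \<open>Here \<gamma> interpolates f linearly along a partition of small oscillation sum, and H
  is the step function of the oscillations. Its integral is the Darboux difference; being a step
  function, it has Riemann sums that can be bounded by counting fractions in intervals.\<close>

lemma riemann_real_approx:
  fixes f :: "real \<Rightarrow> real"
  assumes R: "riemann_int_real f 0 1" and B: "\<And>x. x \<in> {0..1} \<Longrightarrow> \<bar>f x\<bar> \<le> B" and \<epsilon>: "\<epsilon> > 0"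
  shows "\<exists>\<gamma> H. continuous_on {0..1} \<gamma> \<and> \<gamma> 0 = f 0 \<and> \<gamma> 1 = f 1 \<and>
      (\<forall>x\<in>{0..1}. \<bar>\<gamma> x\<bar> \<le> B \<and> \<bar>f x - \<gamma> x\<bar> \<le> H x) \<and> integrable M01 H \<and> (\<integral>x. H x \<partial>M01) < \<epsilon> \<and>
      (\<forall>\<^sub>F M in sequentially. (\<Sum>j<M. H (real j / real M)) \<le> \<epsilon> * real M)"
proof -
  obtain n X where X: "X 0 = 0" "X n = 1" "\<And>i. i < n \<Longrightarrow> X i < X (Suc i)"
    and osc: "(\<Sum>i<n. (X (Suc i) - X i) * ((SUP t\<in>{X i..X (Suc i)}. f t) - (INF t\<in>{X i..X (Suc i)}. f t))) < \<epsilon>"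
    using R \<epsilon> unfolding riemann_int_real_def by blast
  have n: "n > 0" using X(1,2) by (cases n) auto
  have mono: "X i \<le> X j" if "i \<le> j" "j \<le> n" for i j
    using that
  proof (induction j rule: dec_induct)
    case (step j) then show ?case using X(3)[of j] by simp
  qed simp
  have sub: "{X i..X (Suc i)} \<subseteq> {0..1}" if "i < n" for i
    using mono[of 0 i] mono[of "Suc i" n] that X(1,2) by auto
  define hi where "hi = (\<lambda>i. SUP t\<in>{X i..X (Suc i)}. f t)"
  define lo where "lo = (\<lambda>i. INF t\<in>{X i..X (Suc i)}. f t)"
  have hilo: "lo i \<le> f t" "f t \<le> hi i" if "i < n" "t \<in> {X i..X (Suc i)}" for i t
  proof -
    have "- B \<le> f t \<and> f t \<le> B" if "t \<in> {X i..X (Suc i)}" for t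
      using B[of t] sub[OF \<open>i < n\<close>] that by (simp add: abs_le_iff subset_iff)
    then have "bdd_above (f ` {X i..X (Suc i)})" "bdd_below (f ` {X i..X (Suc i)})"
      by (meson bdd_aboveI2 bdd_belowI2)+
    then show "lo i \<le> f t" "f t \<le> hi i" unfolding hi_def lo_def using that(2)
      by (auto intro: cINF_lower cSUP_upper)
  qed
  define \<omega> where "\<omega> = (\<lambda>i. hi i - lo i)"
  have \<omega>0: "\<omega> i \<ge> 0" if "i < n" for i
    using hilo[of i "X i"] X(3)[OF that] that by (simp add: \<omega>_def)
  \<comment> \<open>Neighbouring closed intervals overlap in a point of the partition. There two
    oscillations are added, which is harmless in an upper bound.\<close>
  define H where "H = (\<lambda>x. \<Sum>i<n. \<omega> i * indicator {X i..X (Suc i)} x)"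
  \<comment> \<open>A ramp from 0 to 1 across the i-th interval; on the k-th interval the earlier
    ramps are 1 and the later ones 0, so the sum in \<gamma> telescopes to the
    interpolation.\<close>
  define l where "l = (\<lambda>i x. max 0 (min 1 ((x - X i) / (X (Suc i) - X i))))"
  define \<gamma> where "\<gamma> = (\<lambda>x. f 0 + (\<Sum>i<n. (f (X (Suc i)) - f (X i)) * l i x))"
  have \<gamma>_eq: "\<gamma> x = f (X k) + (f (X (Suc k)) - f (X k)) * l k x" if k: "k < n" and x: "x \<in> {X k..X (Suc k)}" for k x
  proof -
    have l1: "l i x = 1" if "i < k" for i
    proof -
      have "X (Suc i) \<le> x" "X i < X (Suc i)" using mono[of "Suc i" k] that k x X(3)[of i] by auto
      then show ?thesis by (simp add: l_def min_def max_def field_simps)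
    qed
    have l0: "l i x = 0" if "k < i" "i < n" for i
    proof -
      have "x \<le> X i" "X i < X (Suc i)" using mono[of "Suc k" i] that k x X(3)[of i] by auto
      then have "(x - X i) / (X (Suc i) - X i) \<le> 0" by (intro divide_nonpos_pos) auto
      then show ?thesis by (simp add: l_def)
    qed
    have split: "{..<n} = {..<k} \<union> insert k {Suc k..<n}" using k by auto
    have "sum F {..<n} = sum F {..<k} + (F k + sum F {Suc k..<n})" for F :: "nat \<Rightarrow> real"
      unfolding split by (subst sum.union_disjoint) auto
    then have "(\<Sum>i<n. (f (X (Suc i)) - f (X i)) * l i x) = (\<Sum>i<k. (f (X (Suc i)) - f (X i)) * l i x) +
        ((f (X (Suc k)) - f (X k)) * l k x + (\<Sum>i\<in>{Suc k..<n}. (f (X (Suc i)) - f (X i)) * l i x))"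
      by blast
    also have "(\<Sum>i<k. (f (X (Suc i)) - f (X i)) * l i x) = (\<Sum>i<k. f (X (Suc i)) - f (X i))"
      by (intro sum.cong refl) (simp add: l1)
    also have "\<dots> = f (X k) - f 0" using sum_lessThan_telescope[of "\<lambda>i. f (X i)" k] X(1) by simp
    also have "(\<Sum>i\<in>{Suc k..<n}. (f (X (Suc i)) - f (X i)) * l i x) = 0"
      by (intro sum.neutral ballI) (simp add: l0)
    finally show ?thesis by (simp add: \<gamma>_def)
  qed
  have l01: "0 \<le> l i x" "l i x \<le> 1" for i x by (auto simp: l_def)
  have cover: "\<exists>k<n. x \<in> {X k..X (Suc k)}" if "x \<in> {0..1}" for x
    using partition_cover[of X x n] that X n X(3)[of 0] by auto
  have ends: "X k \<in> {X k..X (Suc k)}" "X (Suc k) \<in> {X k..X (Suc k)}" if "k < n" for k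
    using X(3)[OF that] by auto
  have bnd: "\<bar>\<gamma> x\<bar> \<le> B" "\<bar>f x - \<gamma> x\<bar> \<le> H x" if x01: "x \<in> {0..1}" for x
  proof -
    obtain k where k: "k < n" "x \<in> {X k..X (Suc k)}" using cover[OF x01] by blast
    have conv: "\<gamma> x = (1 - l k x) * f (X k) + l k x * f (X (Suc k))"
      using \<gamma>_eq[OF k] by (simp add: algebra_simps)
    have between: "u \<le> \<gamma> x \<and> \<gamma> x \<le> v" if "u \<le> f (X k)" "f (X k) \<le> v" "u \<le> f (X (Suc k))" "f (X (Suc k)) \<le> v" for u v
    proof -
      have "(1 - l k x) * u + l k x * u \<le> \<gamma> x" "\<gamma> x \<le> (1 - l k x) * v + l k x * v"
        unfolding conv using that l01[of k x] by (intro add_mono mult_left_mono; simp)+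
      then show ?thesis by (simp add: algebra_simps)
    qed
    have "X k \<in> {0..1}" "X (Suc k) \<in> {0..1}" using sub[OF k(1)] ends[OF k(1)] by blast+
    then have "\<bar>f (X k)\<bar> \<le> B" "\<bar>f (X (Suc k))\<bar> \<le> B" using B by blast+
    then show "\<bar>\<gamma> x\<bar> \<le> B" using between[of "-B" B] by (simp add: abs_le_iff)
    have "lo k \<le> \<gamma> x \<and> \<gamma> x \<le> hi k" using hilo ends k by (intro between) auto
    moreover have "lo k \<le> f x" "f x \<le> hi k" using hilo k by auto
    ultimately have "\<bar>f x - \<gamma> x\<bar> \<le> \<omega> k" by (simp add: \<omega>_def abs_le_iff)
    also have "\<omega> k = \<omega> k * indicator {X k..X (Suc k)} x" using k(2) by simp
    also have "\<dots> \<le> H x" unfolding H_def using k(1) \<omega>0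
      by (intro member_le_sum[of k "{..<n}" "\<lambda>i. \<omega> i * indicator {X i..X (Suc i)} x"]) auto
    finally show "\<bar>f x - \<gamma> x\<bar> \<le> H x" .
  qed
  have cont: "continuous_on {0..1} \<gamma>"
    unfolding \<gamma>_def l_def using X(3)
    by (intro continuous_intros) (auto simp: less_imp_neq[symmetric] dest: less_imp_neq)
  have "\<gamma> 0 = f 0" using \<gamma>_eq[of 0 0] n X(1) X(3)[of 0] by (simp add: l_def)
  moreover have "\<gamma> 1 = f 1"
  proof -
    obtain m where m: "n = Suc m" using n by (cases n) auto
    then have "l m 1 = 1" using X(2) X(3)[of m] by (simp add: l_def)
    then show ?thesis using \<gamma>_eq[of m 1] m X(2) X(3)[of m] by simp
  qed
  moreover have ind: "integrable M01 (indicator {X i..X (Suc i)} :: real \<Rightarrow> real)" for i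
    by (rule M01_integrable_bounded[of _ 1]) (auto intro!: M01_measurable_borel simp: indicator_def)
  then have "integrable M01 H" unfolding H_def by (intro Bochner_Integration.integrable_sum integrable_mult_right)
  moreover have intH: "(\<integral>x. H x \<partial>M01) < \<epsilon>"
  proof -
    have "(\<integral>x. H x \<partial>M01) = (\<Sum>i<n. \<omega> i * (\<integral>x. indicator {X i..X (Suc i)} x \<partial>M01))"
      unfolding H_def using ind by (subst Bochner_Integration.integral_sum) auto
    also have "\<dots> = (\<Sum>i<n. (X (Suc i) - X i) * \<omega> i)"
    proof (intro sum.cong refl)
      fix i assume i: "i \<in> {..<n}"
      have "(\<integral>x. indicator {X i..X (Suc i)} x \<partial>M01) = measure M01 ({X i..X (Suc i)} \<inter> space M01)"
        by (rule Bochner_Integration.integral_indicator)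
      also have "\<dots> = measure lebesgue {X i..X (Suc i)}"
        using sub[of i] i by (subst measure_restrict_space) (auto simp: Int_absorb2)
      also have "\<dots> = X (Suc i) - X i" using X(3)[of i] i by simp
      finally show "\<omega> i * (\<integral>x. indicator {X i..X (Suc i)} x \<partial>M01) = (X (Suc i) - X i) * \<omega> i" by simp
    qed
    also have "\<dots> < \<epsilon>" using osc by (simp add: \<omega>_def hi_def lo_def)
    finally show ?thesis .
  qed
  moreover have "\<forall>\<^sub>F M in sequentially. (\<Sum>j<M. H (real j / real M)) \<le> \<epsilon> * real M"
  proof -
    define s where "s = (\<Sum>i<n. (X (Suc i) - X i) * \<omega> i)"
    have s: "s < \<epsilon>" using osc by (simp add: s_def \<omega>_def hi_def lo_def)
    \<comment> \<open>An interval may contain one fraction more than its length predicts. The total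
      excess is bounded by the sum of the oscillations and fits into the gap between s and
      \<epsilon> for large M.\<close>
    have "\<forall>\<^sub>F M in sequentially. (\<Sum>i<n. \<omega> i) / (\<epsilon> - s) \<le> real M"
      using filterlim_real_sequentially by (simp add: filterlim_at_top)
    then show ?thesis using eventually_gt_at_top[of 0]
    proof eventually_elim
      case (elim M)
      have "(\<Sum>j<M. H (real j / real M)) = (\<Sum>i<n. \<omega> i * (\<Sum>j<M. indicator {X i..X (Suc i)} (real j / real M)))"
        unfolding H_def by (subst sum.swap) (simp add: sum_distrib_left)
      also have "\<dots> \<le> (\<Sum>i<n. \<omega> i * (real M * (X (Suc i) - X i) + 1))"
        using \<omega>0 X(3) elim(2) by (intro sum_mono mult_left_mono card_fractions_le) (auto intro: less_imp_le)
      also have "\<dots> = s * real M + (\<Sum>i<n. \<omega> i)"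
        unfolding distrib_left sum.distrib s_def sum_distrib_right by (simp add: mult_ac)
      also have "(\<Sum>i<n. \<omega> i) \<le> (\<epsilon> - s) * real M" using elim(1) s by (simp add: divide_le_eq mult.commute)
      finally show ?case by (simp add: algebra_simps)
    qed
  qed
  ultimately show ?thesis by (intro exI[of _ \<gamma>] exI[of _ H] conjI ballI bnd cont)
qed

lemma riemann_real_bounded:
  assumes "riemann_int_real f 0 1"
  shows "\<exists>B. \<forall>x\<in>{0..1}. \<bar>f x\<bar> \<le> B"
  using assms by (simp add: riemann_int_real_def bounded_iff)

text \<open>The functions \<gamma> - H and \<gamma> + H straddle f with integrals arbitrarily close,
  so f is gauge integrable, and this entails Lebesgue measurability.\<close>

lemma riemann_real_measurable:
  fixes f :: "real \<Rightarrow> real"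
  assumes R: "riemann_int_real f 0 1"
  shows "f \<in> borel_measurable M01"
proof -
  obtain B where B: "\<And>x. x \<in> {0..1} \<Longrightarrow> \<bar>f x\<bar> \<le> B"
    using riemann_real_bounded[OF R] by blast
  have "f integrable_on {0..1}"
  proof (rule integrable_straddle)
    fix \<epsilon> :: real assume "\<epsilon> > 0"
    then obtain \<gamma> H where \<gamma>: "continuous_on {0..1} \<gamma>" "\<forall>x\<in>{0..1}. \<bar>\<gamma> x\<bar> \<le> B \<and> \<bar>f x - \<gamma> x\<bar> \<le> H x"
      and H: "integrable M01 H" "(\<integral>x. H x \<partial>M01) < \<epsilon> / 2"
      using riemann_real_approx[OF R B, of "\<epsilon> / 2"] by auto
    have i: "integrable M01 \<gamma>" using \<gamma>(1) by (rule M01_integrable_cont)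
    have "((\<lambda>x. \<gamma> x - H x) has_integral (\<integral>x. \<gamma> x - H x \<partial>M01)) {0..1}"
      "((\<lambda>x. \<gamma> x + H x) has_integral (\<integral>x. \<gamma> x + H x \<partial>M01)) {0..1}"
      using i H(1) by (intro has_integral_integral_lebesgue_on; simp)+
    moreover have "0 \<le> H x" if "x \<in> {0..1}" for x
      using bspec[OF \<gamma>(2) that] by (meson abs_ge_zero order_trans)
    then have "0 \<le> (\<integral>x. H x \<partial>M01)"
      by (intro Bochner_Integration.integral_nonneg_AE AE_I2) simp
    then have "\<bar>(\<integral>x. \<gamma> x - H x \<partial>M01) - (\<integral>x. \<gamma> x + H x \<partial>M01)\<bar> < \<epsilon>" using i H by simp
    moreover have "\<forall>x\<in>{0..1}. \<gamma> x - H x \<le> f x \<and> f x \<le> \<gamma> x + H x"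
      using \<gamma>(2) by (auto simp: abs_le_iff algebra_simps)
    ultimately show "\<exists>g h i j. (g has_integral i) {0..1} \<and> (h has_integral j) {0..1} \<and> \<bar>i - j\<bar> < \<epsilon> \<and>
       (\<forall>x\<in>{0..1}. g x \<le> f x \<and> f x \<le> h x)" by blast
  qed
  then show ?thesis by (rule integrable_imp_measurable)
qed

text \<open>Real and imaginary parts are interpolated separately. The interpolation keeps the values
  at 0 and 1, so periodicity of \<phi> makes the ends of \<gamma> agree.\<close>

lemma riemann_trig_approx:
  assumes R: "riemann_int \<phi> 0 1" and per: "\<phi> 1 = \<phi> 0"
  shows "\<exists>B. trig_approx \<phi> B"
proof -
  have Re: "riemann_int_real (\<lambda>x. Re (\<phi> x)) 0 1" and Im: "riemann_int_real (\<lambda>x. Im (\<phi> x)) 0 1"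
    using R by (auto simp: riemann_int_def)
  obtain B1 B2 where B1: "\<And>x. x \<in> {0..1} \<Longrightarrow> \<bar>Re (\<phi> x)\<bar> \<le> B1" and B2: "\<And>x. x \<in> {0..1} \<Longrightarrow> \<bar>Im (\<phi> x)\<bar> \<le> B2"
    using riemann_real_bounded[OF Re] riemann_real_bounded[OF Im] by blast
  have "trig_approx \<phi> (B1 + B2)"
  proof (rule trig_approxI)
    show "\<phi> \<in> borel_measurable M01"
      using riemann_real_measurable[OF Re] riemann_real_measurable[OF Im] by (simp add: borel_measurable_complex_iff)
    fix x :: real assume x: "x \<in> {0..1}"
    show "cmod (\<phi> x) \<le> B1 + B2"
      using cmod_le[of "\<phi> x"] B1[OF x] B2[OF x] by linarith
  next
    fix \<epsilon> :: real assume \<epsilon>: "\<epsilon> > 0"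
    obtain \<gamma>1 H1 where 1: "continuous_on {0..1} \<gamma>1" "\<gamma>1 0 = Re (\<phi> 0)" "\<gamma>1 1 = Re (\<phi> 1)"
      "\<forall>x\<in>{0..1}. \<bar>\<gamma>1 x\<bar> \<le> B1 \<and> \<bar>Re (\<phi> x) - \<gamma>1 x\<bar> \<le> H1 x" "integrable M01 H1" "(\<integral>x. H1 x \<partial>M01) < \<epsilon> / 2"
      "\<forall>\<^sub>F M in sequentially. (\<Sum>j<M. H1 (real j / real M)) \<le> \<epsilon> / 2 * real M"
      using riemann_real_approx[OF Re B1, of "\<epsilon> / 2"] \<epsilon> by auto
    obtain \<gamma>2 H2 where 2: "continuous_on {0..1} \<gamma>2" "\<gamma>2 0 = Im (\<phi> 0)" "\<gamma>2 1 = Im (\<phi> 1)"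
      "\<forall>x\<in>{0..1}. \<bar>\<gamma>2 x\<bar> \<le> B2 \<and> \<bar>Im (\<phi> x) - \<gamma>2 x\<bar> \<le> H2 x" "integrable M01 H2" "(\<integral>x. H2 x \<partial>M01) < \<epsilon> / 2"
      "\<forall>\<^sub>F M in sequentially. (\<Sum>j<M. H2 (real j / real M)) \<le> \<epsilon> / 2 * real M"
      using riemann_real_approx[OF Im B2, of "\<epsilon> / 2"] \<epsilon> by auto
    define \<gamma> where "\<gamma> = (\<lambda>x. Complex (\<gamma>1 x) (\<gamma>2 x))"
    have "continuous_on {0..1} \<gamma>" unfolding \<gamma>_def Complex_eq using 1(1) 2(1) by (intro continuous_intros)
    moreover have "\<gamma> 0 = \<gamma> 1" using 1(2,3) 2(2,3) per by (simp add: \<gamma>_def)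
    moreover have "cmod (\<gamma> x) \<le> B1 + B2 \<and> cmod (\<phi> x - \<gamma> x) \<le> H1 x + H2 x" if "x \<in> {0..1}" for x
    proof -
      have "\<bar>\<gamma>1 x\<bar> \<le> B1" "\<bar>\<gamma>2 x\<bar> \<le> B2" "\<bar>Re (\<phi> x) - \<gamma>1 x\<bar> \<le> H1 x" "\<bar>Im (\<phi> x) - \<gamma>2 x\<bar> \<le> H2 x"
        using 1(4) 2(4) that by auto
      then show ?thesis using cmod_le[of "\<gamma> x"] cmod_le[of "\<phi> x - \<gamma> x"] by (simp add: \<gamma>_def)
    qed
    moreover have "integrable M01 (\<lambda>x. H1 x + H2 x)" "(\<integral>x. H1 x + H2 x \<partial>M01) < \<epsilon>"
      using 1(5,6) 2(5,6) by simp_all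
    moreover have "\<forall>\<^sub>F M in sequentially. (\<Sum>j<M. H1 (real j / real M) + H2 (real j / real M)) \<le> \<epsilon> * real M"
      using 1(7) 2(7) by eventually_elim (simp add: sum.distrib)
    ultimately show "\<exists>\<gamma> H. continuous_on {0..1} \<gamma> \<and> \<gamma> 0 = \<gamma> 1 \<and>
      (\<forall>x\<in>{0..1}. cmod (\<gamma> x) \<le> B1 + B2 \<and> cmod (\<phi> x - \<gamma> x) \<le> H x) \<and> integrable M01 H \<and> (\<integral>x. H x \<partial>M01) < \<epsilon> \<and>
      (\<forall>\<^sub>F M in sequentially. (\<Sum>j<M. H (real j / real M)) \<le> \<epsilon> * real M)"
      by (intro exI[of _ \<gamma>] exI[of _ "\<lambda>x. H1 x + H2 x"]) blast
  qed
  then show ?thesis by blast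
qed


text \<open>The points \<open>0\<close> and \<open>1\<close> are added to the frontier so that the continuous minorants
  agree at the two ends of the period.\<close>

lemma indicator_trig_approx:
  fixes D :: "real set"
  assumes D: "frontier D \<in> null_sets lebesgue"
  shows "D \<in> sets lebesgue" "trig_approx (\<lambda>x. of_bool (x \<in> D)) 1"
proof -
  define F where "F = frontier D \<union> {0, 1}"
  have negF: "negligible F" unfolding F_def using D
    by (intro negligible_Un) (auto simp: negligible_iff_null_sets negligible_finite)
  have clF: "closed F" unfolding F_def by (intro closed_Un) auto
  have neF: "F \<noteq> {}" by (auto simp: F_def)
  have "D = interior D \<union> (D \<inter> frontier D)"
    using interior_subset closure_subset by (auto simp: frontier_def)
  moreover have "negligible (D \<inter> frontier D)"
    using D negligible_subset[of "frontier D"] by (simp add: negligible_iff_null_sets)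
  then have "D \<inter> frontier D \<in> sets lebesgue" by (rule negligible_imp_sets)
  moreover have "interior D \<in> sets lebesgue" by simp
  ultimately show Dm: "D \<in> sets lebesgue" by (metis sets.Un)
  \<comment> \<open>The indicator of D is tapered to 0 within distance 1/n of F, and
    \<open>H n\<close> is a tent of the same width around F. As n grows the tents tend pointwise to
    the indicator of the null set F, so their integrals tend to 0.\<close>
  define \<gamma> where "\<gamma> = (\<lambda>n x. if x \<in> D then min 1 (real n * infdist x F) else 0)"
  define H where "H = (\<lambda>n x. max 0 (1 - real n * infdist x F))"
  have Hcont: "continuous_on A (H n)" for n A unfolding H_def by (intro continuous_intros)
  have \<gamma>cont: "continuous_on UNIV (\<gamma> n)" for n
  proof (rule continuous_at_imp_continuous_on, intro ballI)
    fix x :: real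
    consider "x \<in> interior D" | "x \<in> interior (- D)" | "x \<in> F"
      by (auto simp: F_def frontier_def interior_complement)
    then show "isCont (\<gamma> n) x"
    proof cases
      case 1
      have "continuous_on (interior D) (\<lambda>x. min 1 (real n * infdist x F))" by (intro continuous_intros)
      moreover have "\<gamma> n y = min 1 (real n * infdist y F)" if "y \<in> interior D" for y
        using that interior_subset by (auto simp: \<gamma>_def)
      ultimately have "continuous_on (interior D) (\<gamma> n)" by (metis (mono_tags, lifting) continuous_on_cong)
      then show ?thesis using 1 by (simp add: continuous_on_eq_continuous_at)
    next
      case 2
      have "continuous_on (interior (- D)) (\<lambda>x. 0 :: real)" by (intro continuous_intros)
      moreover have "\<gamma> n y = 0" if "y \<in> interior (- D)" for y
        using that interior_subset by (auto simp: \<gamma>_def)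
      ultimately have "continuous_on (interior (- D)) (\<gamma> n)" by (metis (mono_tags, lifting) continuous_on_cong)
      then show ?thesis using 2 by (simp add: continuous_on_eq_continuous_at)
    next
      case 3
      then have d0: "infdist x F = 0" by simp
      have "((\<lambda>y. real n * infdist y F) \<longlongrightarrow> real n * infdist x F) (at x)"
        by (intro tendsto_intros)
      then have "((\<lambda>y. real n * infdist y F) \<longlongrightarrow> 0) (at x)" by (simp add: d0)
      then have "(\<gamma> n \<longlongrightarrow> 0) (at x)"
        by (rule Lim_null_comparison[rotated])
          (auto simp: \<gamma>_def infdist_nonneg intro!: always_eventually)
      moreover have "\<gamma> n x = 0" using d0 by (simp add: \<gamma>_def)
      ultimately show ?thesis by (simp add: isCont_def)
    qed
  qed
  have H01: "0 \<le> H n x" "H n x \<le> 1" for n x by (auto simp: H_def infdist_nonneg)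
  have "(\<lambda>n. \<integral>x. H n x \<partial>M01) \<longlonglongrightarrow> (\<integral>x. indicator F x \<partial>M01)"
  proof (rule integral_dominated_convergence[where w="\<lambda>_. 1"])
    show "(indicator F :: real \<Rightarrow> real) \<in> borel_measurable M01"
      using clF by (intro M01_measurable_borel borel_measurable_indicator) auto
    show "AE x in M01. (\<lambda>n. H n x) \<longlonglongrightarrow> indicator F x"
    proof (rule AE_I2)
      fix x
      show "(\<lambda>n. H n x) \<longlonglongrightarrow> indicator F x"
      proof (cases "x \<in> F")
        case True then show ?thesis by (simp add: H_def)
      next
        case False
        then have d: "infdist x F > 0"
          using in_closed_iff_infdist_zero[OF clF neF] infdist_nonneg[of x F] by (metis less_eq_real_def)
        have "\<forall>\<^sub>F n in sequentially. H n x = 0"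
        proof (rule eventually_sequentiallyI[of "nat \<lceil>1 / infdist x F\<rceil>"])
          fix n assume "nat \<lceil>1 / infdist x F\<rceil> \<le> n"
          then have "1 / infdist x F \<le> real n" by linarith
          then have "1 \<le> real n * infdist x F" using d by (simp add: divide_le_eq)
          then show "H n x = 0" by (simp add: H_def)
        qed
        then show ?thesis using False by (simp add: tendsto_eventually)
      qed
    qed
  qed (use H01 Hcont in \<open>auto intro!: M01_measurable_cont\<close>)
  moreover have "(\<integral>x. indicator F x \<partial>M01) = (0::real)"
  proof -
    have "(\<integral>x. indicator F x \<partial>M01) = measure M01 (F \<inter> space M01)"
      by (rule Bochner_Integration.integral_indicator)
    also have "\<dots> = measure lebesgue (F \<inter> {0..1})" by (subst measure_restrict_space) auto
    also have "\<dots> = 0"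
      using negligible_subset[OF negF, of "F \<inter> {0..1}"] by (simp add: negligible_imp_measure0)
    finally show ?thesis .
  qed
  ultimately have lim: "(\<lambda>n. \<integral>x. H n x \<partial>M01) \<longlonglongrightarrow> 0" by simp
  show "trig_approx (\<lambda>x. of_bool (x \<in> D)) 1"
  proof (rule trig_approxI)
    have "(\<lambda>x. of_bool (x \<in> D)) = (indicator D :: real \<Rightarrow> complex)" by (auto simp: indicator_def)
    then show "(\<lambda>x. of_bool (x \<in> D) :: complex) \<in> borel_measurable M01"
      using Dm by (simp only:) (intro measurable_restrict_space1 borel_measurable_indicator)
  next
    fix \<epsilon> :: real assume \<epsilon>: "\<epsilon> > 0"
    then obtain n where n: "(\<integral>x. H n x \<partial>M01) < \<epsilon>"
      using order_tendstoD(2)[OF lim \<epsilon>] by (auto simp: eventually_sequentially)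
    have F01: "infdist 0 F = 0" "infdist 1 F = 0" by (auto simp: F_def)
    have "continuous_on {0..1} (\<lambda>x. complex_of_real (\<gamma> n x))"
      using continuous_on_subset[OF \<gamma>cont] by (intro continuous_intros) auto
    moreover have "complex_of_real (\<gamma> n 0) = complex_of_real (\<gamma> n 1)" by (simp add: \<gamma>_def F01)
    moreover have "cmod (complex_of_real (\<gamma> n x)) \<le> 1 \<and> cmod (of_bool (x \<in> D) - complex_of_real (\<gamma> n x)) \<le> H n x" for x
    proof (cases "x \<in> D")
      case True
      have nn: "0 \<le> real n * infdist x F" by (simp add: infdist_nonneg)
      have "cmod (1 - complex_of_real (min 1 (real n * infdist x F))) = \<bar>1 - min 1 (real n * infdist x F)\<bar>"
        by (metis norm_of_real of_real_1 of_real_diff)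
      then show ?thesis using True nn by (auto simp: \<gamma>_def H_def)
    next
      case False then show ?thesis using H01 by (simp add: \<gamma>_def)
    qed
    moreover have "integrable M01 (H n)" by (intro M01_integrable_cont Hcont)
    moreover have "\<forall>\<^sub>F M in sequentially. (\<Sum>j<M. H n (real j / real M)) \<le> \<epsilon> * real M"
      by (rule riemann_sum_upper[OF Hcont _ n]) (simp add: H_def F01)
    ultimately show "\<exists>\<gamma> H. continuous_on {0..1} \<gamma> \<and> \<gamma> 0 = \<gamma> 1 \<and>
      (\<forall>x\<in>{0..1}. cmod (\<gamma> x) \<le> 1 \<and> cmod (of_bool (x \<in> D) - \<gamma> x) \<le> H x) \<and> integrable M01 H \<and> (\<integral>x. H x \<partial>M01) < \<epsilon> \<and>
      (\<forall>\<^sub>F M in sequentially. (\<Sum>j<M. H (real j / real M)) \<le> \<epsilon> * real M)"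
      using n by (intro exI[of _ "\<lambda>x. complex_of_real (\<gamma> n x)"] exI[of _ "H n"]) simp
  qed simp
qed

section \<open>Square-integrable limits\<close>

lemma measurable_e [measurable]: "e \<in> borel_measurable borel"
  by (intro borel_measurable_continuous_onI continuous_on_e continuous_on_id)

interpretation unifT: prob_space unifT
  unfolding unifT_def by (rule prob_space_uniform_measure) auto

lemma sets_unifT [measurable_cong, simp]: "sets unifT = sets borel"
  and space_unifT [simp]: "space unifT = UNIV"
  by (simp_all add: unifT_def)

lemma nn_integral_unifT:
  assumes "f \<in> borel_measurable borel"
  shows "(\<integral>\<^sup>+x. f x \<partial>unifT) = (\<integral>\<^sup>+x\<in>{0..1}. f x \<partial>lborel)"
  unfolding unifT_def using assms by (subst nn_integral_uniform_measure) (auto simp: divide_ennreal_def)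

lemma nn_integral_unifT_cont:
  fixes h :: "real \<Rightarrow> real"
  assumes "continuous_on UNIV h" "\<And>x. h x \<ge> 0"
  shows "(\<integral>\<^sup>+x. ennreal (h x) \<partial>unifT) = ennreal (\<integral>x. h x \<partial>M01)"
proof -
  have m: "h \<in> borel_measurable borel" using assms(1) by (rule borel_measurable_continuous_onI)
  have "compact (h ` {0..1})"
    using continuous_on_subset[OF assms(1)] by (intro compact_continuous_image) auto
  then obtain B where "\<forall>y\<in>h ` {0..1}. norm y \<le> B" using compact_imp_bounded bounded_iff by metis
  then have B: "\<And>x. x \<in> {0..1} \<Longrightarrow> norm (h x) \<le> B" by blast
  have "AE x in unifT. x \<in> {0..1}"
    unfolding unifT_def by (rule AE_uniform_measureI) auto
  then have "integrable unifT h"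
    using m B by (intro unifT.integrable_const_bound[of _ B]) auto
  then have "(\<integral>\<^sup>+x. ennreal (h x) \<partial>unifT) = ennreal (\<integral>x. h x \<partial>unifT)"
    using assms(2) by (intro nn_integral_eq_integral) auto
  then show ?thesis by (simp add: integral_unifT[OF m])
qed

text \<open>\<open>L2_lim\<close> is a choice, so its properties depend on existence. Along a
  subsequence with tails below (1/4)^j the partial sums converge almost everywhere; Fatou's lemma
  shows that their pointwise limit is the limit in mean square of the whole sequence.\<close>

lemma L2_lim_exists:
  fixes b :: "int \<Rightarrow> complex" and K :: "nat \<Rightarrow> int set"
  assumes fin: "\<And>M. finite (K M)" and mono: "\<And>M M'. M \<le> M' \<Longrightarrow> K M \<subseteq> K M'"
    and bnd: "\<And>M. (\<Sum>n\<in>K M. (cmod (b n))\<^sup>2) \<le> C"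
  shows "\<exists>g. g \<in> borel_measurable lborel \<and>
    ((\<lambda>M. \<integral>\<^sup>+ x\<in>{0..1}. ennreal ((cmod ((\<Sum>n\<in>K M. b n * e (real_of_int (n\<^sup>2) * x)) - g x))\<^sup>2) \<partial>lborel) \<longlongrightarrow> 0) sequentially"
proof -
  define s where "s = (\<lambda>M x. \<Sum>n\<in>K M. b n * e (real_of_int (n\<^sup>2) * x))"
  define v where "v = (\<lambda>M. \<Sum>n\<in>K M. (cmod (b n))\<^sup>2)"
  have scont: "continuous_on A (s M)" for A M unfolding s_def by (intro continuous_intros)
  have sm[measurable]: "s M \<in> borel_measurable borel" for M by (intro borel_measurable_continuous_onI scont)
  have v_mono: "v M \<le> v M'" if "M \<le> M'" for M M'
    unfolding v_def using mono[OF that] fin by (intro sum_mono2) auto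
  have "incseq v" by (simp add: mono_def v_mono)
  then obtain V where V: "v \<longlonglongrightarrow> V" and "\<forall>M. v M \<le> V"
    using incseq_convergent[of v C] bnd by (auto simp: v_def)
  then have vV: "v M \<le> V" for M by blast
  have dist_le1: "(\<integral>\<^sup>+x. ennreal ((cmod (s M' x - s M x))\<^sup>2) \<partial>unifT) \<le> ennreal (2 * \<bar>v M' - v M\<bar>)" if "M \<le> M'" for M M'
  proof -
    have diff: "s M' x - s M x = (\<Sum>n\<in>K M' - K M. b n * e (real_of_int (n\<^sup>2) * x))" for x
      unfolding s_def using mono[OF that] fin by (subst sum_diff) auto
    have "(\<integral>\<^sup>+x. ennreal ((cmod (s M' x - s M x))\<^sup>2) \<partial>unifT) = ennreal (\<integral>x. (cmod (s M' x - s M x))\<^sup>2 \<partial>M01)"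
      by (intro nn_integral_unifT_cont continuous_intros scont) auto
    also have "\<dots> \<le> ennreal (2 * (\<Sum>n\<in>K M' - K M. (cmod (b n))\<^sup>2))"
      unfolding diff using fin by (intro ennreal_leI exp_square_sum_norm_le) auto
    also have "(\<Sum>n\<in>K M' - K M. (cmod (b n))\<^sup>2) = v M' - v M"
      unfolding v_def using mono[OF that] fin by (subst sum_diff) auto
    finally show ?thesis using v_mono[OF that] by simp
  qed
  have dist_le: "(\<integral>\<^sup>+x. ennreal ((cmod (s M x - s M' x))\<^sup>2) \<partial>unifT) \<le> ennreal (2 * \<bar>v M - v M'\<bar>)" for M M'
    using dist_le1[of M M'] dist_le1[of M' M] by (cases "M \<le> M'") (auto simp: norm_minus_commute abs_minus_commute)
  have "\<exists>M. V - v M < (1/4) ^ j" for j :: nat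
  proof -
    have "((\<lambda>M. V - v M) \<longlongrightarrow> V - V) sequentially" by (intro tendsto_intros V)
    then have "\<forall>\<^sub>F M in sequentially. V - v M < (1/4) ^ j" by (rule order_tendstoD) simp
    then show ?thesis by (auto simp: eventually_sequentially)
  qed
  then obtain r where r: "\<And>j. V - v (r j) < (1/4) ^ j" by metis
  have vr: "(\<lambda>j. v (r j)) \<longlonglongrightarrow> V"
  proof (rule tendsto_sandwich)
    show "\<forall>\<^sub>F j in sequentially. V - (1/4) ^ j \<le> v (r j)" using r by (intro always_eventually allI) (simp add: less_imp_le algebra_simps)
    have "(\<lambda>j. V - (1/4::real) ^ j) \<longlonglongrightarrow> V - 0" by (intro tendsto_intros LIMSEQ_power_zero) simp
    then show "(\<lambda>j. V - (1/4::real) ^ j) \<longlonglongrightarrow> V" by simp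
  qed (use vV in auto)
  define d where "d = (\<lambda>j x. s (r (Suc j)) x - s (r j) x)"
  have d_int: "(\<integral>\<^sup>+x. ennreal (2 ^ j * (cmod (d j x))\<^sup>2) \<partial>unifT) \<le> ennreal (2 * (1/2) ^ j)" for j
  proof -
    have "\<bar>v (r (Suc j)) - v (r j)\<bar> \<le> (1/4) ^ j"
      using r[of j] r[of "Suc j"] vV[of "r j"] vV[of "r (Suc j)"] power_decreasing[of j "Suc j" "1/4::real"]
      by (simp add: abs_le_iff)
    then have "2 ^ j * (2 * \<bar>v (r (Suc j)) - v (r j)\<bar>) \<le> 2 ^ j * (2 * (1/4) ^ j)"
      by (intro mult_left_mono) auto
    also have "\<dots> = 2 * (1/2) ^ j"
      using power_mult_distrib[of 2 "1/4::real" j] by simp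
    finally have *: "2 ^ j * (2 * \<bar>v (r (Suc j)) - v (r j)\<bar>) \<le> 2 * (1/2) ^ j" .
    have "(\<integral>\<^sup>+x. ennreal (2 ^ j * (cmod (d j x))\<^sup>2) \<partial>unifT) = ennreal (2 ^ j) * (\<integral>\<^sup>+x. ennreal ((cmod (d j x))\<^sup>2) \<partial>unifT)"
      by (subst nn_integral_cmult[symmetric]) (auto simp: d_def ennreal_mult')
    also have "\<dots> \<le> ennreal (2 ^ j) * ennreal (2 * \<bar>v (r (Suc j)) - v (r j)\<bar>)"
      unfolding d_def by (intro mult_left_mono dist_le) auto
    also have "\<dots> \<le> ennreal (2 * (1/2) ^ j)" using * by (simp add: ennreal_mult'[symmetric] ennreal_leI)
    finally show ?thesis .
  qed
  have "(\<integral>\<^sup>+x. (\<Sum>j. ennreal (2 ^ j * (cmod (d j x))\<^sup>2)) \<partial>unifT) = (\<Sum>j. \<integral>\<^sup>+x. ennreal (2 ^ j * (cmod (d j x))\<^sup>2) \<partial>unifT)"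
    by (rule nn_integral_suminf) (auto simp: d_def)
  also have "\<dots> \<le> (\<Sum>j. ennreal (2 * (1/2) ^ j))" by (intro suminf_le d_int) auto
  also have "\<dots> = ennreal (\<Sum>j. 2 * (1/2) ^ j)" by (rule suminf_ennreal2) (auto intro!: summable_mult summable_geometric)
  finally have "(\<integral>\<^sup>+x. (\<Sum>j. ennreal (2 ^ j * (cmod (d j x))\<^sup>2)) \<partial>unifT) \<noteq> \<infinity>" by (auto simp: top_unique)
  then have "AE x in unifT. (\<Sum>j. ennreal (2 ^ j * (cmod (d j x))\<^sup>2)) \<noteq> \<infinity>"
    unfolding d_def by (intro nn_integral_PInf_AE) measurable
  then have conv: "AE x in unifT. convergent (\<lambda>j. s (r j) x)"
  proof eventually_elim
    case (elim x)
    have sm2: "summable (\<lambda>j. 2 ^ j * (cmod (d j x))\<^sup>2)"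
      using elim by (intro summable_suminf_not_top) auto
    \<comment> \<open>An increment is either at most (1/2)^j or at most 2^j times its square, so
      this series dominates the increments.\<close>
    have "summable (\<lambda>j. (1/2) ^ j + 2 ^ j * (cmod (d j x))\<^sup>2)"
      using sm2 by (intro summable_add summable_geometric) auto
    then have "summable (\<lambda>j. cmod (d j x))"
    proof (rule summable_comparison_test[rotated], intro exI allI impI)
      fix j :: nat
      show "norm (cmod (d j x)) \<le> (1/2) ^ j + 2 ^ j * (cmod (d j x))\<^sup>2"
      proof (cases "cmod (d j x) \<le> (1/2) ^ j")
        case False
        then have "1 \<le> 2 ^ j * cmod (d j x)" by (simp add: power_divide field_simps)
        then have "1 * cmod (d j x) \<le> (2 ^ j * cmod (d j x)) * cmod (d j x)" by (intro mult_right_mono) auto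
        moreover have "0 \<le> (1/2::real) ^ j" by simp
        ultimately show ?thesis by (simp add: power2_eq_square mult.assoc add_increasing)
      qed (simp add: add_increasing2)
    qed
    then have "summable (\<lambda>j. d j x)" by (rule summable_norm_cancel)
    then have "convergent (\<lambda>j. s (r 0) x + (\<Sum>i<j. d i x))"
      by (intro convergent_add convergent_const) (simp add: summable_iff_convergent)
    moreover have "s (r 0) x + (\<Sum>i<j. d i x) = s (r j) x" for j
      unfolding d_def by (simp add: sum_lessThan_telescope[of "\<lambda>j. s (r j) x"])
    ultimately show ?case by simp
  qed
  define g where "g = (\<lambda>x. lim (\<lambda>j. s (r j) x))"
  have gm[measurable]: "g \<in> borel_measurable borel" unfolding g_def by measurable
  have bound: "(\<integral>\<^sup>+x. ennreal ((cmod (s M x - g x))\<^sup>2) \<partial>unifT) \<le> ennreal (2 * \<bar>v M - V\<bar>)" for M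
  proof -
    have "AE x in unifT. ennreal ((cmod (s M x - g x))\<^sup>2) = liminf (\<lambda>j. ennreal ((cmod (s M x - s (r j) x))\<^sup>2))"
      using conv
    proof eventually_elim
      case (elim x)
      then have "(\<lambda>j. s (r j) x) \<longlonglongrightarrow> g x" by (simp add: g_def convergent_LIMSEQ_iff)
      then have "(\<lambda>j. ennreal ((cmod (s M x - s (r j) x))\<^sup>2)) \<longlonglongrightarrow> ennreal ((cmod (s M x - g x))\<^sup>2)"
        by (intro tendsto_intros)
      from lim_imp_Liminf[OF trivial_limit_sequentially this] show ?case by (rule sym)
    qed
    then have "(\<integral>\<^sup>+x. ennreal ((cmod (s M x - g x))\<^sup>2) \<partial>unifT) =
       (\<integral>\<^sup>+x. liminf (\<lambda>j. ennreal ((cmod (s M x - s (r j) x))\<^sup>2)) \<partial>unifT)" by (rule nn_integral_cong_AE)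
    also have "\<dots> \<le> liminf (\<lambda>j. \<integral>\<^sup>+x. ennreal ((cmod (s M x - s (r j) x))\<^sup>2) \<partial>unifT)"
      by (rule nn_integral_liminf) auto
    also have "\<dots> \<le> liminf (\<lambda>j. ennreal (2 * \<bar>v M - v (r j)\<bar>))"
      by (intro Liminf_mono always_eventually allI dist_le)
    also have "\<dots> = ennreal (2 * \<bar>v M - V\<bar>)"
      by (intro lim_imp_Liminf tendsto_intros vr) auto
    finally show ?thesis .
  qed
  have "(\<lambda>M. \<integral>\<^sup>+x. ennreal ((cmod (s M x - g x))\<^sup>2) \<partial>unifT) \<longlonglongrightarrow> 0"
  proof (rule tendsto_sandwich[OF _ _ tendsto_const])
    have "(\<lambda>M. ennreal (2 * \<bar>v M - V\<bar>)) \<longlonglongrightarrow> ennreal (2 * \<bar>V - V\<bar>)" by (intro tendsto_intros V)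
    then show "(\<lambda>M. ennreal (2 * \<bar>v M - V\<bar>)) \<longlonglongrightarrow> 0" by simp
  qed (use bound in auto)
  moreover have "(\<integral>\<^sup>+x. ennreal ((cmod (s M x - g x))\<^sup>2) \<partial>unifT) = (\<integral>\<^sup>+x\<in>{0..1}. ennreal ((cmod (s M x - g x))\<^sup>2) \<partial>lborel)" for M
    by (rule nn_integral_unifT) measurable
  ultimately show ?thesis unfolding s_def using gm by (intro exI[of _ g]) auto
qed

lemma L2_lim_properties:
  fixes b :: "int \<Rightarrow> complex" and K :: "nat \<Rightarrow> int set"
  assumes "\<And>M. finite (K M)" "\<And>M M'. M \<le> M' \<Longrightarrow> K M \<subseteq> K M'" "\<And>M. (\<Sum>n\<in>K M. (cmod (b n))\<^sup>2) \<le> C"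
  defines "G \<equiv> L2_lim (\<lambda>M x. \<Sum>n\<in>K M. b n * e (real_of_int (n\<^sup>2) * x))"
  shows "G \<in> borel_measurable borel"
    "(\<lambda>M. \<integral>\<^sup>+ x. ennreal ((cmod ((\<Sum>n\<in>K M. b n * e (real_of_int (n\<^sup>2) * x)) - G x))\<^sup>2) \<partial>unifT) \<longlonglongrightarrow> 0"
proof -
  let ?s = "\<lambda>M x. \<Sum>n\<in>K M. b n * e (real_of_int (n\<^sup>2) * x)"
  have *: "G \<in> borel_measurable lborel \<and> ((\<lambda>M. \<integral>\<^sup>+ x\<in>{0..1}. ennreal ((cmod (?s M x - G x))\<^sup>2) \<partial>lborel) \<longlongrightarrow> 0) sequentially"
    using someI_ex[OF L2_lim_exists[of K b C, OF assms(1-3)]] unfolding G_def L2_lim_def .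
  then show Gm: "G \<in> borel_measurable borel" by simp
  have sm: "?s M \<in> borel_measurable borel" for M
    by (intro borel_measurable_continuous_onI continuous_intros)
  have "(\<integral>\<^sup>+x. ennreal ((cmod (?s M x - G x))\<^sup>2) \<partial>unifT) = (\<integral>\<^sup>+x\<in>{0..1}. ennreal ((cmod (?s M x - G x))\<^sup>2) \<partial>lborel)" for M
    using Gm sm by (intro nn_integral_unifT) measurable
  then show "(\<lambda>M. \<integral>\<^sup>+ x. ennreal ((cmod (?s M x - G x))\<^sup>2) \<partial>unifT) \<longlonglongrightarrow> 0"
    using * by (simp only:)
qed

text \<open>The factor 2 comes from (a + b)^2 \<le> 2 a^2 + 2 b^2 with \<open>s M\<close> as
  intermediate point; the term measuring the distance of \<open>s M\<close> from its limit
  disappears as M grows.\<close>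

lemma L2_lim_dist_le:
  fixes s :: "nat \<Rightarrow> real \<Rightarrow> complex"
  assumes G: "G \<in> borel_measurable borel" and s: "\<And>M. continuous_on UNIV (s M)" and h: "continuous_on UNIV h"
    and lim: "(\<lambda>M. \<integral>\<^sup>+ x. ennreal ((cmod (s M x - G x))\<^sup>2) \<partial>unifT) \<longlonglongrightarrow> 0"
    and dist: "\<forall>\<^sub>F M in sequentially. (\<integral>x. (cmod (s M x - h x))\<^sup>2 \<partial>M01) \<le> \<delta>"
  shows "integrable unifT (\<lambda>x. (cmod (G x - h x))\<^sup>2)" "(\<integral>x. (cmod (G x - h x))\<^sup>2 \<partial>unifT) \<le> 2 * \<delta>"
proof -
  have [measurable]: "s M \<in> borel_measurable borel" "h \<in> borel_measurable borel" for M
    using s h by (auto intro: borel_measurable_continuous_onI)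
  note G[measurable]
  let ?I = "\<integral>\<^sup>+x. ennreal ((cmod (G x - h x))\<^sup>2) \<partial>unifT"
  have \<delta>: "\<delta> \<ge> 0"
  proof -
    obtain M where "(\<integral>x. (cmod (s M x - h x))\<^sup>2 \<partial>M01) \<le> \<delta>" using dist by (auto simp: eventually_sequentially)
    moreover have "0 \<le> (\<integral>x. (cmod (s M x - h x))\<^sup>2 \<partial>M01)" by (intro Bochner_Integration.integral_nonneg) auto
    ultimately show ?thesis by linarith
  qed
  have "\<forall>\<^sub>F M in sequentially. ?I \<le> 2 * (\<integral>\<^sup>+ x. ennreal ((cmod (s M x - G x))\<^sup>2) \<partial>unifT) + 2 * ennreal \<delta>"
    using dist
  proof eventually_elim
    case (elim M)
    have "?I \<le> (\<integral>\<^sup>+x. 2 * ennreal ((cmod (s M x - G x))\<^sup>2) + 2 * ennreal ((cmod (s M x - h x))\<^sup>2) \<partial>unifT)"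
    proof (intro nn_integral_mono)
      fix x
      have "cmod (G x - h x) \<le> cmod (s M x - G x) + cmod (s M x - h x)"
        using norm_triangle_ineq[of "G x - s M x" "s M x - h x"] by (simp add: norm_minus_commute)
      then have "(cmod (G x - h x))\<^sup>2 \<le> (cmod (s M x - G x) + cmod (s M x - h x))\<^sup>2" by (intro power_mono) auto
      also have "\<dots> \<le> 2 * (cmod (s M x - G x))\<^sup>2 + 2 * (cmod (s M x - h x))\<^sup>2"
        using zero_le_power2[of "cmod (s M x - G x) - cmod (s M x - h x)"] by (simp add: power2_sum power2_diff)
      finally have "ennreal ((cmod (G x - h x))\<^sup>2) \<le> ennreal (2 * (cmod (s M x - G x))\<^sup>2 + 2 * (cmod (s M x - h x))\<^sup>2)"
        by (rule ennreal_leI)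
      then show "ennreal ((cmod (G x - h x))\<^sup>2) \<le> 2 * ennreal ((cmod (s M x - G x))\<^sup>2) + 2 * ennreal ((cmod (s M x - h x))\<^sup>2)"
        by (simp add: ennreal_mult')
    qed
    also have "\<dots> = 2 * (\<integral>\<^sup>+ x. ennreal ((cmod (s M x - G x))\<^sup>2) \<partial>unifT) + 2 * (\<integral>\<^sup>+ x. ennreal ((cmod (s M x - h x))\<^sup>2) \<partial>unifT)"
      by (subst nn_integral_add) (auto simp: nn_integral_cmult)
    also have "(\<integral>\<^sup>+ x. ennreal ((cmod (s M x - h x))\<^sup>2) \<partial>unifT) = ennreal (\<integral>x. (cmod (s M x - h x))\<^sup>2 \<partial>M01)"
      using s h by (intro nn_integral_unifT_cont continuous_intros) auto
    also have "\<dots> \<le> ennreal \<delta>" using elim by (rule ennreal_leI)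
    finally show ?case by (simp add: add_left_mono mult_left_mono)
  qed
  moreover have "(\<lambda>M. 2 * (\<integral>\<^sup>+ x. ennreal ((cmod (s M x - G x))\<^sup>2) \<partial>unifT) + 2 * ennreal \<delta>) \<longlonglongrightarrow> 2 * 0 + 2 * ennreal \<delta>"
    by (intro tendsto_intros lim ennreal_tendsto_cmult) auto
  ultimately have "?I \<le> 2 * 0 + 2 * ennreal \<delta>"
    by (intro tendsto_lowerbound[of _ _ sequentially]) auto
  also have "\<dots> = ennreal (2 * \<delta>)" using \<delta> by (simp add: ennreal_mult')
  finally have I: "?I \<le> ennreal (2 * \<delta>)" .
  then have "?I < \<infinity>" by (auto simp: less_top[symmetric] top_unique)
  then show int: "integrable unifT (\<lambda>x. (cmod (G x - h x))\<^sup>2)"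
    by (intro integrableI_nonneg) auto
  have "ennreal (\<integral>x. (cmod (G x - h x))\<^sup>2 \<partial>unifT) = ?I" using int by (intro nn_integral_eq_integral[symmetric]) auto
  then have "ennreal (\<integral>x. (cmod (G x - h x))\<^sup>2 \<partial>unifT) \<le> ennreal (2 * \<delta>)" using I by (simp only:)
  then show "(\<integral>x. (cmod (G x - h x))\<^sup>2 \<partial>unifT) \<le> 2 * \<delta>"
    using \<delta> by (subst (asm) ennreal_le_iff) auto
qed

section \<open>Equidistribution\<close>

lemma eventually_through: "eventually P (through Q) \<longleftrightarrow> (\<exists>q0. \<forall>q\<ge>q0. q \<in> Q \<longrightarrow> P q)"
  by (simp add: through_def eventually_inf_principal eventually_at_top_linorder)

text \<open>Uniform continuity is available only on a disc; for large a and for distant a and b the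
  boundedness of f is used instead. Quadratic error terms are chosen because mean squares are what
  can be controlled, both for Gauss sums and for the limit.\<close>

lemma bounded_continuous_modulus:
  fixes f :: "complex \<Rightarrow> real"
  assumes f: "continuous_on UNIV f" "\<And>z. \<bar>f z\<bar> \<le> B" and \<eta>: "\<eta> > 0"
  shows "\<exists>C\<ge>0. \<forall>a b. \<bar>f a - f b\<bar> \<le> \<eta> + \<eta> * (cmod a)\<^sup>2 + C * (cmod (a - b))\<^sup>2"
proof -
  have B0: "B \<ge> 0" using f(2)[of 0] by linarith
  \<comment> \<open>For |a| > R the term \<eta> |a|^2 is at least the oscillation 2 B. The point b
    may lie up to d \<le> 1 further out than a, hence the disc of radius R + 1 below.\<close>
  define R where "R = sqrt (2 * B / \<eta>) + 1"
  have R: "R \<ge> 0" "2 * B \<le> \<eta> * R\<^sup>2"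
  proof -
    show "R \<ge> 0" using B0 \<eta> by (simp add: R_def)
    have "2 * B / \<eta> = (sqrt (2 * B / \<eta>))\<^sup>2" using B0 \<eta> by simp
    also have "\<dots> \<le> R\<^sup>2" using B0 \<eta> by (intro power_mono) (auto simp: R_def)
    finally show "2 * B \<le> \<eta> * R\<^sup>2" using \<eta> by (simp add: field_simps)
  qed
  have "uniformly_continuous_on (cball 0 (R + 1)) f"
    using continuous_on_subset[OF f(1)] by (intro compact_uniformly_continuous) auto
  then obtain \<delta> where \<delta>: "\<delta> > 0" "\<And>a b. a \<in> cball 0 (R + 1) \<Longrightarrow> b \<in> cball 0 (R + 1) \<Longrightarrow> dist b a < \<delta> \<Longrightarrow> dist (f b) (f a) < \<eta>"
    unfolding uniformly_continuous_on_def using \<eta> by metis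
  define d where "d = min \<delta> 1"
  have d: "d > 0" "d \<le> \<delta>" "d \<le> 1" using \<delta>(1) by (auto simp: d_def)
  show ?thesis
  proof (intro exI[of _ "2 * B / d\<^sup>2"] conjI allI)
    show "0 \<le> 2 * B / d\<^sup>2" using B0 by simp
    fix a b
    have le2B: "\<bar>f a - f b\<bar> \<le> 2 * B" using f(2)[of a] f(2)[of b] by linarith
    have nn: "0 \<le> \<eta> * (cmod a)\<^sup>2" "0 \<le> 2 * B / d\<^sup>2 * (cmod (a - b))\<^sup>2" using \<eta> B0 by auto
    consider "cmod a > R" | "cmod (a - b) \<ge> d" | "cmod a \<le> R" "cmod (a - b) < d" by linarith
    then show "\<bar>f a - f b\<bar> \<le> \<eta> + \<eta> * (cmod a)\<^sup>2 + 2 * B / d\<^sup>2 * (cmod (a - b))\<^sup>2"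
    proof cases
      case 1
      then have "R\<^sup>2 \<le> (cmod a)\<^sup>2" using R(1) by (intro power_mono) auto
      then have "\<eta> * R\<^sup>2 \<le> \<eta> * (cmod a)\<^sup>2" using \<eta> by (intro mult_left_mono) auto
      then show ?thesis using le2B R(2) nn \<eta> by linarith
    next
      case 2
      then have "d\<^sup>2 \<le> (cmod (a - b))\<^sup>2" using d by (intro power_mono) auto
      then have "2 * B / d\<^sup>2 * d\<^sup>2 \<le> 2 * B / d\<^sup>2 * (cmod (a - b))\<^sup>2" using B0 by (intro mult_left_mono) auto
      then have "2 * B \<le> 2 * B / d\<^sup>2 * (cmod (a - b))\<^sup>2" using d by simp
      then show ?thesis using le2B nn \<eta> by linarith
    next
      case 3
      have "cmod b \<le> R + 1" using 3 d norm_triangle_sub[of b a] by (simp add: norm_minus_commute)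
      then have "dist (f a) (f b) < \<eta>" using 3 d by (intro \<delta>(2)) (auto simp: dist_norm)
      then have "\<bar>f a - f b\<bar> < \<eta>" by (simp add: dist_real_def)
      then show ?thesis using nn by linarith
    qed
  qed
qed

lemma fcoeff_diff:
  assumes f: "f \<in> borel_measurable M01" "\<And>x. x \<in> {0..1} \<Longrightarrow> cmod (f x) \<le> B"
    and g: "g \<in> borel_measurable M01" "\<And>x. x \<in> {0..1} \<Longrightarrow> cmod (g x) \<le> B'"
  shows "fcoeff (\<lambda>x. f x - g x) k = fcoeff f k - fcoeff g k"
proof -
  have em: "(\<lambda>x. cnj (e (real_of_int k * x))) \<in> borel_measurable M01"
    by (intro M01_measurable_cont continuous_intros)
  have i: "integrable M01 (\<lambda>x. f x * cnj (e (real_of_int k * x)))"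
    by (rule M01_integrable_bounded[of _ B]) (use f em in \<open>auto simp: norm_mult\<close>)
  have j: "integrable M01 (\<lambda>x. g x * cnj (e (real_of_int k * x)))"
    by (rule M01_integrable_bounded[of _ B']) (use g em in \<open>auto simp: norm_mult\<close>)
  have fg: "cmod (f x - g x) \<le> B + B'" if "x \<in> {0..1}" for x
    using norm_triangle_ineq4[of "f x" "g x"] f(2)[OF that] g(2)[OF that] by linarith
  have "fcoeff (\<lambda>x. f x - g x) k = (\<integral>x. (f x - g x) * cnj (e (real_of_int k * x)) \<partial>M01)"
    using f(1) g(1) fg by (intro fcoeff_eq_M01[of _ "B + B'"]) auto
  also have "\<dots> = fcoeff f k - fcoeff g k"
    using Bochner_Integration.integral_diff[OF i j] fcoeff_eq_M01[OF f, of k] fcoeff_eq_M01[OF g, of k]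
    by (simp add: left_diff_distrib)
  finally show ?thesis .
qed

lemma tendsto_linear_bound:
  fixes f :: "'a \<Rightarrow> 'b::real_normed_vector"
  assumes "K \<ge> 0" "\<And>\<delta>. \<delta> > 0 \<Longrightarrow> \<forall>\<^sub>F x in F. norm (f x - L) \<le> K * \<delta>"
  shows "(f \<longlongrightarrow> L) F"
proof (rule tendstoI)
  fix \<epsilon> :: real assume \<epsilon>: "\<epsilon> > 0"
  have "\<epsilon> / (K + 1) > 0" using \<epsilon> assms(1) by simp
  then have "\<forall>\<^sub>F x in F. norm (f x - L) \<le> K * (\<epsilon> / (K + 1))" by (rule assms(2))
  moreover have "K * (\<epsilon> / (K + 1)) < \<epsilon>" using \<epsilon> assms(1) by (simp add: field_simps)
  ultimately show "\<forall>\<^sub>F x in F. dist (f x) L < \<epsilon>"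
    by (auto simp: dist_norm elim!: eventually_mono)
qed

lemma trig_frac: "trig S a (frac y) = trig S a y"
proof -
  have "e (real_of_int k * frac y) = e (real_of_int k * y)" for k
    using e_add_int[of "real_of_int k * frac y" "k * \<lfloor>y\<rfloor>"] by (simp add: frac_def algebra_simps)
  then show ?thesis by (simp add: trig_def)
qed

section \<open>Equidistribution along one family of moduli\<close>

context moduli_class
begin

text \<open>The point is not reduced modulo 1; functions are evaluated at it only if they are
  invariant under \<open>frac\<close>.\<close>

definition pt :: "nat \<Rightarrow> int \<Rightarrow> real" where
  "pt q x = real_of_int (t q * minv q x) / real q"

text \<open>The limit function attached to a trigonometric polynomial; at the points
  \<open>pt q x\<close> it equals the ratio of Gauss sums exactly, by
  \<open>gw_trig_ratio\<close>.\<close>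

definition gtrig :: "int set \<Rightarrow> (int \<Rightarrow> complex) \<Rightarrow> real \<Rightarrow> complex" where
  "gtrig S a y = (\<Sum>k\<in>{k \<in> S. c dvd k \<and> k div c \<in> J}. a k * e (real_of_int ((k div c)\<^sup>2) * y))"

text \<open>Common form of the three limits: \<open>Gplus\<close> for c = 2 and all n,
  \<open>Gfull\<close> for c = 1 and all n, \<open>Gminus\<close> for c = 1 and odd n.\<close>

definition Glim :: "(real \<Rightarrow> complex) \<Rightarrow> real \<Rightarrow> complex" where
  "Glim \<phi> = L2_lim (\<lambda>M x. \<Sum>n\<in>{n \<in> {- int M..int M}. n \<in> J}. fcoeff \<phi> (c * n) * e (real_of_int (n\<^sup>2) * x))"

lemma \<nu>_nonzero: "q \<in> Q \<Longrightarrow> coprime x (int q) \<Longrightarrow> \<nu> q x \<noteq> 0"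
  using norm_\<nu>[of q x] Q[of q] by auto

lemma continuous_on_gtrig: "continuous_on A (gtrig S a)"
  unfolding gtrig_def by (intro continuous_intros)

lemma gtrig_frac: "gtrig S a (frac y) = gtrig S a y"
proof -
  have "e (real_of_int k * frac y) = e (real_of_int k * y)" for k
    using e_add_int[of "real_of_int k * frac y" "k * \<lfloor>y\<rfloor>"] by (simp add: frac_def algebra_simps)
  then show ?thesis by (simp add: gtrig_def del: of_int_power)
qed

lemma gw_trig_ratio:
  assumes "q \<in> Q" "coprime x (int q)" "finite S"
  shows "gw (trig S a) q x / \<nu> q x = gtrig S a (pt q x)"
proof -
  have "gw (trig S a) q x / \<nu> q x = (\<Sum>k\<in>S. if c dvd k \<and> k div c \<in> J then a k * ez q (t q * minv q x * (k div c)\<^sup>2) else 0)"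
    unfolding gw_trig sum_divide_distrib
    using \<nu>_nonzero[OF assms(1,2)] by (intro sum.cong refl) (simp add: gs_formula[OF assms(1,2)])
  also have "\<dots> = (\<Sum>k\<in>{k \<in> S. c dvd k \<and> k div c \<in> J}. a k * ez q (t q * minv q x * (k div c)\<^sup>2))"
    using assms(3) by (simp add: sum.inter_filter)
  also have "\<dots> = gtrig S a (pt q x)"
    unfolding gtrig_def by (intro sum.cong refl) (simp add: ez_def pt_def mult_ac)
  finally show ?thesis .
qed

text \<open>The sum is enlarged from units to all residues. One factor N comes from the divisor
  count in \<open>mean_square_gsum_le\<close>, the other from returning to units by q \<le>
  \<open>N * totient q\<close>.\<close>

lemma mean_square_ratio_le:
  assumes q: "q \<in> Q" and R: "R \<ge> 0"
    "\<And>M. M > 0 \<Longrightarrow> q \<le> M\<^sup>2 \<Longrightarrow> (\<Sum>j<M. (cmod (f (real j / real M)))\<^sup>2) \<le> R * real M"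
  shows "(\<Sum>x\<in>units_mod q. (cmod (gw f q x / \<nu> q x))\<^sup>2) \<le> 2 * (real N)\<^sup>2 * R * real (totient q)"
proof -
  have q0: "q > 0" and d: "num_divisors q \<le> N" using Q[OF q] by auto
  have "(\<Sum>x\<in>units_mod q. (cmod (gw f q x / \<nu> q x))\<^sup>2) \<le> (\<Sum>x\<in>units_mod q. (cmod (gw f q x))\<^sup>2 / real q)"
  proof (intro sum_mono)
    fix x assume "x \<in> units_mod q"
    then have "(cmod (\<nu> q x))\<^sup>2 \<ge> real q" using norm_\<nu>[OF q] by (simp add: units_mod_def)
    moreover from this q0 have "0 < (cmod (\<nu> q x))\<^sup>2 * real q" by (intro mult_pos_pos) linarith+
    ultimately show "(cmod (gw f q x / \<nu> q x))\<^sup>2 \<le> (cmod (gw f q x))\<^sup>2 / real q"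
      unfolding norm_divide power_divide by (intro divide_left_mono) auto
  qed
  also have "\<dots> \<le> (\<Sum>x\<in>{0..<int q}. (cmod (gw f q x))\<^sup>2 / real q)"
    by (intro sum_mono2) (auto simp: units_mod_def)
  also have "\<dots> = (\<Sum>x\<in>{0..<int q}. (cmod (gw f q x))\<^sup>2) / real q"
    by (simp add: sum_divide_distrib)
  also have "\<dots> \<le> (2 * real (num_divisors q) * (real q)\<^sup>2 * R) / real q"
    unfolding gw_def by (intro divide_right_mono mean_square_gsum_le q0 R(2)) auto
  also have "\<dots> = 2 * R * real (num_divisors q) * real q" using q0 by (simp add: power2_eq_square)
  also have "\<dots> \<le> 2 * R * real N * (real N * real (totient q))"
  proof (intro mult_mono)
    have "q \<le> N * totient q" using le_num_divisors_totient[OF q0] d by (meson mult_le_mono1 order_trans)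
    then show "real q \<le> real N * real (totient q)" by (metis of_nat_le_iff of_nat_mult)
  qed (use R d in auto)
  finally show ?thesis by (simp add: power2_eq_square mult_ac)
qed

text \<open>Bessel's inequality is applied to \<phi> minus the polynomial. Of the factor 4, one 2 is
  due to n and -n sharing a square and the other to the passage to the limit.\<close>

lemma Glim_properties:
  assumes \<phi>: "\<phi> \<in> borel_measurable M01" "\<And>x. x \<in> {0..1} \<Longrightarrow> cmod (\<phi> x) \<le> B" and S: "finite S"
  shows "Glim \<phi> \<in> borel_measurable borel"
    "integrable unifT (\<lambda>x. (cmod (Glim \<phi> x - gtrig S a x))\<^sup>2)"
    "(\<integral>x. (cmod (Glim \<phi> x - gtrig S a x))\<^sup>2 \<partial>unifT) \<le> 4 * (\<integral>x. (cmod (\<phi> x - trig S a x))\<^sup>2 \<partial>M01)"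
proof -
  define K where "K = (\<lambda>M::nat. {n \<in> {- int M..int M}. n \<in> J})"
  define b where "b = (\<lambda>n. fcoeff \<phi> (c * n))"
  define s where "s = (\<lambda>M x. \<Sum>n\<in>K M. b n * e (real_of_int (n\<^sup>2) * x))"
  have G: "Glim \<phi> = L2_lim s" by (simp add: Glim_def s_def K_def b_def)
  have fin: "finite (K M)" for M unfolding K_def by (rule finite_subset[of _ "{- int M..int M}"]) auto
  have mono: "M \<le> M' \<Longrightarrow> K M \<subseteq> K M'" for M M' by (auto simp: K_def)
  have inj: "inj_on (\<lambda>n. c * n) A" for A using c_pos by (auto intro!: inj_onI)
  have bessel: "(\<Sum>n\<in>K M. (cmod (fcoeff f (c * n)))\<^sup>2) \<le> (\<integral>x. (cmod (f x))\<^sup>2 \<partial>M01)"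
    if "f \<in> borel_measurable M01" "\<And>x. x \<in> {0..1} \<Longrightarrow> cmod (f x) \<le> B'" for f B' M
  proof -
    have "(\<Sum>n\<in>K M. (cmod (fcoeff f (c * n)))\<^sup>2) = (\<Sum>k\<in>(\<lambda>n. c * n) ` K M. (cmod (fcoeff f k))\<^sup>2)"
      by (simp add: sum.reindex[OF inj])
    also have "\<dots> \<le> (\<integral>x. (cmod (f x))\<^sup>2 \<partial>M01)" using fin that by (intro bessel_inequality[of _ B']) auto
    finally show ?thesis .
  qed
  have L: "L2_lim s \<in> borel_measurable borel" "(\<lambda>M. \<integral>\<^sup>+ x. ennreal ((cmod (s M x - L2_lim s x))\<^sup>2) \<partial>unifT) \<longlonglongrightarrow> 0"
    unfolding s_def b_def by (rule L2_lim_properties[OF fin mono bessel[OF \<phi>]]; assumption)+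
  then show Gm: "Glim \<phi> \<in> borel_measurable borel" by (simp add: G)
  have tm: "trig S a \<in> borel_measurable M01" by (intro M01_measurable_cont continuous_intros)
  define f where "f = (\<lambda>x. \<phi> x - trig S a x)"
  have fm: "f \<in> borel_measurable M01" unfolding f_def using \<phi>(1) tm by (rule borel_measurable_diff)
  have fB: "cmod (f x) \<le> B + (\<Sum>k\<in>S. cmod (a k))" if "x \<in> {0..1}" for x
    unfolding f_def using norm_triangle_ineq4[of "\<phi> x" "trig S a x"] \<phi>(2)[OF that] norm_trig_le[of S a x] by linarith
  have fc: "fcoeff f k = fcoeff \<phi> k - (if k \<in> S then a k else 0)" for k
    unfolding f_def fcoeff_trig[OF S, symmetric] using norm_trig_le
    by (intro fcoeff_diff[OF \<phi> tm]) auto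
  \<comment> \<open>Large enough that from \<open>M0\<close> on all surviving frequencies of the
    polynomial lie in \<open>K M\<close>; the difference is then a single sum of Fourier
    coefficients of f.\<close>
  define M0 where "M0 = nat (\<Sum>k\<in>S. \<bar>k div c\<bar>)"
  have "s M x - gtrig S a x = (\<Sum>n\<in>K M. fcoeff f (c * n) * e (real_of_int (n\<^sup>2) * x))" if M: "M \<ge> M0" for M x
  proof -
    have KM: "k div c \<in> K M" if "k \<in> S" "k div c \<in> J" for k
    proof -
      have "\<bar>k div c\<bar> \<le> (\<Sum>k\<in>S. \<bar>k div c\<bar>)" using S that by (intro member_le_sum) auto
      then have "\<bar>k div c\<bar> \<le> int M" using M unfolding M0_def by linarith
      then show ?thesis using that by (auto simp: K_def)
    qed
    have "gtrig S a x = (\<Sum>n\<in>{n \<in> K M. c * n \<in> S}. a (c * n) * e (real_of_int (n\<^sup>2) * x))"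
      unfolding gtrig_def
      by (rule sum.reindex_bij_witness[of _ "\<lambda>n. c * n" "\<lambda>k. k div c"]) (use c_pos KM in \<open>auto simp: K_def\<close>)
    also have "\<dots> = (\<Sum>n\<in>K M. (if c * n \<in> S then a (c * n) else 0) * e (real_of_int (n\<^sup>2) * x))"
      by (simp add: sum.inter_filter[OF fin] if_distrib[of "\<lambda>y. y * _"] cong: if_cong)
    finally show ?thesis by (simp add: s_def b_def fc left_diff_distrib sum_subtractf)
  qed
  then have "\<forall>\<^sub>F M in sequentially. (\<integral>x. (cmod (s M x - gtrig S a x))\<^sup>2 \<partial>M01) \<le> 2 * (\<integral>x. (cmod (f x))\<^sup>2 \<partial>M01)"
  proof (intro eventually_sequentiallyI[of M0])
    fix M assume M: "M0 \<le> M"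
    assume *: "\<And>M x. M \<ge> M0 \<Longrightarrow> s M x - gtrig S a x = (\<Sum>n\<in>K M. fcoeff f (c * n) * e (real_of_int (n\<^sup>2) * x))"
    show "(\<integral>x. (cmod (s M x - gtrig S a x))\<^sup>2 \<partial>M01) \<le> 2 * (\<integral>x. (cmod (f x))\<^sup>2 \<partial>M01)"
      unfolding *[OF M] using bessel[OF fm fB, of M]
      by (intro order_trans[OF exp_square_sum_norm_le[OF fin]]) auto
  qed
  note D = L2_lim_dist_le[OF L(1) _ continuous_on_gtrig L(2) this]
  have sc: "continuous_on UNIV (s M)" for M unfolding s_def by (intro continuous_intros)
  show "integrable unifT (\<lambda>x. (cmod (Glim \<phi> x - gtrig S a x))\<^sup>2)"
    "(\<integral>x. (cmod (Glim \<phi> x - gtrig S a x))\<^sup>2 \<partial>unifT) \<le> 4 * (\<integral>x. (cmod (\<phi> x - trig S a x))\<^sup>2 \<partial>M01)"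
    using D[OF sc] by (auto simp: G f_def)
qed

text \<open>At the zero frequency the mean of the weight is exact. Otherwise k or l is nonzero, and
  the corresponding gcd with q is bounded independently of q.\<close>

lemma weyl_sum_limit:
  assumes w: "\<And>q. q \<in> Q \<Longrightarrow> square_invariant q (w q)"
    and mean: "\<And>q. q \<in> Q \<Longrightarrow> (\<Sum>x\<in>units_mod q. w q x) = \<mu> * of_nat (totient q)"
  shows "((\<lambda>q. kloosterman q (w q) k (l * t q) / of_nat (totient q)) \<longlongrightarrow> (if k = 0 \<and> l = 0 then \<mu> else 0)) (through Q)"
proof (cases "k = 0 \<and> l = 0")
  case True
  have "kloosterman q (w q) k (l * t q) / of_nat (totient q) = \<mu>" if "q \<in> Q" for q
    using True mean[OF that] Q[OF that] by (simp add: kloosterman_def)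
  then show ?thesis using True by (intro tendsto_eventually) (auto simp: eventually_through)
next
  case False
  define g where "g = max \<bar>k\<bar> (2 * \<bar>l\<bar>)"
  have g: "g > 0" using False by (auto simp: g_def)
  have "((\<lambda>q. kloosterman q (w q) k (l * t q) / of_nat (totient q)) \<longlongrightarrow> 0) (through Q)"
  proof (rule tendsto_linear_bound[of 1])
    fix \<delta> :: real assume \<delta>: "\<delta> > 0"
    obtain q0 where q0: "\<And>q w m n. q \<ge> q0 \<Longrightarrow> num_divisors q \<le> N \<Longrightarrow> square_invariant q w \<Longrightarrow>
       gcd m (int q) \<le> g \<or> gcd n (int q) \<le> g \<Longrightarrow> cmod (kloosterman q w m n) \<le> \<delta> * real (totient q)"
      using kloosterman_small[OF \<delta> g, of N] by blast
    have "cmod (kloosterman q (w q) k (l * t q) / of_nat (totient q) - 0) \<le> 1 * \<delta>" if q: "q \<in> Q" "q \<ge> q0" for q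
    proof -
      have qp: "q > 0" "num_divisors q \<le> N" using Q q by auto
      have "gcd k (int q) \<le> g \<or> gcd (l * t q) (int q) \<le> g"
      proof (cases "k = 0")
        case True
        then have "l \<noteq> 0" using False by simp
        then show ?thesis using gcd_t[OF q(1), of l] by (auto simp: g_def max_def)
      next
        case k: False
        then have "gcd k (int q) \<le> \<bar>k\<bar>" by (metis gcd_dvd1 dvd_imp_le_int abs_gcd_int)
        then show ?thesis by (auto simp: g_def max_def)
      qed
      then have "cmod (kloosterman q (w q) k (l * t q)) \<le> \<delta> * real (totient q)"
        using q0[OF q(2) qp(2) w[OF q(1)]] by blast
      then show ?thesis using qp by (simp add: norm_divide divide_le_eq)
    qed
    then show "\<forall>\<^sub>F q in through Q. cmod (kloosterman q (w q) k (l * t q) / of_nat (totient q) - 0) \<le> 1 * \<delta>"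
      unfolding eventually_through by blast
  qed simp
  then show ?thesis by (simp only: False if_False)
qed

text \<open>The roles of f and \<Phi> differ: f is evaluated at fractions x / q and may be
  discontinuous, its error being controlled by the Riemann sum clause of \<open>trig_approx\<close>;
  \<Phi> is approximated uniformly.\<close>

lemma equidistribution:
  assumes w: "\<And>q. q \<in> Q \<Longrightarrow> square_invariant q (w q)"
    and mean: "\<And>q. q \<in> Q \<Longrightarrow> (\<Sum>x\<in>units_mod q. w q x) = \<mu> * of_nat (totient q)"
    and f: "trig_approx f B"
    and \<Phi>: "continuous_on {0..1} \<Phi>" "\<And>y. \<Phi> (frac y) = \<Phi> y"
  shows "((\<lambda>q. (\<Sum>x\<in>units_mod q. w q x * (f (real_of_int x / real q) * \<Phi> (pt q x))) / of_nat (totient q)) \<longlongrightarrow>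
     \<mu> * ((\<integral>x. f x \<partial>M01) * (\<integral>y. \<Phi> y \<partial>M01))) (through Q)"
proof -
  have fm: "f \<in> borel_measurable M01" and fB: "\<And>x. x \<in> {0..1} \<Longrightarrow> cmod (f x) \<le> B"
    using f by (auto simp: trig_approx_def)
  have fi: "integrable M01 f" using fm fB by (rule M01_integrable_bounded)
  have \<Phi>i: "integrable M01 \<Phi>" using \<Phi>(1) by (rule M01_integrable_cont)
  have B0: "B \<ge> 0" using order_trans[OF norm_ge_zero fB[of 0]] by simp
  have "compact (\<Phi> ` {0..1})" using \<Phi>(1) by (intro compact_continuous_image) auto
  then obtain C where C': "\<forall>z\<in>\<Phi> ` {0..1}. cmod z \<le> C" using compact_imp_bounded bounded_iff by metis
  have C: "cmod (\<Phi> y) \<le> C" for y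
  proof -
    have "frac y \<in> {0..1}" using frac_lt_1[of y] frac_ge_0[of y] by simp
    then show ?thesis using C' \<Phi>(2)[of y] by (metis imageI)
  qed
  have C0: "C \<ge> 0" using C[of 0] norm_ge_zero[of "\<Phi> 0"] by linarith
  \<comment> \<open>The first two terms bound the error on the samples, from f and from \<Phi>; the
    1 is for the limit of the polynomial averages, and the last term for the error in the
    integrals.\<close>
  define K where "K = C * real N + (B + 1) + 1 + cmod \<mu> * (C + (B + 1))"
  show ?thesis
  proof (rule tendsto_linear_bound[of K])
    show "K \<ge> 0" using C0 B0 by (simp add: K_def)
    fix \<delta> :: real assume \<delta>: "\<delta> > 0"
    obtain S a H where S: "finite S" and SH: "\<forall>x\<in>{0..1}. cmod (trig S a x) \<le> B + 1 \<and> cmod (f x - trig S a x) \<le> H x"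
      and H: "integrable M01 H" "(\<integral>x. H x \<partial>M01) < \<delta>"
      and HR: "\<forall>\<^sub>F M in sequentially. (\<Sum>j<M. H (real j / real M)) \<le> \<delta> * real M"
      using f \<delta> unfolding trig_approx_def by blast
    have \<Phi>01: "\<Phi> 0 = \<Phi> 1" using \<Phi>(2)[of 1] by simp
    obtain T b where T: "finite T" and Tb: "\<forall>x\<in>{0..1}. cmod (\<Phi> x - trig T b x) < \<delta>"
      using trig_approx_continuous[OF \<Phi>(1) \<Phi>01 \<delta>] by blast
    have Tb': "cmod (\<Phi> y - trig T b y) \<le> \<delta>" for y
    proof -
      have "frac y \<in> {0..1}" using frac_lt_1[of y] frac_ge_0[of y] by simp
      then show ?thesis using bspec[OF Tb, of "frac y"] by (simp add: \<Phi>(2) trig_frac)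
    qed
    define A where "A = (\<lambda>q. (\<Sum>x\<in>units_mod q. w q x * (f (real_of_int x / real q) * \<Phi> (pt q x))) / of_nat (totient q))"
    define A' where "A' = (\<lambda>q. (\<Sum>x\<in>units_mod q. w q x * (trig S a (real_of_int x / real q) * trig T b (pt q x))) / of_nat (totient q))"
    define L where "L = \<mu> * ((\<integral>x. f x \<partial>M01) * (\<integral>y. \<Phi> y \<partial>M01))"
    define L' where "L' = \<mu> * ((\<integral>x. trig S a x \<partial>M01) * (\<integral>y. trig T b y \<partial>M01))"
    have A'_eq: "A' q = (\<Sum>k\<in>S. \<Sum>l\<in>T. a k * b l * (kloosterman q (w q) k (l * t q) / of_nat (totient q)))" for q
    proof -
      have "trig S a (real_of_int x / real q) * trig T b (pt q x) =
          (\<Sum>k\<in>S. \<Sum>l\<in>T. a k * b l * ez q (k * x + l * t q * minv q x))" for x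
        unfolding trig_def sum_product
        unfolding ez_add by (intro sum.cong refl) (simp add: ez_def pt_def mult_ac)
      then have "(\<Sum>x\<in>units_mod q. w q x * (trig S a (real_of_int x / real q) * trig T b (pt q x))) =
          (\<Sum>x\<in>units_mod q. \<Sum>k\<in>S. \<Sum>l\<in>T. a k * b l * (w q x * ez q (k * x + l * t q * minv q x)))"
        by (simp add: sum_distrib_left mult_ac)
      also have "\<dots> = (\<Sum>k\<in>S. \<Sum>l\<in>T. \<Sum>x\<in>units_mod q. a k * b l * (w q x * ez q (k * x + l * t q * minv q x)))"
        by (subst sum.swap) (intro sum.cong refl sum.swap)
      also have "\<dots> = (\<Sum>k\<in>S. \<Sum>l\<in>T. a k * b l * kloosterman q (w q) k (l * t q))"
        by (simp add: kloosterman_def sum_distrib_left)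
      finally have eq: "(\<Sum>x\<in>units_mod q. w q x * (trig S a (real_of_int x / real q) * trig T b (pt q x))) =
          (\<Sum>k\<in>S. \<Sum>l\<in>T. a k * b l * kloosterman q (w q) k (l * t q))" .
      show ?thesis unfolding A'_def eq by (simp add: sum_divide_distrib)
    qed
    have "(A' \<longlongrightarrow> (\<Sum>k\<in>S. \<Sum>l\<in>T. a k * b l * (if k = 0 \<and> l = 0 then \<mu> else 0))) (through Q)"
      unfolding A'_eq by (intro tendsto_sum tendsto_mult tendsto_const weyl_sum_limit w mean)
    also have "(\<Sum>k\<in>S. \<Sum>l\<in>T. a k * b l * (if k = 0 \<and> l = 0 then \<mu> else 0)) =
        (\<Sum>k\<in>S. \<Sum>l\<in>T. (if k = 0 then a k else 0) * (if l = 0 then b l else 0) * \<mu>)"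
      by (intro sum.cong refl) auto
    also have "\<dots> = L'"
      using S T by (simp add: L'_def integral_trig sum.delta flip: sum_product sum_distrib_right)
    finally have "(A' \<longlongrightarrow> L') (through Q)" .
    then have ev1: "\<forall>\<^sub>F q in through Q. cmod (A' q - L') < \<delta>" using \<delta> by (auto simp: tendsto_iff dist_norm)
    obtain M0 where M0: "\<And>M. M \<ge> M0 \<Longrightarrow> (\<Sum>j<M. H (real j / real M)) \<le> \<delta> * real M"
      using HR by (auto simp: eventually_sequentially)
    have H0: "H x \<ge> 0" if "x \<in> {0..1}" for x
      using bspec[OF SH that] norm_ge_zero[of "f x - trig S a x"] by linarith
    have AA': "cmod (A q - A' q) \<le> (C * real N + (B + 1)) * \<delta>" if q: "q \<in> Q" "q \<ge> M0" for q
    proof -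
      have qp: "q > 0" "num_divisors q \<le> N" using Q q by auto
      let ?\<phi> = "real (totient q)"
      have \<phi>0: "?\<phi> > 0" using qp by simp
      have "q \<le> N * totient q" using le_num_divisors_totient[OF qp(1)] qp(2) by (meson mult_le_mono1 order_trans)
      then have qN: "real q \<le> real N * ?\<phi>" by (metis of_nat_le_iff of_nat_mult)
      have x01: "real_of_int x / real q \<in> {0..1}" if "x \<in> units_mod q" for x
        using that qp by (auto simp: units_mod_def)
      have "cmod ((A q - A' q) * of_nat (totient q)) = cmod (\<Sum>x\<in>units_mod q. w q x *
          (f (real_of_int x / real q) * \<Phi> (pt q x) - trig S a (real_of_int x / real q) * trig T b (pt q x)))"
        using \<phi>0 by (simp add: A_def A'_def diff_divide_distrib[symmetric] right_diff_distrib sum_subtractf)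
      also have "\<dots> \<le> (\<Sum>x\<in>units_mod q. C * H (real_of_int x / real q) + (B + 1) * \<delta>)"
      proof (rule sum_norm_le)
        fix x assume x: "x \<in> units_mod q"
        let ?y = "real_of_int x / real q"
        have "f ?y * \<Phi> (pt q x) - trig S a ?y * trig T b (pt q x) =
           (f ?y - trig S a ?y) * \<Phi> (pt q x) + trig S a ?y * (\<Phi> (pt q x) - trig T b (pt q x))" by (simp add: algebra_simps)
        then have "cmod (f ?y * \<Phi> (pt q x) - trig S a ?y * trig T b (pt q x)) \<le>
          cmod (f ?y - trig S a ?y) * cmod (\<Phi> (pt q x)) + cmod (trig S a ?y) * cmod (\<Phi> (pt q x) - trig T b (pt q x))"
          by (metis norm_triangle_ineq norm_mult)
        also have "\<dots> \<le> H ?y * C + (B + 1) * \<delta>"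
          using bspec[OF SH x01[OF x]] C Tb' B0 H0[OF x01[OF x]] by (intro add_mono mult_mono) auto
        finally have 1: "cmod (f ?y * \<Phi> (pt q x) - trig S a ?y * trig T b (pt q x)) \<le> H ?y * C + (B + 1) * \<delta>" .
        have "cmod (w q x) \<le> 1" using w[OF q(1)] by (simp add: square_invariant_def)
        then have "cmod (w q x) * cmod (f ?y * \<Phi> (pt q x) - trig S a ?y * trig T b (pt q x)) \<le> 1 * (H ?y * C + (B + 1) * \<delta>)"
          using 1 by (intro mult_mono) auto
        then show "cmod (w q x * (f ?y * \<Phi> (pt q x) - trig S a ?y * trig T b (pt q x))) \<le> C * H ?y + (B + 1) * \<delta>"
          by (simp add: norm_mult mult.commute)
      qed
      also have "\<dots> = C * (\<Sum>x\<in>units_mod q. H (real_of_int x / real q)) + (B + 1) * \<delta> * ?\<phi>"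
        using qp by (simp add: sum.distrib sum_distrib_left card_units_mod)
      \<comment> \<open>The majorant is nonnegative, so the sum may run over all fractions j / q,
        where its Riemann sums are controlled. Division by the number of units then costs a factor
        N.\<close>
      also have "(\<Sum>x\<in>units_mod q. H (real_of_int x / real q)) \<le> (\<Sum>x\<in>{0..<int q}. H (real_of_int x / real q))"
        using qp by (intro sum_mono2 H0) (auto simp: units_mod_def)
      also have "(\<Sum>x\<in>{0..<int q}. H (real_of_int x / real q)) = (\<Sum>j<q. H (real j / real q))"
        by (rule sum.reindex_bij_witness[of _ int nat]) auto
      also have "\<dots> \<le> \<delta> * real q" using M0 q by blast
      also have "\<dots> \<le> \<delta> * (real N * ?\<phi>)" using qN \<delta> by (intro mult_left_mono) auto
      finally have "cmod ((A q - A' q) * of_nat (totient q)) \<le> C * (\<delta> * (real N * ?\<phi>)) + (B + 1) * \<delta> * ?\<phi>"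
        using C0 by (simp add: mult_left_mono)
      then have "cmod (A q - A' q) * ?\<phi> \<le> ((C * real N + (B + 1)) * \<delta>) * ?\<phi>"
        unfolding norm_mult norm_of_nat by (simp add: algebra_simps)
      then show ?thesis using \<phi>0 by (simp only: mult_le_cancel_right_pos)
    qed
    have ti: "integrable M01 (trig S a)" "integrable M01 (trig T b)"
      by (intro M01_integrable_cont continuous_intros)+
    have LL': "cmod (L' - L) \<le> cmod \<mu> * (C + (B + 1)) * \<delta>"
    proof -
      have 1: "cmod ((\<integral>x. f x \<partial>M01) - (\<integral>x. trig S a x \<partial>M01)) \<le> \<delta>"
      proof -
        have "cmod ((\<integral>x. f x \<partial>M01) - (\<integral>x. trig S a x \<partial>M01)) = cmod (\<integral>x. f x - trig S a x \<partial>M01)"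
          using fi ti by simp
        also have "\<dots> \<le> (\<integral>x. cmod (f x - trig S a x) \<partial>M01)" by (rule integral_norm_bound)
        also have "\<dots> \<le> (\<integral>x. H x \<partial>M01)" using fi ti H SH by (intro integral_mono) auto
        finally show ?thesis using H(2) by linarith
      qed
      have 2: "cmod ((\<integral>x. \<Phi> x \<partial>M01) - (\<integral>x. trig T b x \<partial>M01)) \<le> \<delta>"
      proof -
        have "cmod ((\<integral>x. \<Phi> x \<partial>M01) - (\<integral>x. trig T b x \<partial>M01)) = cmod (\<integral>x. \<Phi> x - trig T b x \<partial>M01)"
          using \<Phi>i ti by simp
        also have "\<dots> \<le> (\<integral>x. cmod (\<Phi> x - trig T b x) \<partial>M01)" by (rule integral_norm_bound)
        also have "\<dots> \<le> (\<integral>x. \<delta> \<partial>M01)" using \<Phi>i ti Tb' by (intro integral_mono) auto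
        finally show ?thesis using M01.prob_space by simp
      qed
      have 3: "cmod (\<integral>x. \<Phi> x \<partial>M01) \<le> C"
      proof -
        have "cmod (\<integral>x. \<Phi> x \<partial>M01) \<le> (\<integral>x. cmod (\<Phi> x) \<partial>M01)" by (rule integral_norm_bound)
        also have "\<dots> \<le> (\<integral>x. C \<partial>M01)" using \<Phi>i C by (intro integral_mono) auto
        finally show ?thesis using M01.prob_space by simp
      qed
      have 4: "cmod (\<integral>x. trig S a x \<partial>M01) \<le> B + 1"
      proof -
        have "cmod (\<integral>x. trig S a x \<partial>M01) \<le> (\<integral>x. cmod (trig S a x) \<partial>M01)" by (rule integral_norm_bound)
        also have "\<dots> \<le> (\<integral>x. B + 1 \<partial>M01)" using ti SH by (intro integral_mono) auto
        finally show ?thesis using M01.prob_space by simp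
      qed
      have "L - L' = \<mu> * (((\<integral>x. f x \<partial>M01) - (\<integral>x. trig S a x \<partial>M01)) * (\<integral>x. \<Phi> x \<partial>M01) +
          (\<integral>x. trig S a x \<partial>M01) * ((\<integral>x. \<Phi> x \<partial>M01) - (\<integral>x. trig T b x \<partial>M01)))"
        by (simp add: L_def L'_def algebra_simps)
      also have "cmod \<dots> \<le> cmod \<mu> * (\<delta> * C + (B + 1) * \<delta>)"
        unfolding norm_mult using 1 2 3 4 \<delta> B0
        by (intro mult_left_mono order_trans[OF norm_triangle_ineq] add_mono) (auto simp: norm_mult intro!: mult_mono)
      finally show ?thesis by (simp add: norm_minus_commute algebra_simps)
    qed
    have "\<forall>\<^sub>F q in through Q. q \<in> Q \<and> q \<ge> M0" unfolding eventually_through by blast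
    then show "\<forall>\<^sub>F q in through Q. cmod (A q - L) \<le> K * \<delta>"
      using ev1
    proof eventually_elim
      case (elim q)
      have "cmod (A q - L) \<le> cmod (A q - A' q) + cmod (A' q - L') + cmod (L' - L)"
        using norm_triangle_ineq[of "A q - A' q" "A' q - L"] norm_triangle_ineq[of "A' q - L'" "L' - L"] by simp
      also have "\<dots> \<le> (C * real N + (B + 1)) * \<delta> + \<delta> + cmod \<mu> * (C + (B + 1)) * \<delta>"
        using AA' elim LL' by (intro add_mono) auto
      also have "\<dots> = K * \<delta>" by (simp add: K_def algebra_simps)
      finally show ?case .
    qed
  qed
qed

text \<open>Replacing \<phi> by a trigonometric polynomial is an error in mean square on both sides,
  by \<open>mean_square_ratio_le\<close> for the samples and by \<open>Glim_properties\<close> for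
  the limit. For the polynomial itself the claim is \<open>equidistribution\<close> with the
  composition of F and \<open>gtrig S a\<close> as test function.\<close>

lemma weighted_limit:
  fixes F :: "complex \<Rightarrow> real"
  assumes w: "\<And>q. q \<in> Q \<Longrightarrow> square_invariant q (w q)"
    and mean: "\<And>q. q \<in> Q \<Longrightarrow> (\<Sum>x\<in>units_mod q. w q x) = \<mu> * of_nat (totient q)"
    and f: "trig_approx f B" and \<phi>: "trig_approx \<phi> B'"
    and F: "continuous_on UNIV F" "\<And>z. \<bar>F z\<bar> \<le> BF"
  shows "((\<lambda>q. (\<Sum>x\<in>units_mod q. w q x * (f (real_of_int x / real q) * of_real (F (gw \<phi> q x / \<nu> q x)))) / of_nat (totient q)) \<longlongrightarrow>
     \<mu> * ((\<integral>x. f x \<partial>M01) * of_real (\<integral>y. F (Glim \<phi> y) \<partial>unifT))) (through Q)"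
proof -
  have fm: "f \<in> borel_measurable M01" and fB: "\<And>x. x \<in> {0..1} \<Longrightarrow> cmod (f x) \<le> B"
    using f by (auto simp: trig_approx_def)
  have fi: "integrable M01 f" using fm fB by (rule M01_integrable_bounded)
  have B0: "B \<ge> 0" using order_trans[OF norm_ge_zero fB[of 0]] by simp
  have \<phi>m: "\<phi> \<in> borel_measurable M01" and \<phi>B: "\<And>x. x \<in> {0..1} \<Longrightarrow> cmod (\<phi> x) \<le> B'"
    using \<phi> by (auto simp: trig_approx_def)
  have B'0: "B' \<ge> 0" using order_trans[OF norm_ge_zero \<phi>B[of 0]] by simp
  define n2 where "n2 = 2 * (real N)\<^sup>2"
  define K where "K = B * (1 + n2 * B'\<^sup>2 + n2 * (2 * B' + 1)) + 1 + cmod \<mu> * (B * (1 + 4 * B'\<^sup>2 + 4 * (2 * B' + 1)))"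
  have G0: "Glim \<phi> \<in> borel_measurable borel" "integrable unifT (\<lambda>x. (cmod (Glim \<phi> x))\<^sup>2)"
    "(\<integral>x. (cmod (Glim \<phi> x))\<^sup>2 \<partial>unifT) \<le> 4 * B'\<^sup>2"
  proof -
    note G = Glim_properties[OF \<phi>m \<phi>B, of "{}"]
    show "Glim \<phi> \<in> borel_measurable borel" by (rule G(1)) auto
    show "integrable unifT (\<lambda>x. (cmod (Glim \<phi> x))\<^sup>2)" using G(2) by (simp add: gtrig_def)
    have "(\<integral>x. (cmod (Glim \<phi> x))\<^sup>2 \<partial>unifT) \<le> 4 * (\<integral>x. (cmod (\<phi> x))\<^sup>2 \<partial>M01)"
      using G(3) by (simp add: gtrig_def trig_def)
    also have "(\<integral>x. (cmod (\<phi> x))\<^sup>2 \<partial>M01) \<le> (\<integral>x. B'\<^sup>2 \<partial>M01)"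
      using \<phi>m \<phi>B by (intro integral_mono M01_integrable_bounded[of _ "B'\<^sup>2"]) (auto intro!: power_mono)
    finally show "(\<integral>x. (cmod (Glim \<phi> x))\<^sup>2 \<partial>unifT) \<le> 4 * B'\<^sup>2" using M01.prob_space by simp
  qed
  note G0(1)[measurable]
  have Fm[measurable]: "F \<in> borel_measurable borel" using F(1) by (rule borel_measurable_continuous_onI)
  have FGi: "integrable unifT (\<lambda>y. F (Glim \<phi> y))"
    by (rule unifT.integrable_const_bound[of _ BF]) (use F(2) in auto)
  show ?thesis
  proof (rule tendsto_linear_bound[of K])
    show "K \<ge> 0" using B0 B'0 by (auto simp: K_def n2_def intro!: add_nonneg_nonneg mult_nonneg_nonneg)
    fix \<delta> :: real assume \<delta>: "\<delta> > 0"
    obtain C where C0: "C \<ge> 0" and C: "\<And>a b. \<bar>F a - F b\<bar> \<le> \<delta> + \<delta> * (cmod a)\<^sup>2 + C * (cmod (a - b))\<^sup>2"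
      using bounded_continuous_modulus[OF F \<delta>] by blast
    \<comment> \<open>The constant C of the modulus depends on \<delta>, so the quality of the
      approximation is fixed only after C, with C \<epsilon> \<le> \<delta>.\<close>
    define \<epsilon> where "\<epsilon> = \<delta> / (C + 1)"
    have \<epsilon>: "\<epsilon> > 0" using \<delta> C0 by (simp add: \<epsilon>_def)
    have C\<epsilon>: "C * \<epsilon> \<le> \<delta>" using \<delta> C0 by (simp add: \<epsilon>_def field_simps)
    obtain S a H where S: "finite S" and SH: "\<forall>x\<in>{0..1}. cmod (trig S a x) \<le> B' + 1 \<and> cmod (\<phi> x - trig S a x) \<le> H x"
      and H: "integrable M01 H" "(\<integral>x. H x \<partial>M01) < \<epsilon>"
      and HR: "\<forall>\<^sub>F M in sequentially. (\<Sum>j<M. H (real j / real M)) \<le> \<epsilon> * real M"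
      using \<phi> \<epsilon> unfolding trig_approx_def by blast
    obtain M0 where M0: "\<And>M. M \<ge> M0 \<Longrightarrow> (\<Sum>j<M. H (real j / real M)) \<le> \<epsilon> * real M"
      using HR by (auto simp: eventually_sequentially)
    \<comment> \<open>For a bounded error the square is at most a constant times the error itself,
      so smallness in mean gives smallness in mean square.\<close>
    have sqH: "(cmod (\<phi> x - trig S a x))\<^sup>2 \<le> (2 * B' + 1) * H x" if x: "x \<in> {0..1}" for x
    proof -
      have "cmod (\<phi> x - trig S a x) \<le> 2 * B' + 1"
        using norm_triangle_ineq4[of "\<phi> x" "trig S a x"] \<phi>B[OF x] bspec[OF SH x] by linarith
      then show ?thesis unfolding power2_eq_square using bspec[OF SH x] B'0 by (intro mult_mono) auto
    qed
    define \<Phi> where "\<Phi> = (\<lambda>y. complex_of_real (F (gtrig S a y)))"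
    have \<Phi>c: "continuous_on UNIV (\<lambda>y. F (gtrig S a y))"
      by (rule continuous_on_compose2[OF F(1) continuous_on_gtrig]) auto
    define A where "A = (\<lambda>q. (\<Sum>x\<in>units_mod q. w q x * (f (real_of_int x / real q) * of_real (F (gw \<phi> q x / \<nu> q x)))) / of_nat (totient q))"
    define A' where "A' = (\<lambda>q. (\<Sum>x\<in>units_mod q. w q x * (f (real_of_int x / real q) * \<Phi> (pt q x))) / of_nat (totient q))"
    define L where "L = \<mu> * ((\<integral>x. f x \<partial>M01) * of_real (\<integral>y. F (Glim \<phi> y) \<partial>unifT))"
    define L' where "L' = \<mu> * ((\<integral>x. f x \<partial>M01) * (\<integral>y. \<Phi> y \<partial>M01))"
    have "(A' \<longlongrightarrow> L') (through Q)"
      unfolding A'_def L'_def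
      by (rule equidistribution[OF w mean f])
        (auto simp: \<Phi>_def gtrig_frac intro!: continuous_intros continuous_on_subset[OF \<Phi>c])
    then have ev1: "\<forall>\<^sub>F q in through Q. cmod (A' q - L') < \<delta>" using \<delta> by (auto simp: tendsto_iff dist_norm)
    \<comment> \<open>The mean square estimate samples the error on M points with q \<le> M^2, so q
      \<ge> M0^2 is what guarantees M \<ge> M0.\<close>
    have AA': "cmod (A q - A' q) \<le> B * (1 + n2 * B'\<^sup>2 + n2 * (2 * B' + 1)) * \<delta>" if q: "q \<in> Q" "q \<ge> M0\<^sup>2" for q
    proof -
      have qp: "q > 0" using Q q by auto
      let ?\<phi> = "real (totient q)"
      have \<phi>0: "?\<phi> > 0" using qp by simp
      have x01: "real_of_int x / real q \<in> {0..1}" if "x \<in> units_mod q" for x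
        using that qp by (auto simp: units_mod_def)
      define W where "W = (\<lambda>x. gw \<phi> q x / \<nu> q x)"
      define W' where "W' = (\<lambda>x. gw (\<lambda>y. \<phi> y - trig S a y) q x / \<nu> q x)"
      have W': "W x - gtrig S a (pt q x) = W' x" if "x \<in> units_mod q" for x
        using that gw_trig_ratio[OF q(1) _ S, of x a]
        by (simp add: W_def W'_def gw_diff diff_divide_distrib units_mod_def)
      have s1: "(\<Sum>x\<in>units_mod q. (cmod (W x))\<^sup>2) \<le> n2 * B'\<^sup>2 * ?\<phi>"
        unfolding W_def n2_def
      proof (rule mean_square_ratio_le[OF q(1)])
        fix M :: nat assume "M > 0"
        then have "(cmod (\<phi> (real j / real M)))\<^sup>2 \<le> B'\<^sup>2" if "j < M" for j
          using that by (intro power_mono \<phi>B) auto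
        then have "(\<Sum>j<M. (cmod (\<phi> (real j / real M)))\<^sup>2) \<le> (\<Sum>j<M. B'\<^sup>2)" by (intro sum_mono) auto
        then show "(\<Sum>j<M. (cmod (\<phi> (real j / real M)))\<^sup>2) \<le> B'\<^sup>2 * real M" by (simp add: mult.commute)
      qed simp
      have s2: "(\<Sum>x\<in>units_mod q. (cmod (W' x))\<^sup>2) \<le> n2 * ((2 * B' + 1) * \<epsilon>) * ?\<phi>"
        unfolding W'_def n2_def
      proof (rule mean_square_ratio_le[OF q(1)])
        fix M :: nat assume M: "M > 0" "q \<le> M\<^sup>2"
        have "M0\<^sup>2 \<le> M\<^sup>2" using M(2) q(2) by linarith
        then have MM: "M0 \<le> M" by (simp add: power2_nat_le_eq_le)
        have "(\<Sum>j<M. (cmod (\<phi> (real j / real M) - trig S a (real j / real M)))\<^sup>2) \<le> (\<Sum>j<M. (2 * B' + 1) * H (real j / real M))"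
          using M(1) by (intro sum_mono sqH) auto
        also have "\<dots> = (2 * B' + 1) * (\<Sum>j<M. H (real j / real M))" by (simp add: sum_distrib_left)
        also have "\<dots> \<le> (2 * B' + 1) * (\<epsilon> * real M)" using M0[OF MM] B'0 by (intro mult_left_mono) auto
        finally show "(\<Sum>j<M. (cmod (\<phi> (real j / real M) - trig S a (real j / real M)))\<^sup>2) \<le> (2 * B' + 1) * \<epsilon> * real M"
          by (simp add: mult.assoc)
      qed (use B'0 \<epsilon> in auto)
      have "cmod ((A q - A' q) * of_nat (totient q)) = cmod (\<Sum>x\<in>units_mod q. w q x *
          (f (real_of_int x / real q) * of_real (F (W x) - F (gtrig S a (pt q x)))))"
        using \<phi>0 by (simp add: A_def A'_def W_def \<Phi>_def diff_divide_distrib[symmetric] right_diff_distrib sum_subtractf)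
      also have "\<dots> \<le> (\<Sum>x\<in>units_mod q. B * (\<delta> + \<delta> * (cmod (W x))\<^sup>2 + C * (cmod (W' x))\<^sup>2))"
      proof (rule sum_norm_le)
        fix x assume x: "x \<in> units_mod q"
        have 1: "cmod (w q x) \<le> 1" using w[OF q(1)] by (simp add: square_invariant_def)
        have 2: "cmod (f (real_of_int x / real q)) \<le> B" using fB x01[OF x] by blast
        have 3: "\<bar>F (W x) - F (gtrig S a (pt q x))\<bar> \<le> \<delta> + \<delta> * (cmod (W x))\<^sup>2 + C * (cmod (W' x))\<^sup>2"
          using C[of "W x" "gtrig S a (pt q x)"] W'[OF x] by simp
        have "cmod (w q x) * (cmod (f (real_of_int x / real q)) * \<bar>F (W x) - F (gtrig S a (pt q x))\<bar>) \<le>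
           1 * (B * (\<delta> + \<delta> * (cmod (W x))\<^sup>2 + C * (cmod (W' x))\<^sup>2))"
          using 1 2 3 B0 by (intro mult_mono) auto
        then show "cmod (w q x * (f (real_of_int x / real q) * of_real (F (W x) - F (gtrig S a (pt q x))))) \<le>
           B * (\<delta> + \<delta> * (cmod (W x))\<^sup>2 + C * (cmod (W' x))\<^sup>2)"
          by (simp only: norm_mult norm_of_real mult_1)
      qed
      also have "\<dots> = B * (\<delta> * ?\<phi> + \<delta> * (\<Sum>x\<in>units_mod q. (cmod (W x))\<^sup>2) + C * (\<Sum>x\<in>units_mod q. (cmod (W' x))\<^sup>2))"
        using qp by (simp add: sum.distrib card_units_mod mult.commute flip: sum_distrib_left)
      also have "\<dots> \<le> B * (\<delta> * ?\<phi> + \<delta> * (n2 * B'\<^sup>2 * ?\<phi>) + C * (n2 * ((2 * B' + 1) * \<epsilon>) * ?\<phi>))"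
        using s1 s2 B0 \<delta> C0 by (intro mult_left_mono add_mono) auto
      also have "\<dots> = B * (\<delta> + \<delta> * (n2 * B'\<^sup>2) + (C * \<epsilon>) * (n2 * (2 * B' + 1))) * ?\<phi>" by (simp add: algebra_simps)
      also have "\<dots> \<le> B * (\<delta> + \<delta> * (n2 * B'\<^sup>2) + \<delta> * (n2 * (2 * B' + 1))) * ?\<phi>"
        using C\<epsilon> B0 B'0 by (intro mult_right_mono mult_left_mono add_left_mono) (auto simp: n2_def)
      also have "\<dots> = B * (1 + n2 * B'\<^sup>2 + n2 * (2 * B' + 1)) * \<delta> * ?\<phi>" by (simp add: algebra_simps)
      finally have "cmod (A q - A' q) * ?\<phi> \<le> B * (1 + n2 * B'\<^sup>2 + n2 * (2 * B' + 1)) * \<delta> * ?\<phi>"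
        by (simp add: norm_mult)
      then show ?thesis using \<phi>0 by (simp only: mult_le_cancel_right_pos)
    qed
    have LL': "cmod (L' - L) \<le> cmod \<mu> * (B * (1 + 4 * B'\<^sup>2 + 4 * (2 * B' + 1))) * \<delta>"
    proof -
      note G = Glim_properties(2,3)[OF \<phi>m \<phi>B S, of a]
      have [measurable]: "gtrig S a \<in> borel_measurable borel"
        by (intro borel_measurable_continuous_onI continuous_on_gtrig)
      have Fgi: "integrable unifT (\<lambda>y. F (gtrig S a y))"
        by (rule unifT.integrable_const_bound[of _ BF]) (use F(2) in auto)
      have "(\<integral>y. \<Phi> y \<partial>M01) = of_real (\<integral>y. F (gtrig S a y) \<partial>M01)"
        unfolding \<Phi>_def by (rule integral_complex_of_real)
      also have "(\<integral>y. F (gtrig S a y) \<partial>M01) = (\<integral>y. F (gtrig S a y) \<partial>unifT)"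
        by (rule integral_unifT[symmetric]) measurable
      finally have \<Phi>eq: "(\<integral>y. \<Phi> y \<partial>M01) = of_real (\<integral>y. F (gtrig S a y) \<partial>unifT)" .
      have I: "(\<integral>x. (cmod (\<phi> x - trig S a x))\<^sup>2 \<partial>M01) \<le> (2 * B' + 1) * \<epsilon>"
      proof -
        have "(\<integral>x. (cmod (\<phi> x - trig S a x))\<^sup>2 \<partial>M01) \<le> (\<integral>x. (2 * B' + 1) * H x \<partial>M01)"
        proof (rule integral_mono)
          have "trig S a \<in> borel_measurable M01" by (intro M01_measurable_cont continuous_intros)
          then have "(\<lambda>x. (cmod (\<phi> x - trig S a x))\<^sup>2) \<in> borel_measurable M01" using \<phi>m by measurable
          moreover have "norm ((cmod (\<phi> x - trig S a x))\<^sup>2) \<le> (2 * B' + 1)\<^sup>2" if "x \<in> {0..1}" for x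
            using norm_triangle_ineq4[of "\<phi> x" "trig S a x"] \<phi>B[OF that] bspec[OF SH that]
            by (auto intro!: power_mono)
          ultimately show "integrable M01 (\<lambda>x. (cmod (\<phi> x - trig S a x))\<^sup>2)" by (rule M01_integrable_bounded)
        qed (use H(1) sqH in auto)
        also have "\<dots> = (2 * B' + 1) * (\<integral>x. H x \<partial>M01)" by simp
        also have "\<dots> \<le> (2 * B' + 1) * \<epsilon>" using H(2) B'0 by (intro mult_left_mono) auto
        finally show ?thesis .
      qed
      have "\<bar>(\<integral>y. F (Glim \<phi> y) \<partial>unifT) - (\<integral>y. F (gtrig S a y) \<partial>unifT)\<bar> = \<bar>\<integral>y. F (Glim \<phi> y) - F (gtrig S a y) \<partial>unifT\<bar>"
        using FGi Fgi by simp
      also have "\<dots> \<le> (\<integral>y. \<bar>F (Glim \<phi> y) - F (gtrig S a y)\<bar> \<partial>unifT)" by (rule integral_abs_bound)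
      also have "\<dots> \<le> (\<integral>y. \<delta> + \<delta> * (cmod (Glim \<phi> y))\<^sup>2 + C * (cmod (Glim \<phi> y - gtrig S a y))\<^sup>2 \<partial>unifT)"
        using FGi Fgi G0(2) G(1) C by (intro integral_mono) auto
      also have "\<dots> = \<delta> + \<delta> * (\<integral>y. (cmod (Glim \<phi> y))\<^sup>2 \<partial>unifT) + C * (\<integral>y. (cmod (Glim \<phi> y - gtrig S a y))\<^sup>2 \<partial>unifT)"
        using G0(2) G(1) unifT.prob_space by simp
      also have "\<dots> \<le> \<delta> + \<delta> * (4 * B'\<^sup>2) + C * (4 * ((2 * B' + 1) * \<epsilon>))"
        using G0(3) G(2) I \<delta> C0 by (intro add_mono mult_left_mono) auto
      also have "\<dots> = \<delta> + \<delta> * (4 * B'\<^sup>2) + (C * \<epsilon>) * (4 * (2 * B' + 1))" by simp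
      also have "\<dots> \<le> \<delta> + \<delta> * (4 * B'\<^sup>2) + \<delta> * (4 * (2 * B' + 1))"
        using C\<epsilon> B'0 by (intro add_left_mono mult_right_mono) auto
      finally have 1: "\<bar>(\<integral>y. F (Glim \<phi> y) \<partial>unifT) - (\<integral>y. F (gtrig S a y) \<partial>unifT)\<bar> \<le> (1 + 4 * B'\<^sup>2 + 4 * (2 * B' + 1)) * \<delta>"
        by (simp add: algebra_simps)
      have 2: "cmod (\<integral>x. f x \<partial>M01) \<le> B"
      proof -
        have "cmod (\<integral>x. f x \<partial>M01) \<le> (\<integral>x. cmod (f x) \<partial>M01)" by (rule integral_norm_bound)
        also have "\<dots> \<le> (\<integral>x. B \<partial>M01)" using fi fB by (intro integral_mono) auto
        finally show ?thesis using M01.prob_space by simp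
      qed
      have "L - L' = \<mu> * ((\<integral>x. f x \<partial>M01) * of_real ((\<integral>y. F (Glim \<phi> y) \<partial>unifT) - (\<integral>y. F (gtrig S a y) \<partial>unifT)))"
        by (simp add: L_def L'_def \<Phi>eq algebra_simps)
      also have "cmod \<dots> \<le> cmod \<mu> * (B * ((1 + 4 * B'\<^sup>2 + 4 * (2 * B' + 1)) * \<delta>))"
        unfolding norm_mult norm_of_real using 1 2 B0 by (intro mult_left_mono mult_mono) auto
      finally show ?thesis by (simp add: norm_minus_commute mult.assoc)
    qed
    have "\<forall>\<^sub>F q in through Q. q \<in> Q \<and> q \<ge> M0\<^sup>2" unfolding eventually_through by blast
    then show "\<forall>\<^sub>F q in through Q. cmod (A q - L) \<le> K * \<delta>"
      using ev1
    proof eventually_elim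
      case (elim q)
      have "cmod (A q - L) \<le> cmod (A q - A' q) + cmod (A' q - L') + cmod (L' - L)"
        using norm_triangle_ineq[of "A q - A' q" "A' q - L"] norm_triangle_ineq[of "A' q - L'" "L' - L"] by simp
      also have "\<dots> \<le> B * (1 + n2 * B'\<^sup>2 + n2 * (2 * B' + 1)) * \<delta> + \<delta> + cmod \<mu> * (B * (1 + 4 * B'\<^sup>2 + 4 * (2 * B' + 1))) * \<delta>"
        using AA' elim LL' by (intro add_mono) auto
      also have "\<dots> = K * \<delta>" by (simp add: K_def algebra_simps)
      finally show ?case .
    qed
  qed
qed

end

section \<open>Convergence in distribution\<close>

text \<open>For q > 1 neither 0 nor q is prime to q, so the representatives 1..q of
  \<open>adm\<close> and 0..q-1 of \<open>units_mod\<close> describe the same units, and the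
  fractional part is the fraction itself.\<close>

lemma adm_sum:
  fixes g :: "int \<Rightarrow> real"
  assumes "q > 1"
  shows "(\<Sum>p\<in>adm D q. g (int p)) = (\<Sum>x\<in>units_mod q. of_bool (real_of_int x / real q \<in> D) * g x)"
proof -
  have "(\<Sum>x\<in>units_mod q. of_bool (real_of_int x / real q \<in> D) * g x) =
      (\<Sum>x\<in>{x \<in> units_mod q. real_of_int x / real q \<in> D}. g x)"
    by (simp add: sum.inter_filter of_bool_def if_distrib[of "\<lambda>y. y * _"] cong: if_cong)
  also have "\<dots> = (\<Sum>p\<in>adm D q. g (int p))"
  proof (rule sum.reindex_bij_witness[of _ int nat])
    fix x assume x: "x \<in> {x \<in> units_mod q. real_of_int x / real q \<in> D}"
    then have x': "0 \<le> x" "x < int q" "coprime x (int q)" "real_of_int x / real q \<in> D" by (auto simp: units_mod_def)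
    have "x \<noteq> 0" using x' assms by (intro notI) simp
    moreover have "frac (real_of_int x / real q) = real_of_int x / real q"
      using x' assms by (intro frac_eq[THEN iffD2]) auto
    moreover have "coprime (nat x) q" using x'(1,3) by (metis coprime_int_iff int_nat_eq)
    ultimately show "nat x \<in> adm D q" using x' by (auto simp: adm_def)
    show "int (nat x) = x" "g (int (nat x)) = g x" using x'(1) by auto
  next
    fix p assume "p \<in> adm D q"
    then have p: "1 \<le> p" "p \<le> q" "coprime p q" "frac (real p / real q) \<in> D" by (auto simp: adm_def)
    have "p \<noteq> q" using p(3) assms by auto
    then have "p < q" using p(2) by simp
    moreover have "frac (real p / real q) = real p / real q"
      using \<open>p < q\<close> by (intro frac_eq[THEN iffD2]) auto
    ultimately show "int p \<in> {x \<in> units_mod q. real_of_int x / real q \<in> D}"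
      using p by (auto simp: units_mod_def)
  qed auto
  finally show ?thesis by simp
qed

lemma finite_adm [simp]: "finite (adm D q)"
  by (rule finite_subset[of _ "{1..q}"]) (auto simp: adm_def)

lemma integral_sample_law:
  fixes f :: "'a \<Rightarrow> real"
  assumes "adm D q \<noteq> {}"
  shows "(\<integral>x. f x \<partial>sample_law D V q) = (\<Sum>p\<in>adm D q. f (V p q)) / real (card (adm D q))"
  using assms unfolding sample_law_def by (simp add: integral_pmf_of_set)

lemma integral_lawT:
  fixes f :: "'a::second_countable_topology \<Rightarrow> real"
  assumes "G \<in> borel_measurable borel" "f \<in> borel_measurable borel"
  shows "(\<integral>x. f x \<partial>lawT G) = (\<integral>x. f (G x) \<partial>unifT)"
  unfolding lawT_def using assms by (intro integral_distr) (simp_all add: measurable_cong_sets[OF sets_unifT refl])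

text \<open>Fubini's theorem for the product law. Its first factor carries the discrete
  sigma-algebra, so the measurability of f is first transferred from the Borel product.\<close>

lemma integral_pmf_lawT:
  fixes f :: "complex \<times> complex \<Rightarrow> real"
  assumes S: "finite S" "S \<noteq> {}" and G: "G \<in> borel_measurable borel"
    and f: "continuous_on UNIV f" "\<And>z. \<bar>f z\<bar> \<le> B"
  shows "(\<integral>z. f z \<partial>(measure_pmf (pmf_of_set S) \<Otimes>\<^sub>M lawT G)) =
    (\<Sum>v\<in>S. (\<integral>y. f (v, G y) \<partial>unifT) / real (card S))"
proof -
  have Gm: "G \<in> unifT \<rightarrow>\<^sub>M borel" using G by (simp add: measurable_cong_sets[OF sets_unifT refl])
  interpret L: prob_space "lawT G" unfolding lawT_def using Gm by (rule unifT.prob_space_distr)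
  interpret P: pair_prob_space "measure_pmf (pmf_of_set S)" "lawT G" ..
  have fm: "f \<in> borel_measurable (borel \<Otimes>\<^sub>M borel)"
    using borel_measurable_continuous_onI[OF f(1)] by (simp add: borel_prod)
  have "(\<lambda>z. (fst z, snd z)) \<in> measure_pmf (pmf_of_set S) \<Otimes>\<^sub>M lawT G \<rightarrow>\<^sub>M borel \<Otimes>\<^sub>M borel"
    by (intro measurable_Pair measurable_compose[OF measurable_fst, where g="\<lambda>x. x"]
        measurable_compose[OF measurable_snd, where g="\<lambda>x. x"]) (simp_all add: lawT_def)
  then have fm': "f \<in> borel_measurable (measure_pmf (pmf_of_set S) \<Otimes>\<^sub>M lawT G)"
    using measurable_compose[OF _ fm] by simp
  have "integrable (measure_pmf (pmf_of_set S) \<Otimes>\<^sub>M lawT G) f"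
    by (rule P.integrable_const_bound[of _ B]) (use f(2) fm' in auto)
  then have "(\<integral>z. f z \<partial>(measure_pmf (pmf_of_set S) \<Otimes>\<^sub>M lawT G)) =
     (\<integral>v. (\<integral>y. f (v, y) \<partial>lawT G) \<partial>measure_pmf (pmf_of_set S))"
    by (rule P.integral_fst'[symmetric])
  also have "\<dots> = (\<Sum>v\<in>S. (\<integral>y. f (v, y) \<partial>lawT G)) / real (card S)"
    using S by (simp add: integral_pmf_of_set)
  also have "(\<Sum>v\<in>S. (\<integral>y. f (v, y) \<partial>lawT G)) = (\<Sum>v\<in>S. (\<integral>y. f (v, G y) \<partial>unifT))"
  proof (intro sum.cong refl integral_lawT G)
    fix v
    show "(\<lambda>y. f (v, y)) \<in> borel_measurable borel"
      by (intro borel_measurable_continuous_onI continuous_on_compose2[OF f(1)] continuous_intros) auto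
  qed
  finally show ?thesis by (simp add: sum_divide_distrib)
qed

locale sampled_class = moduli_class +
  fixes D :: "real set" and \<phi> :: "real \<Rightarrow> complex" and B' :: real
  assumes D_frontier: "frontier D \<in> null_sets lebesgue"
    and D_pos: "emeasure lebesgue (D \<inter> {0..<1}) > 0"
    and \<phi>: "trig_approx \<phi> B'"
begin

text \<open>The limiting proportion of units that are admissible, see
  \<open>card_adm_limit\<close>.\<close>

definition \<delta> :: real where "\<delta> = measure lebesgue (D \<inter> {0..1})"

lemma \<delta>_pos: "\<delta> > 0"
proof -
  have Dm: "D \<in> sets lebesgue" using indicator_trig_approx(1)[OF D_frontier] .
  have fin: "D \<inter> {0..1} \<in> lmeasurable" using Dm by (intro bounded_set_imp_lmeasurable) (auto intro: bounded_Int)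
  have "emeasure lebesgue (D \<inter> {0..<1}) \<le> emeasure lebesgue (D \<inter> {0..1})"
    using Dm by (intro emeasure_mono) auto
  then have "0 < emeasure lebesgue (D \<inter> {0..1})" using D_pos by (rule less_le_trans[rotated])
  then show ?thesis unfolding \<delta>_def using emeasure_eq_measure2[OF fin] by simp
qed

lemma integral_D: "(\<integral>x. of_bool (x \<in> D) \<partial>M01) = complex_of_real \<delta>"
proof -
  have "(\<integral>x. of_bool (x \<in> D) \<partial>M01) = (\<integral>x. complex_of_real (indicator D x) \<partial>M01)"
    by (intro Bochner_Integration.integral_cong) (auto simp: indicator_def)
  also have "\<dots> = of_real (\<integral>x. indicator D x \<partial>M01)" by (rule integral_complex_of_real)
  also have "(\<integral>x. indicator D x \<partial>M01) = measure M01 (D \<inter> space M01)"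
    by (rule Bochner_Integration.integral_indicator)
  also have "\<dots> = \<delta>" unfolding \<delta>_def by (subst measure_restrict_space) auto
  finally show ?thesis .
qed

lemma Glim_measurable: "Glim \<phi> \<in> borel_measurable borel"
  using \<phi> by (intro Glim_properties(1)[of \<phi> B' "{}"]) (auto simp: trig_approx_def)

lemma adm_weighted_limit:
  fixes w :: "nat \<Rightarrow> int \<Rightarrow> real" and F :: "complex \<Rightarrow> real"
  assumes w: "\<And>q. q \<in> Q \<Longrightarrow> square_invariant q (\<lambda>x. of_real (w q x))"
    and mean: "\<And>q. q \<in> Q \<Longrightarrow> (\<Sum>x\<in>units_mod q. w q x) = \<mu> * real (totient q)"
    and F: "continuous_on UNIV F" "\<And>z. \<bar>F z\<bar> \<le> BF"
  shows "((\<lambda>q. (\<Sum>p\<in>adm D q. w q (int p) * F (gw \<phi> q (int p) / \<nu> q (int p))) / real (totient q)) \<longlongrightarrow>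
     \<mu> * (\<delta> * (\<integral>y. F (Glim \<phi> y) \<partial>unifT))) (through Q)"
proof -
  have mean': "(\<Sum>x\<in>units_mod q. complex_of_real (w q x)) = of_real \<mu> * of_nat (totient q)" if "q \<in> Q" for q
    using arg_cong[OF mean[OF that], of complex_of_real] by simp
  have "((\<lambda>q. complex_of_real ((\<Sum>p\<in>adm D q. w q (int p) * F (gw \<phi> q (int p) / \<nu> q (int p))) / real (totient q))) \<longlongrightarrow>
     of_real \<mu> * (of_real \<delta> * of_real (\<integral>y. F (Glim \<phi> y) \<partial>unifT))) (through Q)"
  proof (rule Lim_transform_eventually)
    show "((\<lambda>q. (\<Sum>x\<in>units_mod q. of_real (w q x) * (of_bool (real_of_int x / real q \<in> D) * of_real (F (gw \<phi> q x / \<nu> q x)))) / of_nat (totient q)) \<longlongrightarrow>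
      complex_of_real \<mu> * (of_real \<delta> * of_real (\<integral>y. F (Glim \<phi> y) \<partial>unifT))) (through Q)"
      using weighted_limit[OF w mean' indicator_trig_approx(2)[OF D_frontier] \<phi> F] by (simp add: integral_D)
    have "(\<Sum>x\<in>units_mod q. complex_of_real (w q x) * (of_bool (real_of_int x / real q \<in> D) * of_real (F (gw \<phi> q x / \<nu> q x)))) =
      of_real (\<Sum>p\<in>adm D q. w q (int p) * F (gw \<phi> q (int p) / \<nu> q (int p)))" if "q > 1" for q
      unfolding adm_sum[OF that, of "\<lambda>x. w q x * F (gw \<phi> q x / \<nu> q x)"] of_real_sum
      by (intro sum.cong refl) simp
    then show "\<forall>\<^sub>F q in through Q. (\<Sum>x\<in>units_mod q. of_real (w q x) * (of_bool (real_of_int x / real q \<in> D) * of_real (F (gw \<phi> q x / \<nu> q x)))) / of_nat (totient q)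
      = complex_of_real ((\<Sum>p\<in>adm D q. w q (int p) * F (gw \<phi> q (int p) / \<nu> q (int p))) / real (totient q))"
      unfolding eventually_through by (intro exI[of _ 2] allI impI) simp
  qed
  then have "((\<lambda>q. complex_of_real ((\<Sum>p\<in>adm D q. w q (int p) * F (gw \<phi> q (int p) / \<nu> q (int p))) / real (totient q))) \<longlongrightarrow>
     of_real (\<mu> * (\<delta> * (\<integral>y. F (Glim \<phi> y) \<partial>unifT)))) (through Q)" by simp
  then show ?thesis by (simp only: tendsto_of_real_iff)
qed

lemma square_invariant_1: "square_invariant q (\<lambda>x. of_real 1)"
  by (simp add: square_invariant_def)

lemma card_adm_limit: "((\<lambda>q. real (card (adm D q)) / real (totient q)) \<longlongrightarrow> \<delta>) (through Q)"
proof -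
  have "((\<lambda>q. (\<Sum>p\<in>adm D q. 1 * 1) / real (totient q)) \<longlongrightarrow> 1 * (\<delta> * (\<integral>y. 1 \<partial>unifT))) (through Q)"
    by (rule adm_weighted_limit[where w="\<lambda>_ _. 1" and F="\<lambda>_. 1" and BF=1])
      (use Q card_units_mod square_invariant_1 in auto)
  then show ?thesis using unifT.prob_space by simp
qed

text \<open>The uniform distribution on \<open>adm D q\<close> is meaningful only for a nonempty
  set, so integrals against \<open>sample_law\<close> are rewritten only for large q.\<close>

lemma eventually_adm_nonempty: "\<forall>\<^sub>F q in through Q. q \<in> Q \<and> adm D q \<noteq> {}"
proof -
  have "\<forall>\<^sub>F q in through Q. real (card (adm D q)) / real (totient q) > 0"
    using order_tendstoD(1)[OF card_adm_limit \<delta>_pos] .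
  moreover have "\<forall>\<^sub>F q in through Q. q \<in> Q" unfolding eventually_through by blast
  ultimately show ?thesis by eventually_elim auto
qed

lemma adm_average_limit:
  fixes w :: "nat \<Rightarrow> int \<Rightarrow> real" and F :: "complex \<Rightarrow> real"
  assumes "\<And>q. q \<in> Q \<Longrightarrow> square_invariant q (\<lambda>x. of_real (w q x))"
    and "\<And>q. q \<in> Q \<Longrightarrow> (\<Sum>x\<in>units_mod q. w q x) = \<mu> * real (totient q)"
    and "continuous_on UNIV F" "\<And>z. \<bar>F z\<bar> \<le> BF"
  shows "((\<lambda>q. (\<Sum>p\<in>adm D q. w q (int p) * F (gw \<phi> q (int p) / \<nu> q (int p))) / real (card (adm D q))) \<longlongrightarrow>
     \<mu> * (\<integral>y. F (Glim \<phi> y) \<partial>unifT)) (through Q)"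
proof (rule Lim_transform_eventually)
  have "((\<lambda>q. ((\<Sum>p\<in>adm D q. w q (int p) * F (gw \<phi> q (int p) / \<nu> q (int p))) / real (totient q)) /
     (real (card (adm D q)) / real (totient q))) \<longlongrightarrow> (\<mu> * (\<delta> * (\<integral>y. F (Glim \<phi> y) \<partial>unifT))) / \<delta>) (through Q)"
    using \<delta>_pos by (intro tendsto_divide adm_weighted_limit[OF assms] card_adm_limit) auto
  then show "((\<lambda>q. ((\<Sum>p\<in>adm D q. w q (int p) * F (gw \<phi> q (int p) / \<nu> q (int p))) / real (totient q)) /
     (real (card (adm D q)) / real (totient q))) \<longlongrightarrow> \<mu> * (\<integral>y. F (Glim \<phi> y) \<partial>unifT)) (through Q)"
    using \<delta>_pos by simp
  have "totient q > 0" if "q \<in> Q" for q using Q[OF that] by simp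
  then show "\<forall>\<^sub>F q in through Q. ((\<Sum>p\<in>adm D q. w q (int p) * F (gw \<phi> q (int p) / \<nu> q (int p))) / real (totient q)) /
     (real (card (adm D q)) / real (totient q)) = (\<Sum>p\<in>adm D q. w q (int p) * F (gw \<phi> q (int p) / \<nu> q (int p))) / real (card (adm D q))"
    unfolding eventually_through by (intro exI[of _ 0] allI impI) auto
qed

text \<open>Used with h the identity, when the normalised Gauss sum in the denominator is constant,
  and with h the absolute value.\<close>

lemma conv_distr_single:
  fixes h :: "complex \<Rightarrow> 'a::second_countable_topology"
  assumes h: "continuous_on UNIV h"
    and U: "\<And>q p. q \<in> Q \<Longrightarrow> coprime (int p) (int q) \<Longrightarrow> U p q = h (gw \<phi> q (int p) / \<nu> q (int p))"
  shows "conv_distr (sample_law D U) (lawT (\<lambda>y. h (Glim \<phi> y))) (through Q)"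
  unfolding conv_distr_def
proof (intro allI impI)
  fix f :: "'a \<Rightarrow> real" assume f: "continuous_on UNIV f" "bounded (range f)"
  obtain BF where BF: "\<And>z. \<bar>f z\<bar> \<le> BF" using f(2) by (auto simp: bounded_iff)
  have hm: "h \<in> borel_measurable borel" using h by (rule borel_measurable_continuous_onI)
  have lim: "(\<integral>x. f x \<partial>lawT (\<lambda>y. h (Glim \<phi> y))) = (\<integral>y. f (h (Glim \<phi> y)) \<partial>unifT)"
    using f(1) by (intro integral_lawT measurable_compose[OF Glim_measurable hm] borel_measurable_continuous_onI)
  have "((\<lambda>q. (\<Sum>p\<in>adm D q. 1 * f (h (gw \<phi> q (int p) / \<nu> q (int p)))) / real (card (adm D q))) \<longlongrightarrow>
     1 * (\<integral>y. f (h (Glim \<phi> y)) \<partial>unifT)) (through Q)"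
    by (rule adm_average_limit[where w="\<lambda>_ _. 1" and F="\<lambda>z. f (h z)" and BF=BF])
      (use Q card_units_mod square_invariant_1 BF in \<open>auto intro: continuous_on_compose2[OF f(1) h]\<close>)
  moreover have "\<forall>\<^sub>F q in through Q. (\<Sum>p\<in>adm D q. 1 * f (h (gw \<phi> q (int p) / \<nu> q (int p)))) / real (card (adm D q)) =
     (\<integral>x. f x \<partial>sample_law D U q)"
    using eventually_adm_nonempty
  proof eventually_elim
    case (elim q)
    have "U p q = h (gw \<phi> q (int p) / \<nu> q (int p))" if "p \<in> adm D q" for p
      using U elim that by (auto simp: adm_def)
    then show ?case using elim by (simp add: integral_sample_law)
  qed
  ultimately show "((\<lambda>q. \<integral>x. f x \<partial>sample_law D U q) \<longlongrightarrow> (\<integral>x. f x \<partial>lawT (\<lambda>y. h (Glim \<phi> y)))) (through Q)"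
    unfolding lim by (auto intro: Lim_transform_eventually)
qed

text \<open>The first component takes finitely many values. For each value v the indicator of
  \<open>V q x = v\<close> is an admissible weight of mean 1 / \<open>card S\<close>, and the test
  function is f with first argument fixed; the product law appears on summing over v.\<close>

lemma conv_distr_pair:
  fixes V :: "nat \<Rightarrow> int \<Rightarrow> complex"
  assumes S: "finite S" "S \<noteq> {}"
    and V: "\<And>q x. q \<in> Q \<Longrightarrow> coprime x (int q) \<Longrightarrow> V q x \<in> S"
    and V_mod: "\<And>q x y. q \<in> Q \<Longrightarrow> [x = y] (mod int q) \<Longrightarrow> V q x = V q y"
    and V_square: "\<And>q x u. q \<in> Q \<Longrightarrow> coprime x (int q) \<Longrightarrow> coprime u (int q) \<Longrightarrow> V q (x * u\<^sup>2) = V q x"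
    and V_unif: "\<And>q v. q \<in> Q \<Longrightarrow> v \<in> S \<Longrightarrow> (\<Sum>x\<in>units_mod q. of_bool (V q x = v)) = real (totient q) / real (card S)"
  shows "conv_distr (sample_law D (\<lambda>p q. (V q (int p), gw \<phi> q (int p) / \<nu> q (int p))))
     (measure_pmf (pmf_of_set S) \<Otimes>\<^sub>M lawT (Glim \<phi>)) (through Q)"
  unfolding conv_distr_def
proof (intro allI impI)
  fix f :: "complex \<times> complex \<Rightarrow> real" assume f: "continuous_on UNIV f" "bounded (range f)"
  obtain BF where BF: "\<And>z. \<bar>f z\<bar> \<le> BF" using f(2) by (auto simp: bounded_iff)
  have "((\<lambda>q. \<Sum>v\<in>S. (\<Sum>p\<in>adm D q. of_bool (V q (int p) = v) * f (v, gw \<phi> q (int p) / \<nu> q (int p))) / real (card (adm D q))) \<longlongrightarrow>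
      (\<Sum>v\<in>S. 1 / real (card S) * (\<integral>y. f (v, Glim \<phi> y) \<partial>unifT))) (through Q)"
  proof (intro tendsto_sum)
    fix v assume v: "v \<in> S"
    show "((\<lambda>q. (\<Sum>p\<in>adm D q. of_bool (V q (int p) = v) * f (v, gw \<phi> q (int p) / \<nu> q (int p))) / real (card (adm D q))) \<longlongrightarrow>
      1 / real (card S) * (\<integral>y. f (v, Glim \<phi> y) \<partial>unifT)) (through Q)"
    proof (rule adm_average_limit[where w="\<lambda>q x. of_bool (V q x = v)" and F="\<lambda>z. f (v, z)" and BF=BF])
      fix q assume q: "q \<in> Q"
      show "square_invariant q (\<lambda>x. of_real (of_bool (V q x = v)))"
        using V_mod[OF q] V_square[OF q] by (auto simp: square_invariant_def)
      show "(\<Sum>x\<in>units_mod q. of_bool (V q x = v)) = 1 / real (card S) * real (totient q)"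
        using V_unif[OF q v] by simp
    next
      show "continuous_on UNIV (\<lambda>z. f (v, z))"
        by (intro continuous_on_compose2[OF f(1)] continuous_intros) auto
    qed (rule BF)
  qed
  moreover have "\<forall>\<^sub>F q in through Q. (\<Sum>v\<in>S. (\<Sum>p\<in>adm D q. of_bool (V q (int p) = v) * f (v, gw \<phi> q (int p) / \<nu> q (int p))) / real (card (adm D q))) =
     (\<integral>x. f x \<partial>sample_law D (\<lambda>p q. (V q (int p), gw \<phi> q (int p) / \<nu> q (int p))) q)"
    using eventually_adm_nonempty
  proof eventually_elim
    case (elim q)
    have "(\<Sum>v\<in>S. (\<Sum>p\<in>adm D q. of_bool (V q (int p) = v) * f (v, gw \<phi> q (int p) / \<nu> q (int p)))) =
      (\<Sum>p\<in>adm D q. \<Sum>v\<in>S. of_bool (V q (int p) = v) * f (v, gw \<phi> q (int p) / \<nu> q (int p)))" by (rule sum.swap)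
    also have "\<dots> = (\<Sum>p\<in>adm D q. f (V q (int p), gw \<phi> q (int p) / \<nu> q (int p)))"
    proof (intro sum.cong refl)
      fix p assume "p \<in> adm D q"
      then have "V q (int p) \<in> S" using V elim by (auto simp: adm_def)
      have "(\<Sum>v\<in>S. of_bool (V q (int p) = v) * f (v, gw \<phi> q (int p) / \<nu> q (int p))) =
          (\<Sum>v\<in>S. if V q (int p) = v then f (v, gw \<phi> q (int p) / \<nu> q (int p)) else 0)" by (intro sum.cong) auto
      also have "\<dots> = f (V q (int p), gw \<phi> q (int p) / \<nu> q (int p))" using S \<open>V q (int p) \<in> S\<close> by (simp add: sum.delta')
      finally show "(\<Sum>v\<in>S. of_bool (V q (int p) = v) * f (v, gw \<phi> q (int p) / \<nu> q (int p))) =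
         f (V q (int p), gw \<phi> q (int p) / \<nu> q (int p))" .
    qed
    finally show ?case using elim by (simp add: integral_sample_law flip: sum_divide_distrib)
  qed
  moreover have "(\<integral>z. f z \<partial>(measure_pmf (pmf_of_set S) \<Otimes>\<^sub>M lawT (Glim \<phi>))) = (\<Sum>v\<in>S. 1 / real (card S) * (\<integral>y. f (v, Glim \<phi> y) \<partial>unifT))"
    using integral_pmf_lawT[OF S Glim_measurable f(1) BF] by simp
  ultimately show "((\<lambda>q. \<integral>x. f x \<partial>sample_law D (\<lambda>p q. (V q (int p), gw \<phi> q (int p) / \<nu> q (int p))) q) \<longlongrightarrow>
     (\<integral>z. f z \<partial>(measure_pmf (pmf_of_set S) \<Otimes>\<^sub>M lawT (Glim \<phi>)))) (through Q)"
    by (simp only:) (rule Lim_transform_eventually)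
qed

end

section \<open>Exact uniformity of the normalised Gauss sums\<close>

lemma uniform_sign:
  assumes q: "q > 0" and mod: "\<And>x y. [x = y] (mod int q) \<Longrightarrow> V x = V y"
    and V: "\<And>x. coprime x (int q) \<Longrightarrow> V x \<in> {1, -1 :: complex}"
    and u: "coprime u (int q)" "\<And>x. coprime x (int q) \<Longrightarrow> V (u * x) = - V x"
    and v: "v \<in> {1, -1}"
  shows "(\<Sum>x\<in>units_mod q. of_bool (V x = v)) = real (totient q) / real (card {1, -1 :: complex})"
proof -
  have "(\<Sum>x\<in>units_mod q. of_bool (V x = 1) :: real) = (\<Sum>x\<in>units_mod q. of_bool (V x = - 1))"
    by (rule sum_units_of_bool_eq[OF mod u(1), where \<sigma>=uminus]) (auto simp: u(2) inj_def)
  moreover have "(\<Sum>v\<in>{1, -1}. \<Sum>x\<in>units_mod q. of_bool (V x = v) :: real) = real (totient q)"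
    by (rule sum_units_of_bool_total[OF q _ V]) auto
  ultimately show ?thesis using v by auto
qed

text \<open>The square case: the values 1 + \<i> and 1 - \<i> are exchanged by conjugation, that is
  by x \<mapsto> -x.\<close>

lemma uniform_conj_pair:
  assumes q: "q > 0" and mod: "\<And>x y. [x = y] (mod int q) \<Longrightarrow> V x = V y"
    and V: "\<And>x. coprime x (int q) \<Longrightarrow> V x \<in> {1 + \<i>, 1 - \<i>}"
    and cnj: "\<And>x. V (- x) = cnj (V x)"
    and v: "v \<in> {1 + \<i>, 1 - \<i>}"
  shows "(\<Sum>x\<in>units_mod q. of_bool (V x = v)) = real (totient q) / real (card {1 + \<i>, 1 - \<i>})"
proof -
  have ne: "1 + \<i> \<noteq> 1 - \<i>" by (simp add: complex_eq_iff)
  have "(\<Sum>x\<in>units_mod q. of_bool (V x = 1 + \<i>) :: real) = (\<Sum>x\<in>units_mod q. of_bool (V x = cnj (1 + \<i>)))"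
    by (rule sum_units_of_bool_eq[where u="-1" and \<sigma>=cnj, OF mod]) (auto simp: cnj inj_def)
  moreover have "(\<Sum>v\<in>{1 + \<i>, 1 - \<i>}. \<Sum>x\<in>units_mod q. of_bool (V x = v) :: real) = real (totient q)"
    by (rule sum_units_of_bool_total[OF q _ V]) auto
  ultimately show ?thesis using v ne by auto
qed

lemma card_corners: "card corners = 4"
  by (simp add: corners_def complex_eq_iff)

text \<open>Negation and conjugation together act transitively on the four corners, so all four
  values occur equally often.\<close>

lemma uniform_corners:
  assumes q: "q > 0" and mod: "\<And>x y. [x = y] (mod int q) \<Longrightarrow> V x = V y"
    and V: "\<And>x. coprime x (int q) \<Longrightarrow> V x \<in> corners"
    and cnj: "\<And>x. V (- x) = cnj (V x)"
    and u: "coprime u (int q)" "\<And>x. coprime x (int q) \<Longrightarrow> V (u * x) = - V x"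
    and v: "v \<in> corners"
  shows "(\<Sum>x\<in>units_mod q. of_bool (V x = v)) = real (totient q) / real (card corners)"
proof -
  define A where "A = (\<lambda>v. \<Sum>x\<in>units_mod q. of_bool (V x = v) :: real)"
  have neg: "A v = A (- v)" for v unfolding A_def
    by (rule sum_units_of_bool_eq[OF mod u(1), where \<sigma>=uminus]) (auto simp: u(2) inj_def)
  have con: "A v = A (cnj v)" for v unfolding A_def
    by (rule sum_units_of_bool_eq[where u="-1" and \<sigma>=cnj, OF mod]) (auto simp: cnj inj_def)
  have "(\<Sum>v\<in>corners. A v) = real (totient q)"
    unfolding A_def by (rule sum_units_of_bool_total[OF q _ V]) (auto simp: corners_def)
  moreover have "(\<Sum>v\<in>corners. A v) = A (1 + \<i>) + (A (1 - \<i>) + (A (-1 + \<i>) + A (-1 - \<i>)))"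
    unfolding corners_def by (simp add: complex_eq_iff)
  moreover have "A (1 - \<i>) = A (1 + \<i>)" "A (-1 - \<i>) = A (1 + \<i>)" "A (-1 + \<i>) = A (1 + \<i>)"
    using con[of "1 + \<i>"] neg[of "1 + \<i>"] neg[of "1 - \<i>"] by simp_all
  ultimately have "A v = real (totient q) / 4" using v by (auto simp: corners_def)
  then show ?thesis by (simp add: A_def card_corners)
qed

text \<open>The sign change found modulo r need not be odd; the Chinese remainder theorem makes it a
  unit modulo 2 r.\<close>

lemma sign_change_twice_odd:
  assumes "odd r" "\<not> is_square r"
  shows "\<exists>u. coprime u (int (2 * r)) \<and> (\<forall>a. coprime a (int r) \<longrightarrow> gs r (2 * (u * a)) 0 = - gs r (2 * a) 0)"
proof -
  obtain v where v: "coprime v (int r)" "\<And>a. coprime a (int r) \<Longrightarrow> gs r (a * v) 0 = - gs r a 0"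
    using gs_sign_change_odd[OF assms] by blast
  obtain u where u: "[u = 1] (mod int 2)" "[u = v] (mod int r)" "coprime u (int (2 * r))"
    using ex_coprime_crt[of 2 r 1 v] v(1) assms(1) odd_pos[OF assms(1)] by auto
  have "gs r (2 * (u * a)) 0 = - gs r (2 * a) 0" if "coprime a (int r)" for a
  proof -
    have "gs r (2 * (u * a)) 0 = gs r (2 * (v * a)) 0" by (intro gs_cong cong_mult cong_refl u)
    also have "\<dots> = gs r ((2 * a) * v) 0" by (simp add: mult_ac)
    also have "\<dots> = - gs r (2 * a) 0" using that assms(1) by (intro v(2)) simp
    finally show ?thesis .
  qed
  then show ?thesis using u(3) by blast
qed

section \<open>The limit laws for the three residue classes of q modulo 4\<close>

theorem theorem1p5:
  fixes D :: "real set" and \<phi> :: "real \<Rightarrow> complex" and N :: nat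
  assumes D_periodic: "\<And>x. x \<in> D \<longleftrightarrow> x + 1 \<in> D"
    and D_boundary: "frontier D \<in> null_sets lebesgue"
    and D_pos: "emeasure lebesgue (D \<inter> {0..<1}) > 0"
    and \<phi>_periodic: "\<And>x. \<phi> (x + 1) = \<phi> x"
    and \<phi>_riemann: "riemann_int \<phi> 0 1"
    and N_pos: "N > 0"
  shows
   "conv_distr (sample_law D (\<lambda>p q. (g1 p q / sqrt (real q), gsum \<phi> p q / g1 p q)))
       (lawX \<Otimes>\<^sub>M lawT (Gplus \<phi>))
       (through {q. q > 0 \<and> num_divisors q \<le> N \<and> q mod 4 = 0 \<and> \<not> is_square q})
  \<and> conv_distr (sample_law D (\<lambda>p q. (g1 p q / sqrt (real q), gsum \<phi> p q / g1 p q)))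
       (lawZ \<Otimes>\<^sub>M lawT (Gplus \<phi>))
       (through {q. q > 0 \<and> num_divisors q \<le> N \<and> q mod 4 = 0 \<and> is_square q})
  \<and> conv_distr (sample_law D (\<lambda>p q. (g1 p q / (eps_sym q * sqrt (real q)), gsum \<phi> p q / g1 p q)))
       (lawY \<Otimes>\<^sub>M lawT (Gfull \<phi>))
       (through {q. q > 0 \<and> num_divisors q \<le> N \<and> odd q \<and> \<not> is_square q})
  \<and> conv_distr (sample_law D (\<lambda>p q. gsum \<phi> p q / (eps_sym q * sqrt (real q))))
       (lawT (Gfull \<phi>))
       (through {q. q > 0 \<and> num_divisors q \<le> N \<and> odd q \<and> is_square q})
  \<and> conv_distr (sample_law D (\<lambda>p q. (g1 (2 * p) (q div 2) / (eps_sym (q div 2) * sqrt (real (q div 2))),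
                                     gsum \<phi> p q / (2 * g1 (2 * p) (q div 2)))))
       (lawY \<Otimes>\<^sub>M lawT (Gminus \<phi>))
       (through {q. q > 0 \<and> num_divisors q \<le> N \<and> q mod 4 = 2 \<and> \<not> is_square (q div 2)})
  \<and> conv_distr (sample_law D (\<lambda>p q. gsum \<phi> p q / (eps_sym (q div 2) * sqrt (2 * real q))))
       (lawT (Gminus \<phi>))
       (through {q. q > 0 \<and> num_divisors q \<le> N \<and> q mod 4 = 2 \<and> is_square (q div 2)})
  \<and> conv_distr (sample_law D (\<lambda>p q. cmod (gsum \<phi> p q) / sqrt (2 * real q)))
       (lawT (\<lambda>x. cmod (Gplus \<phi> x)))
       (through {q. q > 0 \<and> num_divisors q \<le> N \<and> q mod 4 = 0})
  \<and> conv_distr (sample_law D (\<lambda>p q. cmod (gsum \<phi> p q) / sqrt (real q)))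
       (lawT (\<lambda>x. cmod (Gfull \<phi> x)))
       (through {q. q > 0 \<and> num_divisors q \<le> N \<and> odd q})
  \<and> conv_distr (sample_law D (\<lambda>p q. cmod (gsum \<phi> p q) / sqrt (2 * real q)))
       (lawT (\<lambda>x. cmod (Gminus \<phi> x)))
       (through {q. q > 0 \<and> num_divisors q \<le> N \<and> q mod 4 = 2})"
proof -
  have "\<phi> 1 = \<phi> 0" using \<phi>_periodic[of 0] by simp
  then obtain B where \<phi>: "trig_approx \<phi> B" using riemann_trig_approx[OF \<phi>_riemann] by blast
  have sampled: "sampled_class Q N \<nu> t c J D \<phi> B" if "moduli_class Q N \<nu> t c J" for Q \<nu> t c J
    using that D_boundary D_pos \<phi> by (intro sampled_class.intro sampled_class_axioms.intro)
  define h where "h = (\<lambda>q::nat. - (int ((q + 1) div 2))\<^sup>2)"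
  define h2 where "h2 = (\<lambda>q::nat. - 2 * (int ((q div 2 + 1) div 2)) ^ 3)"
  have four: "sampled_class Q N (\<lambda>q x. gs q x 0) (\<lambda>q. -1) 2 UNIV D \<phi> B"
    if "Q \<subseteq> {q. q > 0 \<and> num_divisors q \<le> N \<and> q mod 4 = 0}" for Q
    using that by (intro sampled four_dvd_class) auto
  have odd: "sampled_class Q N (\<lambda>q x. gs q x 0) h 1 UNIV D \<phi> B"
    if "Q \<subseteq> {q. q > 0 \<and> num_divisors q \<le> N \<and> odd q}" for Q
    unfolding h_def using that by (intro sampled odd_class) auto
  have twice: "sampled_class Q N (\<lambda>q x. 2 * gs (q div 2) (2 * x) 0) h2 1 {k. odd k} D \<phi> B"
    if "Q \<subseteq> {q. q > 0 \<and> num_divisors q \<le> N \<and> q mod 4 = 2}" for Q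
    unfolding h2_def using that by (intro sampled twice_odd_class) auto
  \<comment> \<open>\<open>Glim\<close> depends only on c and J, so its defining equation may be
    taken from the instance with the empty family of moduli.\<close>
  have Gp: "moduli_class.Glim 2 UNIV \<phi> = Gplus \<phi>"
    unfolding moduli_class.Glim_def[OF sampled_class.axioms(1)[OF four[OF empty_subsetI]]] Gplus_def
    by (simp only: UNIV_I simp_thms Collect_mem_eq)
  have Gf: "moduli_class.Glim 1 UNIV \<phi> = Gfull \<phi>"
    unfolding moduli_class.Glim_def[OF sampled_class.axioms(1)[OF odd[OF empty_subsetI]]] Gfull_def
    by (simp only: UNIV_I simp_thms Collect_mem_eq mult_1)
  have Gm: "moduli_class.Glim 1 {k. odd k} \<phi> = Gminus \<phi>"
    unfolding moduli_class.Glim_def[OF sampled_class.axioms(1)[OF twice[OF empty_subsetI]]] Gminus_def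
    by (simp only: mem_Collect_eq mult_1)
  have half: "q = 2 * (q div 2)" "odd (q div 2)" if "q mod 4 = 2" for q :: nat
    using that by presburger+
  have sqrt_half: "sqrt (2 * real q) = 2 * sqrt (real (q div 2))" if "q mod 4 = 2" for q :: nat
  proof -
    have "2 * real q = 4 * real (q div 2)" using half(1)[OF that] by linarith
    then show ?thesis by (simp add: real_sqrt_mult)
  qed
  \<comment> \<open>For an odd square the Gauss sum equals its normalisation, so the first component
    is constant; this is why the square cases for odd q and for twice an odd number speak of a
    single component.\<close>
  have odd_square: "gs r x 0 = sqrt r" "eps_sym r = 1" if r: "odd r" "is_square r" "coprime x (int r)" for r x
  proof -
    obtain k where k: "r = k\<^sup>2" using r(2) by (auto simp: is_square_def)
    have ko: "odd k" using r(1) k by simp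
    have "coprime x (int k)" using r(3) k by simp
    then show "gs r x 0 = sqrt r" unfolding k using gs_odd_square[OF ko] by simp
    have "k mod 4 = 1 \<or> k mod 4 = 3" using ko by presburger
    moreover have "k\<^sup>2 mod 4 = ((k mod 4) * (k mod 4)) mod 4" by (simp add: power2_eq_square mod_mult_eq)
    ultimately have "k\<^sup>2 mod 4 = 1" by auto
    then show "eps_sym r = 1" by (simp add: eps_sym_def k)
  qed
  \<comment> \<open>The modulus r is q or \<open>q div 2\<close> and the factor c is 1 or 2, so one
    statement serves odd moduli, multiples of 4 and doubled odd moduli.\<close>
  have gs_per: "gs r (c * x) 0 = gs r (c * y) 0" if "[x = y] (mod int q)" "r dvd q" for r q c x y
    using that by (intro gs_cong cong_mult cong_refl cong_dvd_modulus[OF that(1)]) auto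
  have gs_sq: "gs r (c * (x * u\<^sup>2)) 0 = gs r (c * x) 0" if "coprime u (int q)" "r dvd q" for r q c x u
  proof -
    have "coprime u (int r)" using that by (meson coprime_divisors dvd_refl of_nat_dvd_iff)
    then show ?thesis using gs_mult_square[of u r "c * x"] by (simp add: mult.assoc)
  qed
  note gs_per1 = gs_per[where c=1, unfolded mult_1] and gs_sq1 = gs_sq[where c=1, unfolded mult_1]
  let ?Q4 = "{q. q > 0 \<and> num_divisors q \<le> N \<and> q mod 4 = 0}"
  let ?Q1 = "{q. q > 0 \<and> num_divisors q \<le> N \<and> odd q}"
  let ?Q2 = "{q. q > 0 \<and> num_divisors q \<le> N \<and> q mod 4 = 2}"
  have c1: "conv_distr (sample_law D (\<lambda>p q. (g1 p q / sqrt (real q), gsum \<phi> p q / g1 p q)))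
       (lawX \<Otimes>\<^sub>M lawT (Gplus \<phi>))
       (through {q. q > 0 \<and> num_divisors q \<le> N \<and> q mod 4 = 0 \<and> \<not> is_square q})" (is "conv_distr _ _ (through ?Q)")
  proof -
    have "conv_distr (sample_law D (\<lambda>p q. (gs q (int p) 0 / sqrt q, gw \<phi> q (int p) / gs q (int p) 0)))
       (measure_pmf (pmf_of_set corners) \<Otimes>\<^sub>M lawT (moduli_class.Glim 2 UNIV \<phi>)) (through ?Q)"
    proof (rule sampled_class.conv_distr_pair[OF four, where V="\<lambda>q x. gs q x 0 / sqrt q"])
      show "\<And>q x. q \<in> ?Q \<Longrightarrow> coprime x (int q) \<Longrightarrow> gs q x 0 / sqrt q \<in> corners"
        by (intro gs_four_dvd_values) auto
      show "finite corners" "corners \<noteq> {}" by (auto simp: corners_def)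
      fix q v assume q: "q \<in> ?Q" and v: "v \<in> corners"
      then have q4: "4 dvd q" "q > 0" "\<not> is_square q" by auto
      obtain u where u: "coprime u (int q)" "\<And>a. coprime a (int q) \<Longrightarrow> gs q (a * u) 0 = - gs q a 0"
        using gs_sign_change_four_dvd[OF q4] by blast
      show "(\<Sum>x\<in>units_mod q. of_bool (gs q x 0 / sqrt q = v)) = real (totient q) / real (card corners)"
      proof (rule uniform_corners[OF q4(2) _ _ _ u(1) _ v])
        show "gs q x 0 / sqrt q = gs q y 0 / sqrt q" if "[x = y] (mod int q)" for x y
          using gs_per1[OF that] by simp
        show "gs q x 0 / sqrt q \<in> corners" if "coprime x (int q)" for x
          using gs_four_dvd_values[OF q4(1,2) that] .
      qed (use u(2) in \<open>auto simp: mult.commute simp flip: cnj_gs\<close>)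
    qed (auto simp: gs_sq1 intro: gs_cong)
    then show ?thesis unfolding g1_eq_gs gsum_eq_gw lawX_def corners_def Gp .
  qed
  have c2: "conv_distr (sample_law D (\<lambda>p q. (g1 p q / sqrt (real q), gsum \<phi> p q / g1 p q)))
       (lawZ \<Otimes>\<^sub>M lawT (Gplus \<phi>))
       (through {q. q > 0 \<and> num_divisors q \<le> N \<and> q mod 4 = 0 \<and> is_square q})" (is "conv_distr _ _ (through ?Q)")
  proof -
    have val: "gs q x 0 / sqrt q \<in> {1 + \<i>, 1 - \<i>}" if "q \<in> ?Q" "coprime x (int q)" for q x
      using that by (intro gs_four_dvd_square_values) auto
    have "conv_distr (sample_law D (\<lambda>p q. (gs q (int p) 0 / sqrt q, gw \<phi> q (int p) / gs q (int p) 0)))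
       (measure_pmf (pmf_of_set {1 + \<i>, 1 - \<i>}) \<Otimes>\<^sub>M lawT (moduli_class.Glim 2 UNIV \<phi>)) (through ?Q)"
    proof (rule sampled_class.conv_distr_pair[OF four, where V="\<lambda>q x. gs q x 0 / sqrt q"])
      show "\<And>q x. q \<in> ?Q \<Longrightarrow> coprime x (int q) \<Longrightarrow> gs q x 0 / sqrt q \<in> {1 + \<i>, 1 - \<i>}" by (rule val)
      fix q v assume q: "q \<in> ?Q" and v: "v \<in> {1 + \<i>, 1 - \<i>}"
      show "(\<Sum>x\<in>units_mod q. of_bool (gs q x 0 / sqrt q = v)) = real (totient q) / real (card {1 + \<i>, 1 - \<i>})"
      proof (rule uniform_conj_pair[OF _ _ val[OF q] _ v])
        show "gs q x 0 / sqrt q = gs q y 0 / sqrt q" if "[x = y] (mod int q)" for x y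
          using gs_per1[OF that] by simp
      qed (use q in \<open>auto simp flip: cnj_gs\<close>)
    qed (auto simp: gs_sq1 intro: gs_cong)
    then show ?thesis unfolding g1_eq_gs gsum_eq_gw lawZ_def Gp .
  qed
  have c3: "conv_distr (sample_law D (\<lambda>p q. (g1 p q / (eps_sym q * sqrt (real q)), gsum \<phi> p q / g1 p q)))
       (lawY \<Otimes>\<^sub>M lawT (Gfull \<phi>))
       (through {q. q > 0 \<and> num_divisors q \<le> N \<and> odd q \<and> \<not> is_square q})" (is "conv_distr _ _ (through ?Q)")
  proof -
    have val: "gs q x 0 / (eps_sym q * sqrt q) \<in> {1, -1}" if "q \<in> ?Q" "coprime x (int q)" for q x
      using gs_odd_values[of q x] that by (auto simp: eps_sym_def)
    have "conv_distr (sample_law D (\<lambda>p q. (gs q (int p) 0 / (eps_sym q * sqrt q), gw \<phi> q (int p) / gs q (int p) 0)))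
       (measure_pmf (pmf_of_set {1, -1}) \<Otimes>\<^sub>M lawT (moduli_class.Glim 1 UNIV \<phi>)) (through ?Q)"
    proof (rule sampled_class.conv_distr_pair[OF odd, where V="\<lambda>q x. gs q x 0 / (eps_sym q * sqrt q)"])
      show "\<And>q x. q \<in> ?Q \<Longrightarrow> coprime x (int q) \<Longrightarrow> gs q x 0 / (eps_sym q * sqrt q) \<in> {1, -1}" by (rule val)
      fix q v assume q: "q \<in> ?Q" and v: "v \<in> {1, -1 :: complex}"
      obtain u where u: "coprime u (int q)" "\<And>a. coprime a (int q) \<Longrightarrow> gs q (a * u) 0 = - gs q a 0"
        using gs_sign_change_odd[of q] q by blast
      show "(\<Sum>x\<in>units_mod q. of_bool (gs q x 0 / (eps_sym q * sqrt q) = v)) = real (totient q) / real (card {1, -1 :: complex})"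
      proof (rule uniform_sign[OF _ _ val[OF q] u(1) _ v])
        show "gs q x 0 / (eps_sym q * sqrt q) = gs q y 0 / (eps_sym q * sqrt q)" if "[x = y] (mod int q)" for x y
          using gs_per1[OF that] by simp
      qed (use u(2) q in \<open>auto simp: mult.commute\<close>)
    qed (auto simp: gs_sq1 intro: gs_cong)
    then show ?thesis unfolding g1_eq_gs gsum_eq_gw lawY_def Gf .
  qed
  have c5: "conv_distr (sample_law D (\<lambda>p q. (g1 (2 * p) (q div 2) / (eps_sym (q div 2) * sqrt (real (q div 2))),
                                     gsum \<phi> p q / (2 * g1 (2 * p) (q div 2)))))
       (lawY \<Otimes>\<^sub>M lawT (Gminus \<phi>))
       (through {q. q > 0 \<and> num_divisors q \<le> N \<and> q mod 4 = 2 \<and> \<not> is_square (q div 2)})" (is "conv_distr _ _ (through ?Q)")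
  proof -
    have two_half: "2 * (q div 2) = q" if "q \<in> ?Q" for q
      by (rule half(1)[symmetric]) (use that in simp)
    have dv: "q div 2 dvd q" if "q \<in> ?Q" for q
      using dvd_triv_right[of "q div 2" 2] unfolding two_half[OF that] .
    have cop: "coprime x (int (q div 2))" if "coprime x (int q)" "q \<in> ?Q" for x q
      using that dv[OF that(2)] by (meson coprime_divisors dvd_refl of_nat_dvd_iff)
    have val: "gs (q div 2) (2 * x) 0 / (eps_sym (q div 2) * sqrt (q div 2)) \<in> {1, -1}" if q: "q \<in> ?Q" "coprime x (int q)" for q x
    proof -
      have o: "odd (q div 2)" by (rule half(2)) (use q in simp)
      then have "coprime (2 * x) (int (q div 2))" using cop[OF q(2,1)] by simp
      then obtain s where "s \<in> {1, -1}" "gs (q div 2) (2 * x) 0 = s * (eps_sym (q div 2) * sqrt (q div 2))"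
        using gs_odd_values[OF o] by blast
      moreover have "eps_sym (q div 2) * complex_of_real (sqrt (q div 2)) \<noteq> 0"
        using odd_pos[OF o] by (auto simp: eps_sym_def)
      ultimately show ?thesis by auto
    qed
    have "conv_distr (sample_law D (\<lambda>p q. (gs (q div 2) (2 * int p) 0 / (eps_sym (q div 2) * sqrt (q div 2)), gw \<phi> q (int p) / (2 * gs (q div 2) (2 * int p) 0))))
       (measure_pmf (pmf_of_set {1, -1}) \<Otimes>\<^sub>M lawT (moduli_class.Glim 1 {k. odd k} \<phi>)) (through ?Q)"
    proof (rule sampled_class.conv_distr_pair[OF twice, where V="\<lambda>q x. gs (q div 2) (2 * x) 0 / (eps_sym (q div 2) * sqrt (q div 2))"])
      show "\<And>q x. q \<in> ?Q \<Longrightarrow> coprime x (int q) \<Longrightarrow> gs (q div 2) (2 * x) 0 / (eps_sym (q div 2) * sqrt (q div 2)) \<in> {1, -1}" by (rule val)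
      fix q v assume q: "q \<in> ?Q" and v: "v \<in> {1, -1 :: complex}"
      obtain u where u: "coprime u (int (2 * (q div 2)))" "\<And>a. coprime a (int (q div 2)) \<Longrightarrow> gs (q div 2) (2 * (u * a)) 0 = - gs (q div 2) (2 * a) 0"
        using sign_change_twice_odd[OF half(2)[of q]] q by blast
      have cu: "coprime u (int q)" using u(1) unfolding two_half[OF q] .
      show "(\<Sum>x\<in>units_mod q. of_bool (gs (q div 2) (2 * x) 0 / (eps_sym (q div 2) * sqrt (q div 2)) = v)) = real (totient q) / real (card {1, -1 :: complex})"
      proof (rule uniform_sign[OF _ _ val[OF q] cu _ v])
        show "gs (q div 2) (2 * x) 0 / (eps_sym (q div 2) * sqrt (q div 2)) = gs (q div 2) (2 * y) 0 / (eps_sym (q div 2) * sqrt (q div 2))" if "[x = y] (mod int q)" for x y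
          using gs_per[OF that dv[OF q]] by simp
        show "gs (q div 2) (2 * (u * x)) 0 / (eps_sym (q div 2) * sqrt (q div 2)) = - (gs (q div 2) (2 * x) 0 / (eps_sym (q div 2) * sqrt (q div 2)))" if "coprime x (int q)" for x
          using u(2)[OF cop[OF that q]] by simp
      qed (use q in auto)
    next
      fix q x y assume q: "q \<in> ?Q" and xy: "[x = y] (mod int q)"
      show "gs (q div 2) (2 * x) 0 / (eps_sym (q div 2) * sqrt (q div 2)) = gs (q div 2) (2 * y) 0 / (eps_sym (q div 2) * sqrt (q div 2))"
        by (simp only: gs_per[OF xy dv[OF q]])
    next
      fix q x u assume q: "q \<in> ?Q" and u: "coprime u (int q)"
      show "gs (q div 2) (2 * (x * u\<^sup>2)) 0 / (eps_sym (q div 2) * sqrt (q div 2)) = gs (q div 2) (2 * x) 0 / (eps_sym (q div 2) * sqrt (q div 2))"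
        by (simp only: gs_sq[OF u dv[OF q]])
    qed auto
    then show ?thesis unfolding g1_eq_gs gsum_eq_gw lawY_def Gm of_nat_mult of_nat_numeral .
  qed
  have c4: "conv_distr (sample_law D (\<lambda>p q. gsum \<phi> p q / (eps_sym q * sqrt (real q))))
       (lawT (Gfull \<phi>))
       (through {q. q > 0 \<and> num_divisors q \<le> N \<and> odd q \<and> is_square q})" (is "conv_distr _ _ (through ?Q)")
  proof -
    have "conv_distr (sample_law D (\<lambda>p q. gsum \<phi> p q / (eps_sym q * sqrt (real q)))) (lawT (\<lambda>y. moduli_class.Glim 1 UNIV \<phi> y)) (through ?Q)"
      by (rule sampled_class.conv_distr_single[OF odd, where h="\<lambda>z. z"])
        (auto simp: gsum_eq_gw odd_square odd_square(2)[where x=1] intro!: continuous_intros)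
    then show ?thesis by (simp only: Gf)
  qed
  have c6: "conv_distr (sample_law D (\<lambda>p q. gsum \<phi> p q / (eps_sym (q div 2) * sqrt (2 * real q))))
       (lawT (Gminus \<phi>))
       (through {q. q > 0 \<and> num_divisors q \<le> N \<and> q mod 4 = 2 \<and> is_square (q div 2)})" (is "conv_distr _ _ (through ?Q)")
  proof -
    have "conv_distr (sample_law D (\<lambda>p q. gsum \<phi> p q / (eps_sym (q div 2) * sqrt (2 * real q)))) (lawT (\<lambda>y. moduli_class.Glim 1 {k. odd k} \<phi> y)) (through ?Q)"
    proof (rule sampled_class.conv_distr_single[OF twice, where h="\<lambda>z. z"])
      fix q p assume q: "q \<in> ?Q" and p: "coprime (int p) (int q)"
      define r where "r = q div 2"
      have q2: "q mod 4 = 2" and r2: "is_square r" using q by (auto simp: r_def)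
      have r: "q = 2 * r" "odd r" unfolding r_def by (rule half[OF q2])+
      have "coprime (2 * int p) (int r)" using p r by simp
      then have "gs r (2 * int p) 0 = sqrt r" "eps_sym r = 1" using odd_square[OF r(2) r2] by blast+
      then show "gsum \<phi> p q / (eps_sym (q div 2) * sqrt (2 * real q)) = gw \<phi> q (int p) / (2 * gs (q div 2) (2 * int p) 0)"
        using sqrt_half[OF q2] unfolding r_def[symmetric] by (simp add: gsum_eq_gw)
    qed (auto intro!: continuous_intros)
    then show ?thesis by (simp only: Gm)
  qed
  have c7: "conv_distr (sample_law D (\<lambda>p q. cmod (gsum \<phi> p q) / sqrt (2 * real q)))
       (lawT (\<lambda>x. cmod (Gplus \<phi> x))) (through ?Q4)"
  proof -
    have "conv_distr (sample_law D (\<lambda>p q. cmod (gsum \<phi> p q) / sqrt (2 * real q)))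
       (lawT (\<lambda>x. cmod (moduli_class.Glim 2 UNIV \<phi> x))) (through ?Q4)"
    proof (rule sampled_class.conv_distr_single[OF four, where h=cmod])
      fix q p assume q: "q \<in> ?Q4" and p: "coprime (int p) (int q)"
      have "gs q (int p) 0 / sqrt q \<in> corners" using q p by (intro gs_four_dvd_values) auto
      moreover have "cmod z = sqrt 2" if "z \<in> corners" for z
        using that unfolding corners_def by (auto simp: cmod_def)
      ultimately have "cmod (gs q (int p) 0 / sqrt q) = sqrt 2" by blast
      then have "cmod (gs q (int p) 0) = sqrt (2 * real q)" using q by (simp add: norm_divide divide_eq_eq real_sqrt_mult)
      then show "cmod (gsum \<phi> p q) / sqrt (2 * real q) = cmod (gw \<phi> q (int p) / gs q (int p) 0)"
        by (simp add: gsum_eq_gw norm_divide)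
    qed (auto intro!: continuous_intros)
    then show ?thesis by (simp only: Gp)
  qed
  have c8: "conv_distr (sample_law D (\<lambda>p q. cmod (gsum \<phi> p q) / sqrt (real q)))
       (lawT (\<lambda>x. cmod (Gfull \<phi> x))) (through ?Q1)"
  proof -
    have "conv_distr (sample_law D (\<lambda>p q. cmod (gsum \<phi> p q) / sqrt (real q)))
       (lawT (\<lambda>x. cmod (moduli_class.Glim 1 UNIV \<phi> x))) (through ?Q1)"
      by (rule sampled_class.conv_distr_single[OF odd, where h=cmod])
        (auto simp: gsum_eq_gw norm_divide norm_gs_odd_sqrt intro!: continuous_intros)
    then show ?thesis by (simp only: Gf)
  qed
  have c9: "conv_distr (sample_law D (\<lambda>p q. cmod (gsum \<phi> p q) / sqrt (2 * real q)))
       (lawT (\<lambda>x. cmod (Gminus \<phi> x))) (through ?Q2)"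
  proof -
    have "conv_distr (sample_law D (\<lambda>p q. cmod (gsum \<phi> p q) / sqrt (2 * real q)))
       (lawT (\<lambda>x. cmod (moduli_class.Glim 1 {k. odd k} \<phi> x))) (through ?Q2)"
    proof (rule sampled_class.conv_distr_single[OF twice, where h=cmod])
      fix q p assume q: "q \<in> ?Q2" and p: "coprime (int p) (int q)"
      define r where "r = q div 2"
      have q2: "q mod 4 = 2" using q by simp
      have r: "q = 2 * r" "odd r" unfolding r_def by (rule half[OF q2])+
      have "coprime (2 * int p) (int r)" using p r by simp
      then have "cmod (gs r (2 * int p) 0) = sqrt r" using r by (intro norm_gs_odd_sqrt)
      then show "cmod (gsum \<phi> p q) / sqrt (2 * real q) = cmod (gw \<phi> q (int p) / (2 * gs (q div 2) (2 * int p) 0))"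
        using sqrt_half[OF q2] unfolding r_def[symmetric] by (simp add: gsum_eq_gw norm_divide norm_mult)
    qed (auto intro!: continuous_intros)
    then show ?thesis by (simp only: Gm)
  qed
  show ?thesis using c1 c2 c3 c4 c5 c6 c7 c8 c9 by (intro conjI)
qed

end
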